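(* Let $\mathcal{P} = \{(t,t^2) : t \in \mathbb{R}\} \subset \mathbb{R}^2$ be the parabola, and let $$A = \left\{(\alpha,\beta) \in (0,1)^2 : \text{ either } \alpha < \frac{(1-\beta)^2}{2-\beta} \text{ or } \beta < \frac{(1-\alpha)^2}{2-\alpha}\right\}.$$ (1) (Two parallel lines) Let $c_1, c_2 > 0$ and $$\Lambda = \{(\pm c_1 n^{\alpha}, 0) : n \in \mathbb{N}\} \cup \{(\pm c_2 n^{\beta}, 1) : n \in \mathbb{N}\}.$$ If $(\alpha,\beta) \in A$, then $(\mathcal{P},\Lambda)$ is a weak uniqueness pair. (2) (Three lines intersecting at a point) Let $c_1, c_2, c_3 > 0$, let $a, d \in \mathbb{R}$ with $a \neq 0$, $d \neq 0$ and $a \neq d$, and let $$\Lambda = \{\pm(c_1 n^{-\alpha}, a\, c_1 n^{-\alpha}) : n \in \mathbb{N}^*\} \cup \{\pm(c_2 n^{\beta/2}, 0) : n \in \mathbb{N}\} \cup \{\pm(c_3 n^{-\gamma}, d\, c_3 n^{-\gamma}) : n \in \mathbb{N}^*\}.$$ If $(\alpha,\beta) \in A$ and $(\gamma,\beta) \in A$, then $(\mathcal{P},\Lambda)$ is a weak uniqueness pair.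
   Context: Conventions: $\mathbb{N} = \{0,1,2,3,\dots\}$ and $\mathbb{N}^* = \{1,2,3,\dots\}$. In the sets $\Lambda$, both choices of each sign $\pm$ are included. For a finite complex Borel measure $\mu$ on $\mathbb{R}^2$, its Fourier transform is $$\widehat{\mu}(\xi,\eta) = \int_{\mathbb{R}^2} e^{-2\pi i(\xi x + \eta y)}\, \mathrm{d}\mu(x,y).$$ Definition (weak uniqueness pair). Let $\Gamma \subset \mathbb{R}^2$ be an algebraic curve and $\Lambda \subset \mathbb{R}^2$ a set. The pair $(\Gamma,\Lambda)$ is a weak uniqueness pair if there is a constant $C = C(\Gamma,\Lambda) > 0$ such that the following holds: whenever $\mu$ is a complex Borel measure with $\mathrm{supp}(\mu) \subset \Gamma$, absolutely continuous with respect to the arc-length measure of $\Gamma$, with $\mu \in L^1(\Gamma)$ (i.e. its density with respect to arc length is integrable, so $\mu$ is finite), and satisfying $$\widehat{\mu}|_{\Lambda} = 0 \quad\text{and}\quad (1+|x|^C)\,|\widehat{\mu}(x,0)| \in L^1(\mathbb{R}),$$ then $\mu \equiv 0$. *)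

theory Defs
  imports "HOL-Analysis.Analysis" "HOL-Computational_Algebra.Polynomial"
begin

text \<open>
  A bivariate real polynomial is an element of \<open>\<real>[x][y]\<close>; its value at \<open>(x, y)\<close> is
  \<open>poly (poly p [:y:]) x\<close>.
\<close>

definition algebraic_curve :: "(real \<times> real) set \<Rightarrow> bool" where
  "algebraic_curve \<Gamma> \<longleftrightarrow>
     (\<exists>p :: real poly poly. (\<forall>c. p \<noteq> [:[:c:]:]) \<and> \<Gamma> = {(x, y). poly (poly p [:y:]) x = 0})"

text \<open>
  One-dimensional Hausdorff (outer) measure for the Euclidean metric on the plane. Covering sets
  must be bounded because \<^const>\<open>diameter\<close> is unspecified on unbounded sets.
\<close>

definition hausdorff1 :: "(real \<times> real) set \<Rightarrow> ennreal" where
  "hausdorff1 E =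
     (SUP \<delta>\<in>{0<..}.
        INF U\<in>{U :: nat \<Rightarrow> (real \<times> real) set.
                 E \<subseteq> (\<Union>n. U n) \<and> (\<forall>n. bounded (U n) \<and> diameter (U n) \<le> \<delta>)}.
          \<Sum>n. ennreal (diameter (U n)))"

text \<open>
  Arc length on a curve is one-dimensional Hausdorff measure restricted to it. The set function
  below is a metric outer measure, hence countably additive on Borel sets, so
  \<^const>\<open>measure_of\<close> does not fall back to the zero measure.
\<close>

definition arc_length_measure :: "(real \<times> real) set \<Rightarrow> (real \<times> real) measure" where
  "arc_length_measure \<Gamma> = measure_of UNIV (sets borel) (\<lambda>E. hausdorff1 (E \<inter> \<Gamma>))"

text \<open>
  A complex measure is a countably additive complex set function on the Borel sets; its values on
  other sets are irrelevant. (Taking all sets empty gives value 0 on the empty set.)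
\<close>

definition complex_borel_measure :: "((real \<times> real) set \<Rightarrow> complex) \<Rightarrow> bool" where
  "complex_borel_measure \<mu> \<longleftrightarrow>
     (\<forall>A :: nat \<Rightarrow> (real \<times> real) set. range A \<subseteq> sets borel \<longrightarrow> disjoint_family A \<longrightarrow>
        (\<lambda>n. \<mu> (A n)) sums \<mu> (\<Union>n. A n))"

text \<open>
  Positive part in the Jordan decomposition of a finite signed measure \<open>\<nu>\<close>; here
  \<^const>\<open>ennreal\<close> sends negative reals to 0.
\<close>

definition jordan_pos :: "((real \<times> real) set \<Rightarrow> real) \<Rightarrow> (real \<times> real) measure" where
  "jordan_pos \<nu> =
     measure_of UNIV (sets borel) (\<lambda>E. SUP F\<in>{F \<in> sets borel. F \<subseteq> E}. ennreal (\<nu> F))"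

definition signed_integral ::
    "((real \<times> real) set \<Rightarrow> real) \<Rightarrow> (real \<times> real \<Rightarrow> complex) \<Rightarrow> complex" where
  "signed_integral \<nu> g =
     (\<integral>z. g z \<partial>jordan_pos \<nu>) - (\<integral>z. g z \<partial>jordan_pos (\<lambda>E. - \<nu> E))"

definition complex_measure_integral ::
    "((real \<times> real) set \<Rightarrow> complex) \<Rightarrow> (real \<times> real \<Rightarrow> complex) \<Rightarrow> complex" where
  "complex_measure_integral \<mu> g =
     signed_integral (\<lambda>E. Re (\<mu> E)) g + \<i> * signed_integral (\<lambda>E. Im (\<mu> E)) g"

definition fourier :: "((real \<times> real) set \<Rightarrow> complex) \<Rightarrow> real \<times> real \<Rightarrow> complex" where
  "fourier \<mu> = (\<lambda>(\<xi>, \<eta>). complex_measure_integral \<mu>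
     (\<lambda>(x, y). exp (- 2 * of_real pi * \<i> * of_real (\<xi> * x + \<eta> * y))))"

text \<open>
  A point lies in the support iff none of its open neighbourhoods is null for the total variation,
  i.e. each contains a Borel set on which \<open>\<mu>\<close> does not vanish.
\<close>

definition supp :: "((real \<times> real) set \<Rightarrow> complex) \<Rightarrow> (real \<times> real) set" where
  "supp \<mu> = {z. \<forall>U. open U \<longrightarrow> z \<in> U \<longrightarrow> (\<exists>E\<in>sets borel. E \<subseteq> U \<and> \<mu> E \<noteq> 0)}"

definition abs_cont_wrt ::
    "((real \<times> real) set \<Rightarrow> complex) \<Rightarrow> (real \<times> real) measure \<Rightarrow> bool" where
  "abs_cont_wrt \<mu> \<sigma> \<longleftrightarrow> (\<forall>E\<in>null_sets \<sigma>. \<mu> E = 0)"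

definition has_L1_density ::
    "((real \<times> real) set \<Rightarrow> complex) \<Rightarrow> (real \<times> real) measure \<Rightarrow> bool" where
  "has_L1_density \<mu> \<sigma> \<longleftrightarrow>
     (\<exists>f. integrable \<sigma> f \<and> (\<forall>E\<in>sets borel. \<mu> E = (LINT z:E|\<sigma>. f z)))"

definition weak_uniqueness_pair :: "(real \<times> real) set \<Rightarrow> (real \<times> real) set \<Rightarrow> bool" where
  "weak_uniqueness_pair \<Gamma> \<Lambda> \<longleftrightarrow>
     algebraic_curve \<Gamma> \<and>
     (\<exists>C>0. \<forall>\<mu>.
        complex_borel_measure \<mu> \<longrightarrow>
        supp \<mu> \<subseteq> \<Gamma> \<longrightarrow>
        abs_cont_wrt \<mu> (arc_length_measure \<Gamma>) \<longrightarrow>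
        has_L1_density \<mu> (arc_length_measure \<Gamma>) \<longrightarrow>
        (\<forall>p\<in>\<Lambda>. fourier \<mu> p = 0) \<longrightarrow>
        integrable lborel (\<lambda>x. (1 + \<bar>x\<bar> powr C) * cmod (fourier \<mu> (x, 0))) \<longrightarrow>
        (\<forall>E\<in>sets borel. \<mu> E = 0))"

definition parabola :: "(real \<times> real) set" where
  "parabola = {(t, t\<^sup>2) | t. True}"

definition exponent_region :: "(real \<times> real) set" where
  "exponent_region =
     {(\<alpha>, \<beta>). 0 < \<alpha> \<and> \<alpha> < 1 \<and> 0 < \<beta> \<and> \<beta> < 1 \<and>
        (\<alpha> < (1 - \<beta>)\<^sup>2 / (2 - \<beta>) \<or> \<beta> < (1 - \<alpha>)\<^sup>2 / (2 - \<alpha>))}"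

text \<open>The variable \<open>s\<close> is the sign; \<^term>\<open>0 powr r = (0 :: real)\<close> agrees with \<open>0\<^sup>r\<close> for \<open>r > 0\<close>.\<close>

definition two_lines :: "real \<Rightarrow> real \<Rightarrow> real \<Rightarrow> real \<Rightarrow> (real \<times> real) set" where
  "two_lines c1 c2 \<alpha> \<beta> =
     {(s * (c1 * real n powr \<alpha>), 0) | (s :: real) (n :: nat). s \<in> {1, -1}} \<union>
     {(s * (c2 * real n powr \<beta>), 1) | (s :: real) (n :: nat). s \<in> {1, -1}}"

definition three_lines ::
    "real \<Rightarrow> real \<Rightarrow> real \<Rightarrow> real \<Rightarrow> real \<Rightarrow> real \<Rightarrow> real \<Rightarrow> real \<Rightarrow> (real \<times> real) set" where
  "three_lines c1 c2 c3 a d \<alpha> \<beta> \<gamma> =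
     {s *\<^sub>R (c1 * real n powr (- \<alpha>), a * c1 * real n powr (- \<alpha>))
        | (s :: real) (n :: nat). s \<in> {1, -1} \<and> n \<ge> 1} \<union>
     {s *\<^sub>R (c2 * real n powr (\<beta> / 2), 0) | (s :: real) (n :: nat). s \<in> {1, -1}} \<union>
     {s *\<^sub>R (c3 * real n powr (- \<gamma>), d * c3 * real n powr (- \<gamma>))
        | (s :: real) (n :: nat). s \<in> {1, -1} \<and> n \<ge> 1}"

end

theory Submission
  imports Defs "HOL-Probability.Probability" "HOL-Real_Asymp.Real_Asymp"
begin

text \<open>
  A measure \<open>\<mu>\<close> on the parabola that is absolutely continuous with respect to arc length is
  the image of \<open>F(t) dt\<close> with \<open>F \<in> L\<^sup>1\<close>, so its Fourier transform is
  \<open>\<integral> F(t) exp(-2\<pi>i(\<xi>t + \<eta>t\<^sup>2)) dt\<close>. Since a chirp is, up to a constant, the Fourier transform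
  of a chirp, vanishing on a further line becomes vanishing of the Fourier transform of a function
  \<open>G\<close> built from \<open>ft F\<close>. For parallel lines \<open>G\<close> is \<open>ft F\<close> times a chirp. For a line of slope
  \<open>a\<close> through the origin, \<open>G\<close> is the even part of the modulated \<open>ft F\<close> as a function of \<open>y = x\<^sup>2\<close>,
  and the zeros \<open>n powr (- \<alpha>)\<close> turn into \<open>n powr \<alpha>\<close>; two different slopes then give two
  incompatible symmetries of \<open>ft F\<close>.

  It remains to see that \<open>G = 0\<close> if \<open>G\<close> vanishes at \<open>\<plusminus>c n powr \<beta>\<close> and \<open>ft G\<close> at \<open>\<plusminus>c' n powr \<alpha>\<close>,
  where \<open>\<alpha> + \<beta> < 1\<close>.
  The interpolation error at the \<open>k\<close> nearest zeros shows that \<open>k\<close> moments of \<open>G\<close> make \<open>ft G\<close>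
  decay like \<open>(C \<bar>x\<bar> powr (1 - 1/\<alpha>)) ^ k\<close>, with no loss in \<open>k\<close> because the factorials cancel.
  So \<open>k\<close> moments of \<open>G\<close> control about \<open>q k\<close> moments of \<open>ft G\<close>, \<open>q = 1/\<alpha> - 1\<close>, and these in turn
  about \<open>p q k\<close> moments of \<open>G\<close>, \<open>p = 1/\<beta> - 1\<close>, with constants exponential in \<open>k\<close>.
  Since \<open>p q > 1\<close>, a finite number of moments bootstraps to moments of size \<open>R ^ k\<close>
  for infinitely many \<open>k\<close>. Then \<open>ft G\<close> vanishes near infinity, and interpolating at
  points there makes it vanish everywhere.
\<close>

subsection \<open>Interpolation at the zeros of a Fourier transform\<close>

text \<open>Differentiation under the integral sign. The mean value inequality bounds the difference
  quotients by \<open>D\<close>, so dominated convergence applies along any sequence of nonzero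
  increments tending to 0.\<close>

lemma has_vector_derivative_integral:
  fixes K K' :: "real \<Rightarrow> 'a \<Rightarrow> 'b::{banach, second_countable_topology}"
  assumes int: "\<And>s. integrable M (K s)"
    and der: "\<And>s x. ((\<lambda>s. K s x) has_vector_derivative K' s x) (at s)"
    and bound: "\<And>s x. norm (K' s x) \<le> D x"
    and D: "integrable M D"
    and meas: "\<And>s. K' s \<in> borel_measurable M"
  shows "((\<lambda>s. LINT x|M. K s x) has_vector_derivative (LINT x|M. K' s x)) (at s)"
proof -
  have int': "integrable M (K' s)" for s
    using D meas by (rule Bochner_Integration.integrable_bound) (use order_trans[OF bound abs_ge_self] in auto)
  have lip: "norm (K (s + h) x - K s x) \<le> D x * \<bar>h\<bar>" for h x
  proof -
    have "norm (K (s + h) x - K s x) \<le> D x * norm (s + h - s)"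
    proof (rule differentiable_bound[of UNIV "\<lambda>s. K s x" "\<lambda>s h. h *\<^sub>R K' s x" "D x" "s + h" s])
      show "((\<lambda>s. K s x) has_derivative (\<lambda>h. h *\<^sub>R K' t x)) (at t within UNIV)" for t
        using der[of x t] by (simp add: has_vector_derivative_def)
      show "onorm (\<lambda>h. h *\<^sub>R K' t x) \<le> D x" for t
        by (rule onorm_le) (use mult_left_mono[OF bound[of t x] abs_ge_zero] in \<open>auto simp: mult.commute\<close>)
    qed auto
    then show ?thesis by simp
  qed
  show ?thesis
    unfolding has_vector_derivative_def has_derivative_at
  proof (intro conjI bounded_linear_scaleR_left)
    show "(\<lambda>h. norm ((LINT x|M. K (s + h) x) - (LINT x|M. K s x) - h *\<^sub>R (LINT x|M. K' s x)) / norm h)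
      \<midarrow>0\<rightarrow> 0"
      unfolding tendsto_at_iff_sequentially
    proof (intro allI impI, unfold comp_def)
      fix X :: "nat \<Rightarrow> real"
      assume X: "\<forall>i. X i \<in> UNIV - {0}" "X \<longlonglongrightarrow> 0"
      then have Xat: "filterlim X (at 0) sequentially"
        by (auto simp: filterlim_at)
      \<comment> \<open>The error of the difference quotient; it tends to 0 pointwise and is
        dominated by \<open>2 * D x\<close>.\<close>
      define Q where "Q n x = (inverse (X n)) *\<^sub>R (K (s + X n) x - K s x - X n *\<^sub>R K' s x)" for n x
      have "(\<lambda>n. LINT x|M. Q n x) \<longlonglongrightarrow> (LINT x|M. 0)"
      proof (rule integral_dominated_convergence)
        show "integrable M (\<lambda>x. 2 * D x)" using D by simp
        show "Q n \<in> borel_measurable M" for n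
          unfolding Q_def using int meas by (intro borel_measurable_scaleR borel_measurable_diff borel_measurable_const) auto
        show "AE x in M. (\<lambda>n. Q n x) \<longlonglongrightarrow> 0"
        proof (intro always_eventually allI)
          fix x
          have "(\<lambda>h. norm (K (s + h) x - K s x - h *\<^sub>R K' s x) / norm h) \<midarrow>0\<rightarrow> 0"
            using der[of x s] unfolding has_vector_derivative_def has_derivative_at by auto
          from filterlim_compose[OF this Xat]
          have "(\<lambda>n. norm (Q n x)) \<longlonglongrightarrow> 0"
            by (simp add: Q_def divide_inverse mult.commute)
          then show "(\<lambda>n. Q n x) \<longlonglongrightarrow> 0" by (rule tendsto_norm_zero_cancel)
        qed
        show "AE x in M. norm (Q n x) \<le> 2 * D x" for n
        proof (intro always_eventually allI)
          fix x
          have "norm (K (s + X n) x - K s x - X n *\<^sub>R K' s x) \<le> D x * \<bar>X n\<bar> + \<bar>X n\<bar> * D x"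
            using lip[of "X n" x] bound[of s x]
            by (intro order_trans[OF norm_triangle_ineq4[of "K (s + X n) x - K s x"]] add_mono) (auto intro: mult_left_mono)
          then show "norm (Q n x) \<le> 2 * D x"
            using X(1) by (simp add: Q_def divide_simps)
        qed
      qed auto
      moreover have "(LINT x|M. Q n x) = inverse (X n) *\<^sub>R ((LINT x|M. K (s + X n) x) - (LINT x|M. K s x) - X n *\<^sub>R (LINT x|M. K' s x))" for n
        unfolding Q_def using int int' by simp
      ultimately have "(\<lambda>n. norm (inverse (X n) *\<^sub>R ((LINT x|M. K (s + X n) x) - (LINT x|M. K s x) - X n *\<^sub>R (LINT x|M. K' s x)))) \<longlonglongrightarrow> 0"
        by (simp only: tendsto_norm_zero_iff) simp
      then show "(\<lambda>n. norm ((LINT x|M. K (s + X n) x) - (LINT x|M. K s x) - X n *\<^sub>R (LINT x|M. K' s x)) / norm (X n)) \<longlonglongrightarrow> 0"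
        by (simp add: divide_inverse mult.commute)
    qed
  qed
qed

text \<open>The location \<open>T \<subseteq> {..<Max S}\<close> carries the induction: a new
  largest point \<open>b\<close> yields a zero of \<open>f'\<close> strictly between
  \<open>Max A\<close> and \<open>b\<close>, which therefore differs from all zeros found
  before.\<close>

lemma Rolle_finite:
  fixes f f' :: "real \<Rightarrow> real"
  assumes der: "\<And>x. (f has_real_derivative f' x) (at x)"
    and "finite S" "S \<noteq> {}" "\<And>x. x \<in> S \<Longrightarrow> f x = 0"
  shows "\<exists>T. finite T \<and> Suc (card T) = card S \<and> T \<subseteq> {..<Max S} \<and> (\<forall>x\<in>T. f' x = 0)"
  using assms(2-4)
proof (induction S rule: finite_linorder_max_induct)
  case empty
  then show ?case by simp
next
  case (insert b A)
  show ?case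
  proof (cases "A = {}")
    case True
    then show ?thesis by (intro exI[of _ "{}"]) auto
  next
    case False
    with insert obtain T where T: "finite T" "Suc (card T) = card A" "T \<subseteq> {..<Max A}" "\<forall>x\<in>T. f' x = 0"
      by auto
    have m: "Max A \<in> A" "Max A < b" using False insert by auto
    have "\<exists>z>Max A. z < b \<and> f' z = 0"
    proof -
      have "\<exists>z. Max A < z \<and> z < b \<and> (\<lambda>h. f' z * h) = (\<lambda>v. 0)"
      proof (rule Rolle_deriv[of "Max A" b f "\<lambda>z h. f' z * h"])
        show "continuous_on {Max A..b} f"
          using der by (intro continuous_at_imp_continuous_on) (blast intro: DERIV_isCont)
        show "(f has_derivative (\<lambda>h. f' x * h)) (at x)" for x
          using der[of x] by (simp add: has_field_derivative_def)
      qed (use m insert.prems in auto)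
      then show ?thesis by (metis mult.right_neutral)
    qed
    then obtain z where z: "Max A < z" "z < b" "f' z = 0" by auto
    have "z \<notin> T" using T z by auto
    moreover have "Max (insert b A) = b"
      using insert by (intro Max_eqI) (auto intro: less_imp_le)
    moreover have "b \<notin> A" using insert by auto
    ultimately show ?thesis
      using T z m insert.hyps by (intro exI[of _ "insert z T"]) auto
  qed
qed

text \<open>\<open>f j\<close> stands for the \<open>j\<close>-th derivative of \<open>f 0\<close>,
  and each differentiation costs one zero.\<close>

lemma Rolle_iterated:
  fixes f :: "nat \<Rightarrow> real \<Rightarrow> real"
  assumes der: "\<And>j x. j < k \<Longrightarrow> (f j has_real_derivative f (Suc j) x) (at x)"
    and "finite S" "card S = Suc k" "\<And>x. x \<in> S \<Longrightarrow> f 0 x = 0"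
  shows "\<exists>x. f k x = 0"
  using assms
proof (induction k arbitrary: f S)
  case 0
  then show ?case by (metis card.empty nat.distinct(1) all_not_in_conv)
next
  case (Suc k)
  have "S \<noteq> {}" using Suc.prems by auto
  from Rolle_finite[of "f 0" "f 1", OF _ Suc.prems(2) this] Suc.prems
  obtain T where "finite T" "Suc (card T) = card S" "\<forall>x\<in>T. f 1 x = 0" by auto
  then show ?case using Suc.prems Suc.IH[of "\<lambda>j. f (Suc j)" T] by auto
qed

text \<open>The error formula of Lagrange interpolation. Since \<open>f 0\<close> vanishes at all
  nodes, the interpolating polynomial is 0 and the error is \<open>f 0\<close> itself.\<close>

lemma interpolation_error_real:
  fixes f :: "nat \<Rightarrow> real \<Rightarrow> real"
  assumes der: "\<And>j x. j < k \<Longrightarrow> (f j has_real_derivative f (Suc j) x) (at x)"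
    and S: "finite S" "card S = k" "\<And>x. x \<in> S \<Longrightarrow> f 0 x = 0"
    and bound: "\<And>x. \<bar>f k x\<bar> \<le> M"
  shows "\<bar>f 0 x\<bar> \<le> M * (\<Prod>t\<in>S. \<bar>x - t\<bar>) / fact k"
proof (cases "x \<in> S")
  case True
  have "M \<ge> 0" using bound[of 0] by linarith
  then show ?thesis using S True by (auto intro!: mult_nonneg_nonneg prod_nonneg divide_nonneg_nonneg)
next
  case False
  define p where "p = (\<Prod>t\<in>S. [:-t, 1:])"
  have deg: "degree p = k"
    using S unfolding p_def by (auto simp: degree_prod_sum_eq)
  have "lead_coeff p = 1"
    using S unfolding p_def lead_coeff_prod by simp
  with deg have dp: "degree p = k" "coeff p k = 1"
    by auto
  define P where "P = poly p x"
  have P: "P = (\<Prod>t\<in>S. x - t)" by (simp add: P_def p_def poly_prod)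
  have P0: "P \<noteq> 0" using False S(1) by (force simp: P)
  \<comment> \<open>Subtracting the multiple of the nodal polynomial \<open>p\<close> that matches
    \<open>f 0\<close> at \<open>x\<close> gives a function with \<open>k + 1\<close> zeros, namely
    the nodes and \<open>x\<close>; its \<open>k\<close>-th derivative then vanishes
    somewhere.\<close>
  define g where "g j t = f j t - f 0 x / P * poly ((pderiv ^^ j) p) t" for j t
  have "\<exists>t. g k t = 0"
  proof (rule Rolle_iterated[of k g "insert x S"])
    show "(g j has_real_derivative g (Suc j) t) (at t)" if "j < k" for j t
      unfolding g_def by (auto intro!: derivative_eq_intros der[OF that] poly_DERIV simp: P0)
    show "g 0 t = 0" if "t \<in> insert x S" for t
    proof (cases "t = x")
      case True
      then show ?thesis using P0 by (simp add: g_def flip: P_def)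
    next
      case False
      then have "t \<in> S" using that by auto
      then show ?thesis using S by (auto simp: g_def p_def poly_prod)
    qed
  qed (use S False in auto)
  then obtain t where t: "g k t = 0" by auto
  \<comment> \<open>\<open>p\<close> is monic of degree \<open>k\<close>.\<close>
  have "(pderiv ^^ k) p = [:fact k:]"
  proof -
    have "degree ((pderiv ^^ k) p) = 0" by (simp add: degree_higher_pderiv dp)
    moreover have "coeff ((pderiv ^^ k) p) 0 = fact k"
      using dp by (simp add: coeff_higher_pderiv pochhammer_fact)
    ultimately show ?thesis by (metis degree_0_id)
  qed
  with t have "f 0 x = f k t * P / fact k"
    using P0 by (simp add: g_def field_simps)
  then have "\<bar>f 0 x\<bar> = \<bar>f k t\<bar> * \<bar>P\<bar> / fact k" by (simp add: abs_mult)
  also have "\<dots> \<le> M * \<bar>P\<bar> / fact k"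
    using bound by (intro divide_right_mono mult_right_mono) auto
  finally show ?thesis by (simp add: P abs_prod)
qed

text \<open>The transform in angular frequency, without normalisation: inversion carries a factor
  \<open>2 * pi\<close>, and the frequency \<open>\<xi>\<close> of \<open>fourier\<close>
  corresponds to \<open>2 * pi * \<xi>\<close> here.\<close>

definition ft :: "(real \<Rightarrow> complex) \<Rightarrow> real \<Rightarrow> complex" where
  "ft F x = (LINT y|lborel. F y * cis (- (x * y)))"

lemma borel_measurable_cis [measurable]: "cis \<in> borel_measurable borel"
  by (intro borel_measurable_continuous_onI continuous_intros)

text \<open>The \<open>k\<close>-th derivative of \<open>ft F\<close> is the transform of
  \<open>F y * (- \<i> * y) ^ k\<close>, hence bounded by the moment of order \<open>k\<close>, and
  the real error formula applies.\<close>

lemma ft_interpolation: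
  assumes F[measurable]: "F \<in> borel_measurable borel"
    and int: "integrable lborel (\<lambda>y. (1 + \<bar>y\<bar>) ^ k * norm (F y))"
    and S: "finite S" "card S = k" "\<And>x. x \<in> S \<Longrightarrow> ft F x = 0"
  shows "norm (ft F x) \<le> (LINT y|lborel. (1 + \<bar>y\<bar>) ^ k * norm (F y)) * (\<Prod>t\<in>S. \<bar>x - t\<bar>) / fact k"
proof -
  have pw: "\<bar>y\<bar> ^ j \<le> (1 + \<bar>y\<bar>) ^ k" if "j \<le> k" for y :: real and j
    by (rule order_trans[OF power_mono[of "\<bar>y\<bar>" "1 + \<bar>y\<bar>" j] power_increasing[OF that]]) auto
  define g where "g j s y = F y * (- \<i> * of_real y) ^ j * cis (- (s * y))" for j and s y :: real
  have gm[measurable]: "g j s \<in> borel_measurable borel" for j s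
    unfolding g_def by measurable
  have gn: "norm (g j s y) \<le> (1 + \<bar>y\<bar>) ^ k * norm (F y)" if "j \<le> k" for j s y
    using mult_right_mono[OF pw[OF that], of "norm (F y)" y] by (simp add: g_def norm_mult norm_power mult.commute)
  have gi: "integrable lborel (g j s)" if "j \<le> k" for j s
    using int by (rule Bochner_Integration.integrable_bound) (use gn[OF that] in \<open>auto intro: order_trans[OF _ abs_ge_self]\<close>)
  have cd: "((\<lambda>s. cis (- (s * y))) has_vector_derivative - \<i> * of_real y * cis (- (s * y))) (at s)" for s y
    unfolding cis_conv_exp
    by (rule has_vector_derivative_real_field derivative_eq_intros | simp)+
  have gd: "((\<lambda>s. g j s y) has_vector_derivative g (Suc j) s y) (at s)" for j s y
    unfolding g_def by (rule has_vector_derivative_eq_rhs[OF has_vector_derivative_mult_right[OF cd]]) simp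
  define h where "h j s = (LINT y|lborel. g j s y)" for j s
  have hd: "(h j has_vector_derivative h (Suc j) s) (at s)" if "j < k" for j s
    unfolding h_def
    by (rule has_vector_derivative_integral[where D="\<lambda>y. (1 + \<bar>y\<bar>) ^ k * norm (F y)"])
       (use that gi gd gn int in auto)
  have h0: "h 0 = ft F" unfolding h_def g_def ft_def by auto
  \<comment> \<open>A unimodular \<open>u\<close> rotates the value at the fixed point
    \<open>x\<close> onto the nonnegative reals, so that the real error formula for
    \<open>Re (u * ft F s)\<close> controls the full norm at \<open>x\<close>.\<close>
  obtain u where u: "norm u = 1" "norm (ft F x) = Re (u * ft F x)"
  proof (cases "ft F x = 0")
    case True then show ?thesis by (intro that[of 1]) auto
  next
    case False
    then show ?thesis
      by (intro that[of "cnj (ft F x) / norm (ft F x)"])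
         (auto simp: norm_divide complex_mod_cnj mult.commute complex_norm_square[symmetric] power2_eq_square simp flip: of_real_mult)
  qed
  have "\<bar>Re (u * h 0 x)\<bar> \<le> (LINT y|lborel. (1 + \<bar>y\<bar>) ^ k * norm (F y)) * (\<Prod>t\<in>S. \<bar>x - t\<bar>) / fact k"
  proof (rule interpolation_error_real[of k "\<lambda>j s. Re (u * h j s)"])
    show "((\<lambda>s. Re (u * h j s)) has_real_derivative Re (u * h (Suc j) s)) (at s)" if "j < k" for j s
      using bounded_linear.has_vector_derivative[OF bounded_linear_Re has_vector_derivative_mult_right[OF hd[OF that]]]
      by (simp add: has_real_derivative_iff_has_vector_derivative)
    show "\<bar>Re (u * h k s)\<bar> \<le> (LINT y|lborel. (1 + \<bar>y\<bar>) ^ k * norm (F y))" for s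
    proof -
      have "\<bar>Re (u * h k s)\<bar> \<le> norm (h k s)"
        using abs_Re_le_cmod[of "u * h k s"] u by (simp add: norm_mult)
      also have "\<dots> \<le> (LINT y|lborel. norm (g k s y))" unfolding h_def by (rule integral_norm_bound)
      also have "\<dots> \<le> (LINT y|lborel. (1 + \<bar>y\<bar>) ^ k * norm (F y))"
        by (intro integral_mono integrable_norm gi int gn) auto
      finally show ?thesis .
    qed
  qed (use S h0 in auto)
  with u h0 show ?thesis by simp
qed

subsection \<open>Decay from zeros\<close>

text \<open>Mean value theorem together with the monotonicity of \<open>z powr (a - 1)\<close>. It
  estimates the gaps between the zeros \<open>c * real n powr \<alpha>\<close>.\<close>

lemma powr_increment_le:
  fixes a x y :: real
  assumes "0 < a" "a \<le> 1" "0 < x" "0 \<le> y"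
  shows "(x + y) powr a - x powr a \<le> y * x powr (a - 1)"
proof (cases "y = 0")
  case False
  then have "\<exists>z. x < z \<and> z < x + y \<and> (x + y) powr a - x powr a = (x + y - x) * (a * z powr (a - 1))"
    using assms by (intro MVT2) (auto intro!: derivative_eq_intros)
  then obtain z where z: "x < z" "(x + y) powr a - x powr a = y * (a * z powr (a - 1))"
    by auto
  have "a * z powr (a - 1) \<le> 1 * x powr (a - 1)"
    using z assms by (intro mult_mono powr_mono2') auto
  then show ?thesis using assms unfolding z by (intro mult_left_mono) auto
qed auto

lemma borel_measurable_ft [measurable]:
  assumes [measurable]: "F \<in> borel_measurable borel"
  shows "ft F \<in> borel_measurable borel"
  unfolding ft_def by measurable

text \<open>Interpolation at the first \<open>k\<close> zeros beyond \<open>x\<close>, on the same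
  side of the origin. The \<open>j\<close>-th of them lies within \<open>j\<close> times a common
  length of \<open>x\<close>, so the bound on the product of the distances contains
  \<open>fact k\<close>, which cancels the denominator of the error formula.\<close>

lemma ft_decay:
  assumes \<alpha>: "0 < \<alpha>" "\<alpha> < 1" and c: "0 < c"
    and F: "F \<in> borel_measurable borel" "integrable lborel (\<lambda>y. (1 + \<bar>y\<bar>) ^ k * norm (F y))"
    and zeros: "\<And>(n::nat) s. n \<ge> 1 \<Longrightarrow> s \<in> {1, -1} \<Longrightarrow> ft F (s * (c * real n powr \<alpha>)) = 0"
    and x: "c \<le> \<bar>x\<bar>"
  shows "norm (ft F x) \<le> (LINT y|lborel. (1 + \<bar>y\<bar>) ^ k * norm (F y)) *
           (2 * c * (\<bar>x\<bar> / c) powr (1 - 1 / \<alpha>)) ^ k"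
proof -
  \<comment> \<open>The real index with \<open>c * X powr \<alpha> = \<bar>x\<bar>\<close>. The
    hypothesis \<open>c \<le> \<bar>x\<bar>\<close> makes it at least 1, so that its floor
    \<open>n0\<close> is positive.\<close>
  define X where "X = (\<bar>x\<bar> / c) powr (1 / \<alpha>)"
  define n0 where "n0 = nat \<lfloor>X\<rfloor>"
  have X1: "X \<ge> 1" unfolding X_def using x c \<alpha> by (intro ge_one_powr_ge_zero) auto
  have n0: "real n0 \<le> X" "X < real n0 + 1" "n0 \<ge> 1"
    using X1 unfolding n0_def by linarith+
  have Xa: "c * X powr \<alpha> = \<bar>x\<bar>"
    using \<alpha> c by (simp add: X_def powr_powr)
  have Xe: "X powr (\<alpha> - 1) = (\<bar>x\<bar> / c) powr (1 - 1 / \<alpha>)"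
    using \<alpha> by (simp add: X_def powr_powr field_simps)
  define s where "s = (if x \<ge> 0 then 1 else -1 :: real)"
  have s: "s \<in> {1, -1}" by (auto simp: s_def)
  define p where "p j = s * (c * real (n0 + j) powr \<alpha>)" for j
  have inj: "inj_on p {1..k}"
  proof (rule inj_onI)
    fix i j assume "p i = p j"
    then have "real (n0 + i) powr \<alpha> = real (n0 + j) powr \<alpha>" using s c by (auto simp: p_def)
    then have "(real (n0 + i) powr \<alpha>) powr (1/\<alpha>) = (real (n0 + j) powr \<alpha>) powr (1/\<alpha>)" by simp
    then show "i = j" using \<alpha> by (simp add: powr_powr)
  qed
  have dist: "\<bar>x - p j\<bar> \<le> real j * (2 * c * (\<bar>x\<bar> / c) powr (1 - 1 / \<alpha>))" if j: "j \<in> {1..k}" for j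
  proof -
    have "\<bar>x - p j\<bar> = \<bar>\<bar>x\<bar> - c * real (n0 + j) powr \<alpha>\<bar>"
      by (auto simp: p_def s_def)
    also have "\<dots> = c * (real (n0 + j) powr \<alpha> - X powr \<alpha>)"
    proof -
      have "X powr \<alpha> \<le> real (n0 + j) powr \<alpha>" using n0 \<alpha> X1 j by (intro powr_mono2) auto
      then have "\<bar>x\<bar> \<le> c * real (n0 + j) powr \<alpha>" using c by (simp flip: Xa)
      then show ?thesis using Xa by (simp add: algebra_simps)
    qed
    also have "\<dots> \<le> c * (real (n0 + j) powr \<alpha> - real n0 powr \<alpha>)"
      using c n0 \<alpha> by (intro mult_left_mono diff_left_mono powr_mono2) auto
    also have "\<dots> \<le> c * (real j * real n0 powr (\<alpha> - 1))"
      using powr_increment_le[of \<alpha> "real n0" "real j"] c n0 \<alpha> by (intro mult_left_mono) auto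
    \<comment> \<open>From \<open>X < n0 + 1\<close> and \<open>n0 \<ge> 1\<close> follows
      \<open>n0 \<ge> X / 2\<close>; as \<open>\<alpha> - 1\<close> lies between -1 and 0, replacing
      \<open>n0\<close> by \<open>X\<close> costs at most a factor 2.\<close>
    also have "\<dots> \<le> c * (real j * (2 * X powr (\<alpha> - 1)))"
    proof -
      have "real n0 powr (\<alpha> - 1) \<le> (X / 2) powr (\<alpha> - 1)"
        using n0 X1 \<alpha> by (intro powr_mono2') linarith+
      also have "\<dots> = 2 powr (1 - \<alpha>) * X powr (\<alpha> - 1)"
        using X1 by (simp add: powr_divide powr_minus_divide[symmetric] field_simps) (simp add: powr_add[symmetric])
      also have "\<dots> \<le> 2 powr 1 * X powr (\<alpha> - 1)"
        using \<alpha> by (intro mult_right_mono powr_mono) auto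
      finally show ?thesis using c by (intro mult_left_mono) auto
    qed
    finally show ?thesis by (simp add: Xe mult_ac)
  qed
  have "norm (ft F x) \<le> (LINT y|lborel. (1 + \<bar>y\<bar>) ^ k * norm (F y)) * (\<Prod>t\<in>p ` {1..k}. \<bar>x - t\<bar>) / fact k"
  proof (rule ft_interpolation[OF F])
    show "ft F t = 0" if "t \<in> p ` {1..k}" for t
      using that zeros[OF _ s, of "n0 + _"] by (force simp: p_def)
  qed (use inj in \<open>auto simp: card_image\<close>)
  also have "\<dots> = (LINT y|lborel. (1 + \<bar>y\<bar>) ^ k * norm (F y)) * (\<Prod>j=1..k. \<bar>x - p j\<bar>) / fact k"
    using inj by (simp add: prod.reindex)
  also have "\<dots> \<le> (LINT y|lborel. (1 + \<bar>y\<bar>) ^ k * norm (F y)) *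
      (\<Prod>j=1..k. real j * (2 * c * (\<bar>x\<bar> / c) powr (1 - 1 / \<alpha>))) / fact k"
    using dist by (intro divide_right_mono mult_left_mono prod_mono) auto
  also have "\<dots> = (LINT y|lborel. (1 + \<bar>y\<bar>) ^ k * norm (F y)) *
           (2 * c * (\<bar>x\<bar> / c) powr (1 - 1 / \<alpha>)) ^ k"
    by (simp add: prod.distrib fact_prod)
  finally show ?thesis .
qed

lemma integrable_inverse_1_plus_square': "integrable lborel (\<lambda>x::real. inverse (1 + x\<^sup>2))"
  using integrable_inverse_1_plus_square by (simp add: set_integrable_def)

lemma norm_ft_le:
  assumes "F \<in> borel_measurable borel" "integrable lborel F"
  shows "norm (ft F x) \<le> (LINT y|lborel. norm (F y))"
  unfolding ft_def by (rule order_trans[OF integral_norm_bound]) (simp add: norm_mult)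

text \<open>With \<open>q = 1 / \<alpha> - 1\<close>, decay of order \<open>q * k\<close> beats the
  weight of degree \<open>j\<close>, and the margin 2 leaves an integrable inverse square. The
  constant \<open>D\<close> depends only on \<open>\<alpha>\<close> and \<open>c\<close>; its
  uniformity in \<open>F\<close>, \<open>j\<close> and \<open>k\<close> is what allows
  iteration.\<close>

lemma ft_moment_transfer:
  assumes \<alpha>: "0 < \<alpha>" "\<alpha> < 1" and c: "0 < c"
  obtains D where "D \<ge> 1" and "\<And>F j k. F \<in> borel_measurable borel \<Longrightarrow>
    integrable lborel (\<lambda>y. (1 + \<bar>y\<bar>) ^ k * norm (F y)) \<Longrightarrow>
    (\<forall>(n::nat) s. n \<ge> 1 \<longrightarrow> s \<in> {1, -1} \<longrightarrow> ft F (s * (c * real n powr \<alpha>)) = 0) \<Longrightarrow>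
    real j + 2 \<le> (1 / \<alpha> - 1) * real k \<Longrightarrow>
    integrable lborel (\<lambda>x. (1 + \<bar>x\<bar>) ^ j * norm (ft F x)) \<and>
    (LINT x|lborel. (1 + \<bar>x\<bar>) ^ j * norm (ft F x)) \<le> D ^ k * (LINT y|lborel. (1 + \<bar>y\<bar>) ^ k * norm (F y))"
proof -
  define q where "q = 1 / \<alpha> - 1"
  have q: "q > 0" using \<alpha> by (simp add: q_def field_simps)
  \<comment> \<open>Beyond \<open>c'\<close> both the decay estimate and
    \<open>\<bar>x\<bar> \<ge> 1\<close> are available; below it the trivial bound of
    \<open>ft F\<close> by the moment suffices.\<close>
  define c' where "c' = max c 1"
  \<comment> \<open>The second summand serves the range beyond \<open>c'\<close>, the third the
    range below it.\<close>
  define D1 where "D1 = 1 + 2 powr q * (2 * c * c powr q) + (1 + c') powr q"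
  define D2 where "D2 = 3 + c'\<^sup>2"
  define I where "I = max 1 (LINT x|lborel. inverse (1 + x\<^sup>2 :: real))"
  have c': "c' \<ge> 1" "c' \<ge> c" by (auto simp: c'_def)
  have D1: "D1 \<ge> 1" using c by (auto simp: D1_def)
  have D2: "D2 \<ge> 1" by (auto simp: D2_def)
  have "D1 * D2 * I \<ge> 1"
  proof -
    have "1 * 1 * 1 \<le> D1 * D2 * I" using D1 D2 by (intro mult_mono) (auto simp: I_def)
    then show ?thesis by simp
  qed
  moreover {
    fix F and j k :: nat
    assume F[measurable]: "F \<in> borel_measurable borel"
      and int: "integrable lborel (\<lambda>y. (1 + \<bar>y\<bar>) ^ k * norm (F y))"
      and zeros: "\<forall>(n::nat) s. n \<ge> 1 \<longrightarrow> s \<in> {1, -1} \<longrightarrow> ft F (s * (c * real n powr \<alpha>)) = 0"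
      and jk: "real j + 2 \<le> (1 / \<alpha> - 1) * real k"
    define M where "M = (LINT y|lborel. (1 + \<bar>y\<bar>) ^ k * norm (F y))"
    have M0: "M \<ge> 0" unfolding M_def by simp
    have k: "k \<ge> 1" using jk by (cases k) auto
    have jq: "real j + 2 \<le> q * real k" using jk by (simp add: q_def)
    have FM: "norm (ft F x) \<le> M" for x
    proof -
      have le: "norm (F y) \<le> (1 + \<bar>y\<bar>) ^ k * norm (F y)" for y
        using mult_right_mono[OF one_le_power[of "1 + \<bar>y\<bar>" k], of "norm (F y)"] by simp
      have i: "integrable lborel F"
        using int by (rule Bochner_Integration.integrable_bound) (use le in auto)
      show ?thesis unfolding M_def
        by (rule order_trans[OF norm_ft_le[OF F i] integral_mono]) (use le i int in auto)
    qed
    have bound: "(1 + \<bar>x\<bar>) ^ j * norm (ft F x) \<le> D1 ^ k * D2 * M * inverse (1 + x\<^sup>2)" for x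
    proof (cases "c' \<le> \<bar>x\<bar>")
      case True
      then have x1: "\<bar>x\<bar> \<ge> 1" "\<bar>x\<bar> \<ge> c" using c' by auto
      have "norm (ft F x) \<le> M * (2 * c * (\<bar>x\<bar> / c) powr (1 - 1 / \<alpha>)) ^ k"
        unfolding M_def using zeros by (intro ft_decay \<alpha> c F int x1) auto
      also have "(2 * c * (\<bar>x\<bar> / c) powr (1 - 1 / \<alpha>)) ^ k = (2 * c * c powr q) ^ k * \<bar>x\<bar> powr (- (q * k))"
      proof -
        have "(\<bar>x\<bar> / c) powr (1 - 1 / \<alpha>) = c powr q * \<bar>x\<bar> powr (-q)"
          using x1 c by (simp add: q_def powr_divide powr_minus powr_diff field_simps)
        moreover have "(\<bar>x\<bar> powr (-q)) ^ k = \<bar>x\<bar> powr (- (q * k))"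
          using x1 c by (simp add: powr_power mult.commute)
        ultimately show ?thesis by (simp add: power_mult_distrib)
      qed
      finally have 1: "norm (ft F x) \<le> M * ((2 * c * c powr q) ^ k * \<bar>x\<bar> powr (- (q * k)))" .
      have "(1 + \<bar>x\<bar>) ^ j \<le> (2 * \<bar>x\<bar>) ^ j" using x1 by (intro power_mono) auto
      also have "\<dots> = 2 powr (real j) * \<bar>x\<bar> powr (real j)"
        using x1 by (simp add: power_mult_distrib powr_realpow)
      also have "\<dots> \<le> 2 powr (q * k) * \<bar>x\<bar> powr (q * k - 2)"
        using jq x1 by (intro mult_mono powr_mono) auto
      also have "2 powr (q * k) = (2 powr q) ^ k" by (simp add: powr_power mult.commute)
      finally have 2: "(1 + \<bar>x\<bar>) ^ j \<le> (2 powr q) ^ k * \<bar>x\<bar> powr (q * k - 2)" .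
      have "(1 + \<bar>x\<bar>) ^ j * norm (ft F x) \<le>
          (2 powr q) ^ k * \<bar>x\<bar> powr (q * k - 2) * (M * ((2 * c * c powr q) ^ k * \<bar>x\<bar> powr (- (q * k))))"
        using 1 2 by (intro mult_mono) auto
      also have "\<dots> = (2 powr q * (2 * c * c powr q)) ^ k * M * (\<bar>x\<bar> powr (q * k - 2) * \<bar>x\<bar> powr (- (q * k)))"
        by (simp add: power_mult_distrib mult_ac)
      also have "\<bar>x\<bar> powr (q * k - 2) * \<bar>x\<bar> powr (- (q * k)) = inverse (x\<^sup>2)"
        unfolding powr_add[symmetric] using x1 by (simp add: powr_minus powr_numeral)
      also have "(2 powr q * (2 * c * c powr q)) ^ k * M * inverse (x\<^sup>2) \<le> D1 ^ k * M * (D2 * inverse (1 + x\<^sup>2))"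
      proof (intro mult_mono power_mono)
        have "x\<^sup>2 \<ge> 1" using x1 by (metis abs_square_le_1 abs_le_square_iff abs_one one_power2)
        moreover from this have "x \<noteq> 0" by auto
        ultimately have "inverse (x\<^sup>2) \<le> 2 * inverse (1 + x\<^sup>2)"
          by (simp add: divide_simps add_pos_nonneg)
        also have "\<dots> \<le> D2 * inverse (1 + x\<^sup>2)" by (intro mult_right_mono) (auto simp: D2_def)
        finally show "inverse (x\<^sup>2) \<le> D2 * inverse (1 + x\<^sup>2)" .
      qed (use M0 D1 c in \<open>auto simp: D1_def\<close>)
      finally show ?thesis by (simp add: mult_ac)
    next
      case False
      then have "(1 + \<bar>x\<bar>) ^ j \<le> (1 + c') ^ j" by (intro power_mono) auto
      also have "\<dots> = (1 + c') powr (real j)" using c' by (simp add: powr_realpow)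
      also have "\<dots> \<le> (1 + c') powr (q * k)" using c' jq by (intro powr_mono) auto
      also have "\<dots> = ((1 + c') powr q) ^ k" using c' by (simp add: powr_power mult.commute)
      also have "\<dots> \<le> D1 ^ k" using c by (intro power_mono) (auto simp: D1_def)
      finally have 1: "(1 + \<bar>x\<bar>) ^ j \<le> D1 ^ k" .
      have "x\<^sup>2 \<le> c'\<^sup>2" using False c' by (metis abs_le_square_iff abs_of_nonneg linorder_le_cases order_trans zero_le_one)
      then have "1 \<le> D2 * inverse (1 + x\<^sup>2)"
        by (simp add: D2_def field_simps add_pos_nonneg)
      with mult_mono[OF 1 FM[of x]] M0 D1 show ?thesis
        using mult_left_mono[of 1 "D2 * inverse (1 + x\<^sup>2)" "D1 ^ k * M"] by (simp add: mult_ac)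
    qed
    have iI: "integrable lborel (\<lambda>x. D1 ^ k * D2 * M * inverse (1 + x\<^sup>2))"
      by (intro integrable_mult_right integrable_inverse_1_plus_square')
    have i: "integrable lborel (\<lambda>x. (1 + \<bar>x\<bar>) ^ j * norm (ft F x))"
      using iI by (rule Bochner_Integration.integrable_bound)
        (use bound D1 D2 M0 in \<open>auto intro!: AE_I2 simp: abs_mult\<close>)
    have "(LINT x|lborel. (1 + \<bar>x\<bar>) ^ j * norm (ft F x)) \<le> (LINT x|lborel. D1 ^ k * D2 * M * inverse (1 + x\<^sup>2))"
      by (intro integral_mono i iI bound)
    also have "\<dots> = D1 ^ k * D2 * M * (LINT x|lborel. inverse (1 + x\<^sup>2 :: real))" by simp
    \<comment> \<open>\<open>D2\<close> and the integral occur only once; they are absorbed into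
      \<open>k\<close>-th powers, as \<open>D2\<close> and \<open>I\<close> are at least 1 and
      \<open>k \<ge> 1\<close>.\<close>
    also have "\<dots> \<le> D1 ^ k * D2 ^ k * M * I ^ k"
    proof (intro mult_mono)
      show "D2 \<le> D2 ^ k" using D2 k by (simp add: self_le_power)
      have "(LINT x|lborel. inverse (1 + x\<^sup>2 :: real)) \<le> I" by (simp add: I_def)
      also have "I \<le> I ^ k" using k by (intro self_le_power) (auto simp: I_def)
      finally show "(LINT x|lborel. inverse (1 + x\<^sup>2 :: real)) \<le> I ^ k" .
    qed (use M0 D1 D2 in auto)
    also have "\<dots> = (D1 * D2 * I) ^ k * M" by (simp add: power_mult_distrib mult_ac)
    finally have "(LINT x|lborel. (1 + \<bar>x\<bar>) ^ j * norm (ft F x)) \<le> (D1 * D2 * I) ^ k * M" .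
    with i have "integrable lborel (\<lambda>x. (1 + \<bar>x\<bar>) ^ j * norm (ft F x)) \<and>
      (LINT x|lborel. (1 + \<bar>x\<bar>) ^ j * norm (ft F x)) \<le> (D1 * D2 * I) ^ k * (LINT y|lborel. (1 + \<bar>y\<bar>) ^ k * norm (F y))"
      by (simp add: M_def)
  }
  ultimately show ?thesis by (rule that)
qed

subsection \<open>Gaussians and chirps\<close>

text \<open>The Gaussian is a multiple of the normal density with variance
  \<open>1 / (2 * a)\<close>, whose absolute moments are finite.\<close>

lemma integrable_gaussian_moment:
  fixes a :: real
  assumes "0 < a"
  shows "integrable lborel (\<lambda>x. \<bar>x\<bar> ^ k * exp (- a * x\<^sup>2))"
proof -
  define \<sigma> where "\<sigma> = sqrt (1 / (2 * a))"
  have \<sigma>: "0 < \<sigma>" "\<sigma>\<^sup>2 = 1 / (2 * a)" using assms by (auto simp: \<sigma>_def)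
  have "integrable lborel (\<lambda>x. sqrt (2 * pi * \<sigma>\<^sup>2) * (normal_density 0 \<sigma> x * \<bar>x - 0\<bar> ^ k))"
    by (intro integrable_mult_right integrable_normal_moment_abs \<sigma>)
  also have "(\<lambda>x. sqrt (2 * pi * \<sigma>\<^sup>2) * (normal_density 0 \<sigma> x * \<bar>x - 0\<bar> ^ k)) = (\<lambda>x. \<bar>x\<bar> ^ k * exp (- a * x\<^sup>2))"
    using assms by (auto simp: normal_density_def \<sigma> field_simps)
  finally show ?thesis .
qed

lemma norm_exp_gaussian:
  "norm (exp (- w * (of_real x)\<^sup>2 :: complex)) = exp (- Re w * x\<^sup>2)"
  by (simp add: norm_exp_eq_Re power2_eq_square)

text \<open>Rescaling by the standard deviation \<open>b\<close> turns the integral into the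
  characteristic function of the standard normal distribution.\<close>

lemma ft_real_gaussian:
  fixes a :: real
  assumes a: "0 < a"
  shows "ft (\<lambda>x. exp (- of_real a * (of_real x)\<^sup>2)) t = of_real (sqrt (pi / a) * exp (- t\<^sup>2 / (4 * a)))"
proof -
  define b where "b = 1 / sqrt (2 * a)"
  have b: "b > 0" "b\<^sup>2 = 1 / (2 * a)" using a by (auto simp: b_def power_divide)
  have "ft (\<lambda>x. exp (- of_real a * (of_real x)\<^sup>2)) t =
      b *\<^sub>R (LINT x|lborel. exp (- of_real a * (of_real (0 + b * x))\<^sup>2) * cis (- (t * (0 + b * x))))"
    unfolding ft_def using b by (subst lborel_integral_real_affine[of b _ 0]) auto
  also have "(\<lambda>x. exp (- of_real a * (of_real (0 + b * x))\<^sup>2) * cis (- (t * (0 + b * x)))) =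
     (\<lambda>x. of_real (sqrt (2 * pi)) * (std_normal_density x *\<^sub>R iexp ((- (t * b)) * x)))"
  proof
    fix x :: real
    have "- a * (0 + b * x)\<^sup>2 = - x\<^sup>2 / 2"
      using a b(2) by (simp add: power_mult_distrib)
    then have "- of_real a * (of_real (0 + b * x))\<^sup>2 = (of_real (- x\<^sup>2 / 2) :: complex)"
      by (metis of_real_minus of_real_mult of_real_power)
    then have e: "exp (- of_real a * (of_real (0 + b * x))\<^sup>2) = (of_real (exp (- x\<^sup>2 / 2)) :: complex)"
      by (simp only: exp_of_real)
    show "exp (- of_real a * (of_real (0 + b * x))\<^sup>2) * cis (- (t * (0 + b * x))) =
      of_real (sqrt (2 * pi)) * (std_normal_density x *\<^sub>R iexp ((- (t * b)) * x))"
      unfolding e by (simp add: std_normal_density_def cis_conv_exp scaleR_conv_of_real mult_ac)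
  qed
  also have "(LINT x|lborel. of_real (sqrt (2 * pi)) * (std_normal_density x *\<^sub>R iexp ((- (t * b)) * x))) =
      of_real (sqrt (2 * pi)) * char std_normal_distribution (- (t * b))"
    unfolding char_def integral_mult_right_zero by (subst integral_density) auto
  also have "b *\<^sub>R \<dots> = of_real (b * (sqrt (2 * pi)) * exp (- (t * b)\<^sup>2 / 2))"
    by (simp add: char_std_normal_distribution scaleR_conv_of_real exp_of_real[symmetric])
  also have "b * sqrt (2 * pi) = sqrt (pi / a)"
    using a by (simp add: b_def real_sqrt_divide real_sqrt_mult)
  also have "- (t * b)\<^sup>2 / 2 = - t\<^sup>2 / (4 * a)"
    by (simp add: power_mult_distrib b)
  finally show ?thesis .
qed

text \<open>The fundamental theorem of calculus on the whole line, in the form used for integrating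
  by parts against a Gaussian.\<close>

lemma integral_vector_derivative_eq_0:
  fixes f :: "real \<Rightarrow> complex"
  assumes der: "\<And>x. (F has_vector_derivative f x) (at x)"
    and "continuous_on UNIV f" "integrable lborel f"
    and "(F \<longlongrightarrow> 0) at_top" "(F \<longlongrightarrow> 0) at_bot"
  shows "(LINT x|lborel. f x) = 0"
proof -
  have "(LBINT x=-\<infinity>..\<infinity>. f x) = 0 - 0"
    by (rule interval_integral_FTC_integrable[where F=F])
       (use assms in \<open>auto simp: ereal_tendsto_simps set_integrable_def continuous_on_eq_continuous_at\<close>)
  then show ?thesis by (simp add: interval_lebesgue_integral_def set_lebesgue_integral_def)
qed

text \<open>Both sides solve the same linear differential equation along \<open>Re w = const\<close>; the product form avoids dividing by the square root.\<close>

lemma ft_complex_gaussian: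
  assumes w: "0 < Re w"
  shows "ft (\<lambda>x. exp (- w * (of_real x)\<^sup>2)) t * csqrt w * exp ((of_real t)\<^sup>2 / (4 * w)) = of_real (sqrt pi)"
proof -
  define a where "a = Re w"
  define W where "W s = Complex a s" for s
  have ReW: "Re (W s) = a" "W s \<noteq> 0" "W s \<notin> \<real>\<^sub>\<le>\<^sub>0" for s
    using w by (auto simp: W_def a_def complex_eq_iff complex_nonpos_Reals_iff)
  have a: "a > 0" using w by (simp add: a_def)
  define E where "E s x = exp (- W s * (of_real x)\<^sup>2) * cis (- (t * x))" for s x
  define I where "I s = (LINT x|lborel. E s x)" for s
  have nE: "norm (E s x) = exp (- a * x\<^sup>2)" for s x
    using norm_exp_gaussian[of "W s" x] by (simp add: E_def norm_mult ReW)
  have mE[measurable]: "E s \<in> borel_measurable borel" for s unfolding E_def by measurable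
  have iE: "integrable lborel (\<lambda>x. (of_real x) ^ k * E s x)" for s k
    using integrable_gaussian_moment[OF a, of k]
    by (rule Bochner_Integration.integrable_bound) (auto simp: nE norm_mult norm_power)
  have dW: "(W has_vector_derivative \<i>) (at s)" for s
  proof -
    have "((\<lambda>s. of_real a + \<i> * of_real s) has_vector_derivative \<i>) (at s)"
      by (auto intro!: derivative_eq_intros has_vector_derivative_real_field)
    then show ?thesis by (simp add: W_def[abs_def] complex_eq_iff Complex_eq)
  qed
  have dE: "((\<lambda>s. E s x) has_vector_derivative - \<i> * (of_real x)\<^sup>2 * E s x) (at s)" for s x
  proof -
    have "((\<lambda>z. exp (- z * (of_real x)\<^sup>2) * cis (- (t * x))) has_field_derivative
        - (of_real x)\<^sup>2 * E s x) (at (W s))"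
      unfolding E_def by (auto intro!: derivative_eq_intros)
    from field_vector_diff_chain_at[OF dW this] show ?thesis
      by (simp add: o_def E_def mult_ac)
  qed
  have dI: "(I has_vector_derivative (LINT x|lborel. - \<i> * ((of_real x)\<^sup>2 * E s x))) (at s)" for s
    unfolding I_def
  proof (rule has_vector_derivative_integral[where D = "\<lambda>x. \<bar>x\<bar>\<^sup>2 * exp (- a * x\<^sup>2)"])
    show "integrable lborel (E s)" for s using iE[of 0 s] by simp
    show "((\<lambda>s. E s x) has_vector_derivative - \<i> * ((of_real x)\<^sup>2 * E s x)) (at s)" for s x
      using dE[of x s] by (simp add: mult_ac)
  qed (use integrable_gaussian_moment[OF a, of 2] in \<open>auto simp: norm_mult norm_power nE\<close>)
  \<comment> \<open>Integration by parts expresses the second moment through \<open>I s\<close>,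
    which closes the differential equation for \<open>I\<close>.\<close>
  have parts: "2 * W s * (LINT x|lborel. (of_real x)\<^sup>2 * E s x) = (1 - (of_real t)\<^sup>2 / (2 * W s)) * I s" for s
  proof -
    \<comment> \<open>With this shift the terms linear in \<open>x\<close> cancel in the derivative
      of \<open>(x + B) * E s x\<close>.\<close>
    define B where "B = - \<i> * of_real t / (2 * W s)"
    have BW: "2 * W s * B = - \<i> * of_real t" using ReW by (simp add: B_def)
    have IB: "\<i> * of_real t * B = (of_real t)\<^sup>2 / (2 * W s)" using ReW by (simp add: B_def field_simps power2_eq_square)
    have lim: "((\<lambda>x. (of_real x + B) * E s x) \<longlongrightarrow> 0) F"
      if "((\<lambda>x. (\<bar>x\<bar> + norm B) * exp (- a * x\<^sup>2)) \<longlongrightarrow> 0) F" for F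
    proof (rule Lim_null_comparison[OF always_eventually that], intro allI)
      fix x
      have "norm (of_real x + B) \<le> \<bar>x\<bar> + norm B" using norm_triangle_ineq[of "of_real x" B] by simp
      then show "norm ((of_real x + B) * E s x) \<le> (\<bar>x\<bar> + norm B) * exp (- a * x\<^sup>2)"
        unfolding norm_mult nE by (intro mult_right_mono) auto
    qed
    have "(LINT x|lborel. (1 - (of_real t)\<^sup>2 / (2 * W s)) * E s x - 2 * W s * ((of_real x)\<^sup>2 * E s x)) = 0"
    proof (rule integral_vector_derivative_eq_0[where F = "\<lambda>x. (of_real x + B) * E s x"])
      fix x
      have "((\<lambda>z. (z + B) * (exp (- W s * z\<^sup>2) * exp (\<i> * (- (of_real t * z))))) has_field_derivative
        (1 - (of_real x + B) * (2 * W s * of_real x + \<i> * of_real t)) * E s x) (at (of_real x))"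
        unfolding E_def cis_conv_exp by (auto intro!: derivative_eq_intros simp: algebra_simps power2_eq_square)
      from has_vector_derivative_real_field[OF this]
      have "((\<lambda>x. (of_real x + B) * E s x) has_vector_derivative
        (1 - (of_real x + B) * (2 * W s * of_real x + \<i> * of_real t)) * E s x) (at x)"
        by (simp add: E_def cis_conv_exp)
      also have "(1 - (of_real x + B) * (2 * W s * of_real x + \<i> * of_real t)) =
          1 - \<i> * of_real t * B - 2 * W s * (of_real x)\<^sup>2 - (2 * W s * B + \<i> * of_real t) * of_real x"
        by (simp add: algebra_simps power2_eq_square)
      also have "\<dots> = 1 - (of_real t)\<^sup>2 / (2 * W s) - 2 * W s * (of_real x)\<^sup>2"
        unfolding BW IB by simp
      finally show "((\<lambda>x. (of_real x + B) * E s x) has_vector_derivative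
          (1 - (of_real t)\<^sup>2 / (2 * W s)) * E s x - 2 * W s * ((of_real x)\<^sup>2 * E s x)) (at x)"
        by (simp add: algebra_simps)
    next
      show "continuous_on UNIV (\<lambda>x. (1 - (of_real t)\<^sup>2 / (2 * W s)) * E s x - 2 * W s * ((of_real x)\<^sup>2 * E s x))"
        unfolding E_def by (intro continuous_intros)
      show "integrable lborel (\<lambda>x. (1 - (of_real t)\<^sup>2 / (2 * W s)) * E s x - 2 * W s * ((of_real x)\<^sup>2 * E s x))"
        using iE[of 0 s] iE[of 2 s]
        by (intro Bochner_Integration.integrable_diff integrable_mult_right) auto
      show "((\<lambda>x. (of_real x + B) * E s x) \<longlongrightarrow> 0) at_top" "((\<lambda>x. (of_real x + B) * E s x) \<longlongrightarrow> 0) at_bot"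
        by (rule lim; use a in real_asymp)+
    qed
    moreover have "(LINT x|lborel. (1 - (of_real t)\<^sup>2 / (2 * W s)) * E s x - 2 * W s * ((of_real x)\<^sup>2 * E s x)) =
       (1 - (of_real t)\<^sup>2 / (2 * W s)) * I s - 2 * W s * (LINT x|lborel. (of_real x)\<^sup>2 * E s x)"
      unfolding I_def using iE[of 0 s] iE[of 2 s] by (subst Bochner_Integration.integral_diff) auto
    ultimately show ?thesis by simp
  qed
  \<comment> \<open>This product is constant along the vertical line through \<open>w\<close>; at
    \<open>s = 0\<close> the parameter is real and the value is known from the real
    Gaussian.\<close>
  define Q where "Q s = I s * (csqrt (W s) * exp ((of_real t)\<^sup>2 / (4 * W s)))" for s
  have "(Q has_vector_derivative 0) (at s)" for s
  proof -
    have c0: "csqrt (W s) \<noteq> 0" "csqrt (W s) * csqrt (W s) = W s" using ReW by (auto simp flip: power2_eq_square)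
    have "((\<lambda>z. csqrt z * exp ((of_real t)\<^sup>2 / (4 * z))) has_field_derivative
       (inverse (2 * csqrt (W s)) - csqrt (W s) * ((of_real t)\<^sup>2 / (4 * (W s)\<^sup>2))) * exp ((of_real t)\<^sup>2 / (4 * W s))) (at (W s))"
      using ReW by (auto intro!: derivative_eq_intros has_field_derivative_csqrt simp: field_simps power2_eq_square)
    also have "inverse (2 * csqrt (W s)) = csqrt (W s) / (2 * W s)"
      using c0 ReW by (simp add: field_simps)
    finally have 1: "((\<lambda>s. csqrt (W s) * exp ((of_real t)\<^sup>2 / (4 * W s))) has_vector_derivative
       \<i> * ((csqrt (W s) / (2 * W s) - csqrt (W s) * ((of_real t)\<^sup>2 / (4 * (W s)\<^sup>2))) * exp ((of_real t)\<^sup>2 / (4 * W s)))) (at s)"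
      using field_vector_diff_chain_at[OF dW] by (simp add: o_def)
    have 2: "(LINT x|lborel. - \<i> * ((of_real x)\<^sup>2 * E s x)) = - \<i> * ((1 - (of_real t)\<^sup>2 / (2 * W s)) * I s / (2 * W s))"
      using ReW by (simp add: parts[symmetric])
    show ?thesis unfolding Q_def
      by (rule has_vector_derivative_eq_rhs[OF has_vector_derivative_mult[OF dI[of s, unfolded 2] 1]])
         (use ReW in \<open>simp add: field_simps power2_eq_square\<close>)
  qed
  then obtain q where "\<And>s. Q s = q"
    using has_vector_derivative_zero_constant[of UNIV Q] by auto
  then have "Q (Im w) = Q 0" by simp
  also have "Q 0 = of_real (sqrt pi)"
  proof -
    have W0: "W 0 = of_real a" by (simp add: W_def complex_eq_iff)
    have "I 0 = of_real (sqrt (pi / a) * exp (- t\<^sup>2 / (4 * a)))"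
      using ft_real_gaussian[OF a, of t] by (simp add: I_def E_def ft_def W0)
    moreover have "csqrt (of_real a) = of_real (sqrt a)" using a by simp
    moreover have "exp ((of_real t)\<^sup>2 / (4 * of_real a)) = (of_real (exp (t\<^sup>2 / (4 * a))) :: complex)"
      by (simp flip: exp_of_real)
    ultimately have "Q 0 = of_real (sqrt (pi / a) * exp (- t\<^sup>2 / (4 * a)) * (sqrt a * exp (t\<^sup>2 / (4 * a))))"
      by (simp add: Q_def W0)
    also have "sqrt (pi / a) * exp (- t\<^sup>2 / (4 * a)) * (sqrt a * exp (t\<^sup>2 / (4 * a))) = sqrt pi"
      using a by (simp add: real_sqrt_divide exp_minus field_simps)
    finally show ?thesis .
  qed
  finally show ?thesis by (simp add: Q_def I_def E_def ft_def W_def a_def mult_ac)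
qed

lemma integrable_ft_factor:
  assumes [measurable]: "F \<in> borel_measurable borel" and "integrable lborel F"
    and [measurable]: "u \<in> borel_measurable borel" and "\<And>y. norm (u y) \<le> B"
  shows "integrable lborel (\<lambda>y. F y * (u y :: complex))"
proof -
  have "integrable lborel (\<lambda>y. norm (F y) * B)" using assms by simp
  then show ?thesis
  proof (rule Bochner_Integration.integrable_bound)
    have "norm (F y) * norm (u y) \<le> norm (norm (F y) * B)" for y
      using mult_left_mono[OF assms(4), of "norm (F y)" y] by (simp add: order_trans[OF _ abs_ge_self])
    then show "AE y in lborel. norm (F y * u y) \<le> norm (norm (F y) * B)" by (simp add: norm_mult)
  qed auto
qed

text \<open>Fubini's theorem for \<open>\<phi> x * F y * cis (- (x * y))\<close>.\<close>

lemma ft_multiplication: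
  assumes [measurable]: "F \<in> borel_measurable borel" "\<phi> \<in> borel_measurable borel"
    and F: "integrable lborel F" and \<phi>: "integrable lborel \<phi>"
  shows "(LINT x|lborel. ft F x * \<phi> x) = (LINT y|lborel. F y * ft \<phi> y)"
proof -
  have "integrable (lborel \<Otimes>\<^sub>M lborel) (\<lambda>(x, y). \<phi> x * F y * cis (- (x * y)))"
  proof (rule lborel_pair.Fubini_integrable)
    show "integrable lborel (\<lambda>x. LINT y|lborel. norm (case (x, y) of (x, y) \<Rightarrow> \<phi> x * F y * cis (- (x * y))))"
      using \<phi> by (simp add: norm_mult)
    show "AE x in lborel. integrable lborel (\<lambda>y. case (x, y) of (x, y) \<Rightarrow> \<phi> x * F y * cis (- (x * y)))"
    proof (intro AE_I2)
      fix x
      have "integrable lborel (\<lambda>y. \<phi> x * (F y * cis (- (x * y))))"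
        using F by (intro integrable_mult_right integrable_ft_factor[where B=1]) auto
      then show "integrable lborel (\<lambda>y. case (x, y) of (x, y) \<Rightarrow> \<phi> x * F y * cis (- (x * y)))"
        by (simp add: mult_ac)
    qed
  qed measurable
  note Fubini = lborel_pair.Fubini_integral[OF this]
  have "(LINT y|lborel. \<phi> x * F y * cis (- (x * y))) = ft F x * \<phi> x" for x
    unfolding ft_def by (subst integral_mult_left_zero[symmetric]) (simp add: mult_ac)
  moreover have "(LINT x|lborel. \<phi> x * F y * cis (- (x * y))) = F y * ft \<phi> y" for y
    unfolding ft_def by (subst integral_mult_right_zero[symmetric]) (simp add: mult_ac)
  ultimately show ?thesis using Fubini by simp
qed

text \<open>On a bounded window the positive and negative parts of \<open>g\<close> are densities of
  two finite measures. These agree on all half-lines, hence coincide, so the two parts are equal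
  almost everywhere; as they are never both nonzero, both vanish there.\<close>

lemma AE_eq_0_of_interval_integrals_real:
  fixes g :: "real \<Rightarrow> real"
  assumes [measurable]: "g \<in> borel_measurable borel"
    and int: "\<And>a b. set_integrable lborel {a<..b} g"
    and zero: "\<And>a b. (LINT x:{a<..b}|lborel. g x) = 0"
  shows "AE x in lborel. g x = 0"
proof -
  have "AE x in lborel. indicator {- real N<..real N} x * g x = 0" for N :: nat
  proof -
    define h where "h x = indicator {- real N<..real N} x * g x" for x
    have hm[measurable]: "h \<in> borel_measurable borel" unfolding h_def by measurable
    have hi: "integrable lborel h"
      using int[of "- real N" "real N"] by (simp add: h_def[abs_def] set_integrable_def)
    define M where "M s = density lborel (\<lambda>x. ennreal (max 0 (s * h x)))" for s :: real
    have em: "emeasure (M s) {x<..} = ennreal (LINT y|lborel. max 0 (s * h y) * indicator {x<..} y)" for s x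
    proof -
      have "emeasure (M s) {x<..} = (\<integral>\<^sup>+y. ennreal (max 0 (s * h y) * indicator {x<..} y) \<partial>lborel)"
        unfolding M_def by (subst emeasure_density) (auto intro!: nn_integral_cong split: split_indicator)
      also have "\<dots> = ennreal (LINT y|lborel. max 0 (s * h y) * indicator {x<..} y)"
        using hi by (intro nn_integral_eq_integral integrable_real_mult_indicator) auto
      finally show ?thesis .
    qed
    have "M 1 = M (-1)"
    proof (rule measure_eqI_lessThan)
      show "emeasure (M 1) {x<..} = emeasure (M (-1)) {x<..}" for x
      proof -
        have "(LINT y|lborel. max 0 (1 * h y) * indicator {x<..} y) - (LINT y|lborel. max 0 ((-1) * h y) * indicator {x<..} y)
            = (LINT y|lborel. max 0 (1 * h y) * indicator {x<..} y - max 0 ((-1) * h y) * indicator {x<..} y)"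
          using hi by (intro Bochner_Integration.integral_diff[symmetric] integrable_real_mult_indicator) auto
        also have "\<dots> = (LINT y:{max x (- real N)<..real N}|lborel. g y)"
          unfolding set_lebesgue_integral_def
          by (intro Bochner_Integration.integral_cong) (auto simp: h_def split: split_indicator)
        also have "\<dots> = 0" by (rule zero)
        finally show ?thesis unfolding em by simp
      qed
      show "emeasure (M 1) {x<..} < \<infinity>" for x unfolding em by simp
    qed (auto simp: M_def)
    then have "AE x in lborel. ennreal (max 0 (1 * h x)) = ennreal (max 0 ((-1) * h x))"
      unfolding M_def by (intro sigma_finite_measure.density_unique) (auto intro: sigma_finite_lborel)
    then show ?thesis
      by eventually_elim (auto simp: h_def max_def split: if_splits)
  qed
  then have "AE x in lborel. \<forall>N::nat. indicator {- real N<..real N} x * g x = 0"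
    by (subst AE_all_countable) blast
  then show ?thesis
  proof eventually_elim
    case (elim x)
    obtain N :: nat where "\<bar>x\<bar> < real N" using reals_Archimedean2 by blast
    with elim[rule_format, of N] show ?case by (auto simp: abs_less_iff)
  qed
qed

lemma AE_eq_0_of_interval_integrals:
  fixes g :: "real \<Rightarrow> complex"
  assumes [measurable]: "g \<in> borel_measurable borel"
    and int: "\<And>a b. set_integrable lborel {a<..b} g"
    and zero: "\<And>a b. (LINT x:{a<..b}|lborel. g x) = 0"
  shows "AE x in lborel. g x = 0"
proof -
  have "AE x in lborel. Re (g x) = 0"
  proof (rule AE_eq_0_of_interval_integrals_real)
    show "set_integrable lborel {a<..b} (\<lambda>x. Re (g x))" "(LINT x:{a<..b}|lborel. Re (g x)) = 0" for a b
      using integrable_Re[OF int[of a b, unfolded set_integrable_def]]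
        integral_Re[OF int[of a b, unfolded set_integrable_def]] zero[of a b]
      by (simp_all add: set_integrable_def set_lebesgue_integral_def)
  qed auto
  moreover have "AE x in lborel. Im (g x) = 0"
  proof (rule AE_eq_0_of_interval_integrals_real)
    show "set_integrable lborel {a<..b} (\<lambda>x. Im (g x))" "(LINT x:{a<..b}|lborel. Im (g x)) = 0" for a b
      using integrable_Im[OF int[of a b, unfolded set_integrable_def]]
        integral_Im[OF int[of a b, unfolded set_integrable_def]] zero[of a b]
      by (simp_all add: set_integrable_def set_lebesgue_integral_def)
  qed auto
  ultimately show ?thesis by eventually_elim (simp add: complex_eq_iff)
qed

lemma ft_modulated:
  "ft (\<lambda>x. cis (a * x) * g x) t = ft g (t - a)"
proof -
  have "cis (a * x) * g x * cis (- (t * x)) = g x * cis (- ((t - a) * x))" for x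
  proof -
    have "cis (a * x) * g x * cis (- (t * x)) = g x * (cis (a * x) * cis (- (t * x)))"
      by (simp only: mult_ac)
    also have "cis (a * x) * cis (- (t * x)) = cis (- ((t - a) * x))"
      by (simp add: cis_mult algebra_simps)
    finally show ?thesis .
  qed
  then show ?thesis unfolding ft_def by (simp only:)
qed

text \<open>The Gaussian with parameter \<open>w\<close> tends to the chirp as \<open>w\<close> tends to \<open>- \<i> / (4 * \<eta>)\<close> from the right half plane.\<close>

lemma chirp_formula:
  assumes [measurable]: "f \<in> borel_measurable borel"
    and f: "integrable lborel f" and g: "integrable lborel (ft f)"
    and \<eta>: "\<eta> \<noteq> 0" and zero: "(LINT t|lborel. f t * cis (- (\<xi> * t + \<eta> * t\<^sup>2))) = 0"
  shows "ft (\<lambda>x. ft f x * cis (x\<^sup>2 / (4 * \<eta>))) (\<xi> / (2 * \<eta>)) = 0"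
proof -
  have gm[measurable]: "ft f \<in> borel_measurable borel" unfolding ft_def by measurable
  define w0 where "w0 = Complex 0 (- 1 / (4 * \<eta>))"
  define w where "w n = Complex (1 / real (Suc n)) (- 1 / (4 * \<eta>))" for n
  \<comment> \<open>This completes the square: \<open>\<xi> * t + \<eta> * t\<^sup>2 = \<eta> * (t +
    c)\<^sup>2 - \<eta> * c\<^sup>2\<close>.\<close>
  define c where "c = \<xi> / (2 * \<eta>)"
  have w: "Re (w n) > 0" "w n \<noteq> 0" for n by (auto simp: w_def complex_eq_iff)
  have w0: "w0 \<noteq> 0" "w0 \<notin> \<real>\<^sub>\<le>\<^sub>0" using \<eta> by (auto simp: w0_def complex_eq_iff complex_nonpos_Reals_iff)
  have wlim: "w \<longlonglongrightarrow> w0"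
    unfolding w_def w0_def by (intro tendsto_Complex tendsto_const LIMSEQ_Suc[OF lim_inverse_n'])
  define \<phi> where "\<phi> n x = cis (- c * x) * exp (- w n * (of_real x)\<^sup>2)" for n x
  have \<phi>m[measurable]: "\<phi> n \<in> borel_measurable borel" for n unfolding \<phi>_def by measurable
  have n\<phi>: "norm (\<phi> n x) = exp (- Re (w n) * x\<^sup>2)" for n x
    using norm_exp_gaussian[of "w n" x] by (simp add: \<phi>_def norm_mult)
  have n\<phi>1: "norm (\<phi> n x) \<le> 1" for n x
    using w(1)[of n] by (simp add: n\<phi>)
  have i\<phi>: "integrable lborel (\<phi> n)" for n
    using integrable_gaussian_moment[OF w(1), of 0 n]
    by (rule Bochner_Integration.integrable_bound) (auto simp: n\<phi>)
  have ft\<phi>: "csqrt (w n) * ft (\<phi> n) t = of_real (sqrt pi) * exp (- ((of_real (t + c))\<^sup>2 / (4 * w n)))" for n t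
  proof -
    have "ft (\<phi> n) t = ft (\<lambda>x. exp (- w n * (of_real x)\<^sup>2)) (t + c)"
      using ft_modulated[of "- c" "\<lambda>x. exp (- w n * (of_real x)\<^sup>2)" t] by (simp add: \<phi>_def[abs_def])
    then show ?thesis
      using ft_complex_gaussian[OF w(1)[of n], of "t + c"] by (simp add: exp_minus field_simps)
  qed
  have "(\<lambda>n. LINT x|lborel. ft f x * \<phi> n x) \<longlonglongrightarrow> (LINT x|lborel. ft f x * (cis (- c * x) * exp (- w0 * (of_real x)\<^sup>2)))"
  proof (rule integral_dominated_convergence[where w = "\<lambda>x. norm (ft f x)"])
    show "AE x in lborel. (\<lambda>n. ft f x * \<phi> n x) \<longlonglongrightarrow> ft f x * (cis (- c * x) * exp (- w0 * (of_real x)\<^sup>2))"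
      unfolding \<phi>_def by (intro AE_I2 tendsto_intros wlim)
    show "AE x in lborel. norm (ft f x * \<phi> n x) \<le> norm (ft f x)" for n
      using n\<phi>1 by (auto simp: norm_mult mult_left_le)
  qed (use g in auto)
  \<comment> \<open>\<open>w0\<close> is purely imaginary and nonzero, hence off the branch cut of
    \<open>csqrt\<close>.\<close>
  moreover have "(\<lambda>n. csqrt (w n)) \<longlonglongrightarrow> csqrt w0"
    using w0 wlim by (intro isCont_tendsto_compose[of _ csqrt] continuous_at_csqrt)
  ultimately have L: "(\<lambda>n. csqrt (w n) * (LINT x|lborel. ft f x * \<phi> n x)) \<longlonglongrightarrow>
      csqrt w0 * (LINT x|lborel. ft f x * (cis (- c * x) * exp (- w0 * (of_real x)\<^sup>2)))"
    by (intro tendsto_mult)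
  have eq: "csqrt (w n) * (LINT x|lborel. ft f x * \<phi> n x) =
      of_real (sqrt pi) * (LINT t|lborel. f t * exp (- ((of_real (t + c))\<^sup>2 / (4 * w n))))" for n
  proof -
    have "csqrt (w n) * (LINT x|lborel. ft f x * \<phi> n x) = (LINT t|lborel. f t * (csqrt (w n) * ft (\<phi> n) t))"
      using f i\<phi> by (subst ft_multiplication) (auto simp: mult_ac simp flip: integral_mult_right_zero)
    then show ?thesis unfolding ft\<phi> by (simp add: mult_ac flip: integral_mult_right_zero)
  qed
  have "(\<lambda>n. LINT t|lborel. f t * exp (- ((of_real (t + c))\<^sup>2 / (4 * w n)))) \<longlonglongrightarrow>
      (LINT t|lborel. f t * exp (- ((of_real (t + c))\<^sup>2 / (4 * w0))))"
  proof (rule integral_dominated_convergence[where w = "\<lambda>x. norm (f x)"])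
    show "AE t in lborel. (\<lambda>n. f t * exp (- ((of_real (t + c))\<^sup>2 / (4 * w n)))) \<longlonglongrightarrow> f t * exp (- ((of_real (t + c))\<^sup>2 / (4 * w0)))"
      by (intro AE_I2 tendsto_intros wlim) (use w0 in auto)
    have "norm (exp (- ((of_real (t + c))\<^sup>2 / (4 * w n)))) \<le> 1" for t n
    proof -
      \<comment> \<open>\<open>1 / w n\<close> stays in the right half plane, so these Gaussians are
        bounded by 1 and dominated convergence reaches the limit \<open>w0\<close>.\<close>
      have "Re (1 / w n) \<ge> 0" using w(1)[of n] by (simp add: Re_divide)
      then have "(t + c)\<^sup>2 / 4 * Re (1 / w n) \<ge> 0" by simp
      also have "(t + c)\<^sup>2 / 4 * Re (1 / w n) = Re (of_real ((t + c)\<^sup>2 / 4) * (1 / w n))"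
        by (simp only: Re_complex_of_real Im_complex_of_real times_complex.sel)
      also have "of_real ((t + c)\<^sup>2 / 4) * (1 / w n) = (of_real (t + c))\<^sup>2 / (4 * w n)"
        by simp
      finally show ?thesis by (simp add: norm_exp_eq_Re)
    qed
    then show "AE t in lborel. norm (f t * exp (- ((of_real (t + c))\<^sup>2 / (4 * w n)))) \<le> norm (f t)" for n
      by (simp add: norm_mult mult_left_le)
  qed (use f in auto)
  moreover have "(LINT t|lborel. f t * exp (- ((of_real (t + c))\<^sup>2 / (4 * w0)))) = 0"
  proof -
    have "1 / (4 * w0) = \<i> * of_real \<eta>"
      using \<eta> by (simp add: w0_def complex_eq_iff Re_divide Im_divide power2_eq_square)
    then have "(of_real (t + c))\<^sup>2 / (4 * w0) = \<i> * of_real (\<eta> * (t + c)\<^sup>2)" for t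
      by (metis (no_types, lifting) divide_inverse inverse_eq_divide mult.assoc mult.commute of_real_mult of_real_power)
    then have "exp (- ((of_real (t + c))\<^sup>2 / (4 * w0))) = cis (- (\<eta> * (t + c)\<^sup>2))" for t
      unfolding cis_conv_exp by simp
    moreover have "- (\<eta> * (t + c)\<^sup>2) = - (\<xi> * t + \<eta> * t\<^sup>2) + - (\<eta> * c\<^sup>2)" for t
      using \<eta> by (simp add: c_def field_simps power2_eq_square)
    ultimately have "(LINT t|lborel. f t * exp (- ((of_real (t + c))\<^sup>2 / (4 * w0)))) =
        (LINT t|lborel. f t * cis (- (\<xi> * t + \<eta> * t\<^sup>2)) * cis (- (\<eta> * c\<^sup>2)))"
      by (simp only: cis_mult[symmetric] mult.assoc)
    also have "\<dots> = 0" by (simp only: integral_mult_left_zero zero mult_zero_left)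
    finally show ?thesis .
  qed
  ultimately have "(\<lambda>n. csqrt (w n) * (LINT x|lborel. ft f x * \<phi> n x)) \<longlonglongrightarrow> of_real (sqrt pi) * 0"
    unfolding eq by (intro tendsto_mult tendsto_const) simp
  with L have "csqrt w0 * (LINT x|lborel. ft f x * (cis (- c * x) * exp (- w0 * (of_real x)\<^sup>2))) = 0"
    using LIMSEQ_unique by fastforce
  then have "(LINT x|lborel. ft f x * (cis (- c * x) * exp (- w0 * (of_real x)\<^sup>2))) = 0"
    using w0 by simp
  moreover have "exp (- w0 * (of_real x)\<^sup>2) = cis (x\<^sup>2 / (4 * \<eta>))" for x
    unfolding cis_conv_exp using \<eta> by (simp add: w0_def complex_eq_iff Complex_eq)
  ultimately show ?thesis
    by (simp add: ft_def c_def mult_ac)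
qed

subsection \<open>Fourier inversion\<close>

text \<open>Damping \<open>ft F\<close> by the Gaussian \<open>e n\<close> turns the inverse
  transform into the convolution of \<open>F\<close> with the kernel \<open>k n\<close> of mass
  \<open>2 * pi\<close>. The two sides are compared through their integrals over intervals, where
  dominated convergence suffices.\<close>

lemma ft_inversion:
  assumes [measurable]: "F \<in> borel_measurable borel"
    and F: "integrable lborel F" and H: "integrable lborel (ft F)"
  shows "AE y in lborel. ft (ft F) (- y) = 2 * of_real pi * F y"
proof -
  have Hm[measurable]: "ft F \<in> borel_measurable borel" unfolding ft_def by measurable
  have fin: "emeasure lborel {a<..b} < \<infinity>" for a b :: real by (cases "a \<le> b") auto
  define J where "J x = ft (ft F) (- x)" for x
  have Jm[measurable]: "J \<in> borel_measurable borel" unfolding J_def ft_def[of "ft F"] by measurable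
  define B where "B = (LINT \<xi>|lborel. norm (ft F \<xi>))"
  define m where "m n = real (Suc n)" for n
  have m: "m n > 0" for n by (simp add: m_def)
  have mlim: "(\<lambda>n. 1 / m n) \<longlonglongrightarrow> 0"
    unfolding m_def by (rule LIMSEQ_Suc[OF lim_inverse_n'])
  define k where "k n u = 2 * sqrt pi * m n * exp (- ((m n)\<^sup>2 * u\<^sup>2))" for n and u :: real
  have km[measurable]: "k n \<in> borel_measurable borel" for n unfolding k_def by measurable
  define e where "e n \<xi> = exp (- \<xi>\<^sup>2 / (4 * (m n)\<^sup>2))" for n and \<xi> :: real
  have em[measurable]: "e n \<in> borel_measurable borel" for n unfolding e_def by measurable
  have e1: "0 \<le> e n \<xi>" "e n \<xi> \<le> 1" for n \<xi> by (auto simp: e_def)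
  define J' where "J' n x = (LINT \<xi>|lborel. ft F \<xi> * (cis (x * \<xi>) * e n \<xi>))" for n x
  have bJ': "norm (J' n x) \<le> B" for n x
  proof -
    have "norm (J' n x) \<le> (LINT \<xi>|lborel. norm (ft F \<xi> * (cis (x * \<xi>) * e n \<xi>)))"
      unfolding J'_def by (rule integral_norm_bound)
    also have "\<dots> \<le> B" unfolding B_def
      using H e1 by (intro integral_mono integrable_norm integrable_ft_factor[where B=1])
        (auto simp: norm_mult mult_left_le)
    finally show ?thesis .
  qed
  have bJ: "norm (J x) \<le> B" for x
    unfolding J_def B_def ft_def[of "ft F"]
    by (rule order_trans[OF integral_norm_bound]) (simp add: norm_mult)
  have J'lim: "(\<lambda>n. J' n x) \<longlonglongrightarrow> J x" for x
  proof -
    have "(\<lambda>n. J' n x) \<longlonglongrightarrow> (LINT \<xi>|lborel. ft F \<xi> * (cis (x * \<xi>) * of_real (exp 0)))"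
      unfolding J'_def
    proof (rule integral_dominated_convergence[where w = "\<lambda>x. norm (ft F x)"])
      have "(\<lambda>n. - \<xi>\<^sup>2 / 4 * (1 / m n)\<^sup>2) \<longlonglongrightarrow> - \<xi>\<^sup>2 / 4 * 0\<^sup>2" for \<xi>
        by (intro tendsto_intros mlim)
      then have "(\<lambda>n. e n \<xi>) \<longlonglongrightarrow> exp 0" for \<xi>
        unfolding e_def by (intro tendsto_exp) (simp add: power_divide)
      then show "AE \<xi> in lborel. (\<lambda>n. ft F \<xi> * (cis (x * \<xi>) * e n \<xi>)) \<longlonglongrightarrow> ft F \<xi> * (cis (x * \<xi>) * of_real (exp 0))"
        by (intro AE_I2 tendsto_intros)
      show "AE \<xi> in lborel. norm (ft F \<xi> * (cis (x * \<xi>) * e n \<xi>)) \<le> norm (ft F \<xi>)" for n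
        using e1 by (auto simp: norm_mult mult_left_le)
    qed (use H in auto)
    then show ?thesis by (simp add: J_def ft_def[of "ft F"])
  qed
  have J'k: "J' n x = (LINT y|lborel. F y * of_real (k n (y - x)))" for n x
  proof -
    define a where "a = 1 / (4 * (m n)\<^sup>2)"
    have a: "a > 0" "sqrt (pi / a) = 2 * sqrt pi * m n" using m[of n] by (auto simp: a_def real_sqrt_mult)
    define \<phi> where "\<phi> \<xi> = cis (x * \<xi>) * exp (- of_real a * (of_real \<xi>)\<^sup>2)" for \<xi>
    have \<phi>e: "\<phi> \<xi> = cis (x * \<xi>) * e n \<xi>" for \<xi>
    proof -
      have "- of_real a * (of_real \<xi>)\<^sup>2 = (of_real (- \<xi>\<^sup>2 / (4 * (m n)\<^sup>2)) :: complex)"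
        by (simp add: a_def)
      then show ?thesis unfolding \<phi>_def e_def by (simp only: exp_of_real)
    qed
    have [measurable]: "\<phi> \<in> borel_measurable borel" unfolding \<phi>_def by measurable
    have "integrable lborel \<phi>"
      using integrable_gaussian_moment[OF a(1), of 0]
      by (rule Bochner_Integration.integrable_bound) (auto simp: \<phi>e norm_mult e_def a_def)
    then have j: "J' n x = (LINT y|lborel. F y * ft \<phi> y)"
      unfolding J'_def \<phi>e[symmetric] using F by (intro ft_multiplication) auto
    have "ft \<phi> y = of_real (k n (y - x))" for y
    proof -
      have "ft \<phi> y = of_real (sqrt (pi / a) * exp (- (y - x)\<^sup>2 / (4 * a)))"
        unfolding \<phi>_def ft_modulated by (rule ft_real_gaussian[OF a(1)])
      also have "sqrt (pi / a) * exp (- (y - x)\<^sup>2 / (4 * a)) = k n (y - x)"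
        unfolding a k_def by (simp add: a_def mult.commute)
      finally show ?thesis .
    qed
    then show ?thesis unfolding j by simp
  qed
  have k_le: "0 \<le> k n u" "k n u \<le> 2 * sqrt pi * m n" for n u
    using m[of n] by (auto simp: k_def mult_left_le)
  have e0: "integrable lborel (\<lambda>v. 2 * sqrt pi * exp (- v\<^sup>2))" "(LINT v|lborel. 2 * sqrt pi * exp (- v\<^sup>2)) = 2 * pi"
  proof -
    show "integrable lborel (\<lambda>v::real. 2 * sqrt pi * exp (- v\<^sup>2))"
      using integrable_gaussian_moment[of 1 0] by simp
    have "of_real (LINT v|lborel. exp (- v\<^sup>2)) = ft (\<lambda>x. exp (- of_real 1 * (of_real x)\<^sup>2)) 0"
      by (simp add: ft_def flip: integral_complex_of_real exp_of_real of_real_power)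
    also have "\<dots> = of_real (sqrt pi)" by (subst ft_real_gaussian) auto
    finally have "(LINT v|lborel. exp (- v\<^sup>2)) = sqrt pi" by (simp only: of_real_eq_iff)
    then show "(LINT v|lborel. 2 * sqrt pi * exp (- v\<^sup>2)) = 2 * pi" by simp
  qed
  have main: "(LINT x:{a<..b}|lborel. J x) = 2 * of_real pi * (LINT x:{a<..b}|lborel. F x)" for a b
  proof -
    \<comment> \<open>The mass that the kernel centred at \<open>y\<close> places on the interval.
      It tends to \<open>2 * pi\<close> for \<open>y\<close> inside and to 0 for \<open>y\<close>
      outside.\<close>
    define c where "c n y = (LINT x|lborel. indicator {a<..b} x * k n (y - x))" for n y
    have cm[measurable]: "c n \<in> borel_measurable borel" for n unfolding c_def by measurable
    have c_eq: "c n y = (LINT v|lborel. indicator {a<..b} (y + (1 / m n) * v) * (2 * sqrt pi * exp (- v\<^sup>2)))" for n y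
    proof -
      have "c n y = \<bar>1 / m n\<bar> *\<^sub>R (LINT v|lborel. indicator {a<..b} (y + (1 / m n) * v) * k n (y - (y + (1 / m n) * v)))"
        unfolding c_def using m[of n] by (subst lborel_integral_real_affine[of "1 / m n" _ y]) auto
      also have "\<dots> = (LINT v|lborel. (1 / m n) * (indicator {a<..b} (y + (1 / m n) * v) * k n (y - (y + (1 / m n) * v))))"
        using m[of n] by simp
      finally show ?thesis
        using m[of n] by (auto simp: k_def power_divide field_simps intro!: Bochner_Integration.integral_cong)
    qed
    have ci: "integrable lborel (\<lambda>v. indicator {a<..b} (y + (1 / m n) * v) * (2 * sqrt pi * exp (- v\<^sup>2)))" for n y
      using e0(1) by (rule Bochner_Integration.integrable_bound) (auto split: split_indicator)
    have cb: "0 \<le> c n y" "c n y \<le> 2 * pi" for n y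
    proof -
      show "0 \<le> c n y" unfolding c_eq by (intro integral_nonneg_AE AE_I2) auto
      have "c n y \<le> (LINT v|lborel. 2 * sqrt pi * exp (- v\<^sup>2))"
        unfolding c_eq by (intro integral_mono ci e0) (auto split: split_indicator)
      then show "c n y \<le> 2 * pi" by (simp only: e0)
    qed
    \<comment> \<open>The endpoints, where the indicator may jump, are excluded; they form a null
      set.\<close>
    have clim: "(\<lambda>n. c n y) \<longlonglongrightarrow> indicator {a<..b} y * (2 * pi)" if y: "y \<noteq> a" "y \<noteq> b" for y
    proof -
      have "(\<lambda>n. c n y) \<longlonglongrightarrow> (LINT v|lborel. indicator {a<..b} y * (2 * sqrt pi * exp (- v\<^sup>2)))"
        unfolding c_eq
      proof (rule integral_dominated_convergence[where w="\<lambda>v. 2 * sqrt pi * exp (- v\<^sup>2)"])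
        show "AE v in lborel. (\<lambda>n. indicator {a<..b} (y + (1 / m n) * v) * (2 * sqrt pi * exp (- v\<^sup>2))) \<longlonglongrightarrow> indicator {a<..b} y * (2 * sqrt pi * exp (- v\<^sup>2))"
        proof (intro AE_I2)
          fix v :: real
          have "(\<lambda>n. y + (1 / m n) * v) \<longlonglongrightarrow> y + 0 * v" by (intro tendsto_intros mlim)
          then have l: "(\<lambda>n. y + (1 / m n) * v) \<longlonglongrightarrow> y" by simp
          have "\<forall>\<^sub>F n in sequentially. indicator {a<..b} (y + (1 / m n) * v) = (indicator {a<..b} y :: real)"
          proof (cases "a < y \<and> y < b")
            case True
            then show ?thesis
              using order_tendstoD[OF l, of a] order_tendstoD[OF l, of b]
              by (auto elim: eventually_elim2)
          next
            case False
            then have "y < a \<or> y > b" using y by linarith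
            then show ?thesis
              using order_tendstoD[OF l, of a] order_tendstoD[OF l, of b]
              by (auto elim!: eventually_mono)
          qed
          then show "(\<lambda>n. indicator {a<..b} (y + (1 / m n) * v) * (2 * sqrt pi * exp (- v\<^sup>2))) \<longlonglongrightarrow> indicator {a<..b} y * (2 * sqrt pi * exp (- v\<^sup>2))"
            by (intro tendsto_eventually) (auto elim: eventually_mono)
        qed
      qed (use e0 in \<open>auto split: split_indicator\<close>)
      also have "(LINT v|lborel. indicator {a<..b} y * (2 * sqrt pi * exp (- v\<^sup>2))) =
          indicator {a<..b} y * (LINT v|lborel. 2 * sqrt pi * exp (- v\<^sup>2))"
        by (rule integral_mult_right_zero)
      finally show ?thesis unfolding e0 .
    qed
    \<comment> \<open>Fubini applies because the kernel is bounded and the interval has finite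
      length.\<close>
    have swap: "(LINT x|lborel. indicator {a<..b} x * J' n x) = (LINT y|lborel. F y * of_real (c n y))" for n
    proof -
      have "integrable (lborel \<Otimes>\<^sub>M lborel) (\<lambda>(x, y). complex_of_real (indicator {a<..b} x) * (F y * of_real (k n (y - x))))"
      proof (rule lborel_pair.Fubini_integrable)
        have iFk: "integrable lborel (\<lambda>y. F y * of_real (k n (y - x)))" for x
          using F k_le by (intro integrable_ft_factor[where B="2 * sqrt pi * m n"]) auto
        then show "AE x in lborel. integrable lborel (\<lambda>y. case (x, y) of (x, y) \<Rightarrow> complex_of_real (indicator {a<..b} x) * (F y * of_real (k n (y - x))))"
          by auto
        have "integrable lborel (\<lambda>x. indicator {a<..b} x * (\<integral>y. norm (F y) \<partial>lborel) * (2 * sqrt pi * m n))"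
          by (intro integrable_mult_left integrable_real_indicator fin) auto
        then show "integrable lborel (\<lambda>x. LINT y|lborel. norm (case (x, y) of (x, y) \<Rightarrow> complex_of_real (indicator {a<..b} x) * (F y * of_real (k n (y - x)))))"
        proof (rule Bochner_Integration.integrable_bound)
          have "(LINT y|lborel. norm (complex_of_real (indicator {a<..b} x) * (F y * of_real (k n (y - x)))))
             \<le> indicator {a<..b} x * (\<integral>y. norm (F y) \<partial>lborel) * (2 * sqrt pi * m n)" for x
          proof -
            have "(LINT y|lborel. norm (complex_of_real (indicator {a<..b} x) * (F y * of_real (k n (y - x)))))
              \<le> (LINT y|lborel. indicator {a<..b} x * norm (F y) * (2 * sqrt pi * m n))"
            proof (intro integral_mono integrable_norm integrable_mult_right iFk)
              show "norm (complex_of_real (indicator {a<..b} x) * (F y * of_real (k n (y - x)))) \<le> indicator {a<..b} x * norm (F y) * (2 * sqrt pi * m n)" for y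
                using mult_left_mono[OF k_le(2)[of n "y - x"], of "norm (F y)"] k_le(1)[of n "y - x"]
                by (auto simp: norm_mult split: split_indicator)
              show "integrable lborel (\<lambda>y. indicator {a<..b} x * norm (F y) * (2 * sqrt pi * m n))"
                using F by simp
            qed
            then show ?thesis by simp
          qed
          moreover have "0 \<le> (LINT y|lborel. norm (complex_of_real (indicator {a<..b} x) * (F y * of_real (k n (y - x)))))" for x
            by simp
          ultimately show "AE x in lborel. norm (LINT y|lborel. norm (case (x, y) of (x, y) \<Rightarrow> complex_of_real (indicator {a<..b} x) * (F y * of_real (k n (y - x)))))
              \<le> norm (indicator {a<..b} x * (\<integral>y. norm (F y) \<partial>lborel) * (2 * sqrt pi * m n))"
            by (auto intro!: AE_I2 intro: order_trans[OF _ abs_ge_self])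
        qed measurable
      qed measurable
      note Fubini = lborel_pair.Fubini_integral[OF this]
      have "(LINT y|lborel. complex_of_real (indicator {a<..b} x) * (F y * of_real (k n (y - x)))) = indicator {a<..b} x * J' n x" for x
        unfolding J'k by (subst integral_mult_right_zero) (simp add: of_real_indicator)
      moreover have "(LINT x|lborel. complex_of_real (indicator {a<..b} x) * (F y * of_real (k n (y - x)))) = F y * of_real (c n y)" for y
      proof -
        have "(LINT x|lborel. complex_of_real (indicator {a<..b} x) * (F y * of_real (k n (y - x)))) =
          (LINT x|lborel. F y * of_real (indicator {a<..b} x * k n (y - x)))"
          by (intro Bochner_Integration.integral_cong) auto
        then show ?thesis by (simp only: integral_mult_right_zero integral_complex_of_real c_def)
      qed
      ultimately show ?thesis using Fubini by simp
    qed
    have "(\<lambda>n. LINT x|lborel. indicator {a<..b} x * J' n x) \<longlonglongrightarrow> (LINT x|lborel. indicator {a<..b} x * J x)"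
    proof (rule integral_dominated_convergence[where w="\<lambda>x. indicator {a<..b} x * B"])
      show "(\<lambda>x. indicator {a<..b} x * J' n x) \<in> borel_measurable lborel" for n unfolding J'_def by measurable
      show "AE x in lborel. (\<lambda>n. indicator {a<..b} x * J' n x) \<longlonglongrightarrow> indicator {a<..b} x * J x"
        by (intro AE_I2 tendsto_intros J'lim)
      show "AE x in lborel. norm (indicator {a<..b} x * J' n x) \<le> indicator {a<..b} x * B" for n
        using bJ' by (auto simp: norm_mult split: split_indicator)
      show "integrable lborel (\<lambda>x. indicator {a<..b} x * B)"
        by (intro integrable_mult_left integrable_real_indicator fin) auto
    qed measurable
    moreover have "(\<lambda>n. LINT y|lborel. F y * of_real (c n y)) \<longlonglongrightarrow> (LINT y|lborel. F y * of_real (indicator {a<..b} y * (2 * pi)))"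
    proof (rule integral_dominated_convergence[where w="\<lambda>y. norm (F y) * (2 * pi)"])
      have "AE y in lborel. y \<noteq> a \<and> y \<noteq> b"
        using AE_lborel_singleton[of a] AE_lborel_singleton[of b] by eventually_elim auto
      then show "AE y in lborel. (\<lambda>n. F y * of_real (c n y)) \<longlonglongrightarrow> F y * of_real (indicator {a<..b} y * (2 * pi))"
        by eventually_elim (intro tendsto_intros clim, auto)
      show "AE y in lborel. norm (F y * of_real (c n y)) \<le> norm (F y) * (2 * pi)" for n
        using cb by (auto simp: norm_mult intro!: mult_left_mono)
    qed (use F in auto)
    ultimately have "(LINT x|lborel. indicator {a<..b} x * J x) = (LINT y|lborel. F y * of_real (indicator {a<..b} y * (2 * pi)))"
      unfolding swap using LIMSEQ_unique by blast
    also have "\<dots> = (LINT y|lborel. (2 * of_real pi) * (indicator {a<..b} y *\<^sub>R F y))"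
      by (intro Bochner_Integration.integral_cong) (auto split: split_indicator)
    also have "\<dots> = 2 * of_real pi * (LINT x:{a<..b}|lborel. F x)"
      by (simp only: integral_mult_right_zero set_lebesgue_integral_def)
    also have "(LINT x|lborel. indicator {a<..b} x * J x) = (LINT x:{a<..b}|lborel. J x)"
      unfolding set_lebesgue_integral_def
      by (intro Bochner_Integration.integral_cong) (auto split: split_indicator)
    finally show ?thesis .
  qed
  have Ji: "set_integrable lborel {a<..b} J" for a b
  proof -
    have "integrable lborel (\<lambda>x. indicator {a<..b} x * B)"
      by (intro integrable_mult_left integrable_real_indicator fin) auto
    then show ?thesis unfolding set_integrable_def
      by (rule Bochner_Integration.integrable_bound)
        (use bJ in \<open>auto intro!: AE_I2 intro: order_trans[OF _ abs_ge_self] split: split_indicator\<close>)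
  qed
  have Fi: "set_integrable lborel {a<..b} (\<lambda>x. 2 * of_real pi * F x)" for a b
    unfolding set_integrable_def using F by (intro integrable_mult_indicator integrable_mult_right) auto
  have "AE y in lborel. J y - 2 * of_real pi * F y = 0"
  proof (rule AE_eq_0_of_interval_integrals)
    show "set_integrable lborel {a<..b} (\<lambda>y. J y - 2 * of_real pi * F y)" for a b
      by (intro set_integral_diff Ji Fi)
    show "(LINT y:{a<..b}|lborel. J y - 2 * of_real pi * F y) = 0" for a b
      by (subst set_integral_diff(2)[OF Ji Fi]) (simp add: main)
  qed measurable
  then show ?thesis by (simp add: J_def)
qed

subsection \<open>Functions vanishing at powers of integers together with their transform\<close>

text \<open>The points of \<open>S\<close> where \<open>h\<close> is nonzero form an open null set,
  which is empty. A general open \<open>S\<close> admits functions that are continuous only off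
  0.\<close>

lemma continuous_AE_eq_0:
  fixes h :: "real \<Rightarrow> complex"
  assumes "open S" "continuous_on S h" "AE y in lborel. h y = 0" "y \<in> S"
  shows "h y = 0"
proof -
  have o: "open {y \<in> S. h y \<noteq> 0}"
    using continuous_open_preimage[OF assms(2,1), of "- {0}"] by (simp add: vimage_def Int_def conj_commute open_Compl)
  have "AE y in lborel. y \<notin> {y \<in> S. h y \<noteq> 0}"
    using assms(3) by eventually_elim simp
  then have "{y \<in> S. h y \<noteq> 0} \<in> null_sets lborel"
    using o by (subst AE_iff_null_sets) auto
  then have "negligible {y \<in> S. h y \<noteq> 0}"
    by (simp add: negligible_iff_null_sets null_sets_completionI)
  then have "{y \<in> S. h y \<noteq> 0} = {}"
    using open_not_negligible[OF o] by blast
  with assms(4) show ?thesis by blast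
qed

lemma continuous_on_ft:
  assumes [measurable]: "F \<in> borel_measurable borel" and F: "integrable lborel F"
  shows "continuous_on S (ft F)"
proof (rule continuous_on_subset[of UNIV])
  show "continuous_on UNIV (ft F)"
    unfolding continuous_on_sequentially comp_def ft_def
  proof (intro allI impI ballI, elim conjE)
    fix X :: "nat \<Rightarrow> real" and x
    assume X: "X \<longlonglongrightarrow> x"
    show "(\<lambda>n. LINT y|lborel. F y * cis (- (X n * y))) \<longlonglongrightarrow> (LINT y|lborel. F y * cis (- (x * y)))"
    proof (rule integral_dominated_convergence[where w = "\<lambda>y. norm (F y)"])
      show "AE y in lborel. (\<lambda>n. F y * cis (- (X n * y))) \<longlonglongrightarrow> F y * cis (- (x * y))"
        using X by (intro AE_I2 tendsto_intros)
    qed (use F in \<open>auto simp: norm_mult\<close>)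
  qed
qed simp

lemma integrable_of_moment:
  assumes [measurable]: "F \<in> borel_measurable borel" and "integrable lborel (\<lambda>y. (1 + \<bar>y\<bar>) ^ k * norm (F y :: complex))"
    and "j \<le> k"
  shows "integrable lborel (\<lambda>y. (1 + \<bar>y\<bar>) ^ j * norm (F y))"
  using assms(2)
proof (rule Bochner_Integration.integrable_bound)
  show "AE y in lborel. norm ((1 + \<bar>y\<bar>) ^ j * norm (F y)) \<le> norm ((1 + \<bar>y\<bar>) ^ k * norm (F y))"
    using assms(3) by (auto intro!: AE_I2 mult_right_mono power_increasing simp: abs_mult)
qed auto

text \<open>\<open>K\<close> is chosen from the exponents before \<open>G\<close>, which fixes the
  weight independently of the measure. \<open>G\<close> may be singular at 0, as can happen after
  the substitution \<open>y = x\<^sup>2\<close>.\<close>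

lemma Fourier_uniqueness_powers:
  assumes \<alpha>: "0 < \<alpha>" "\<alpha> < 1" and \<beta>: "0 < \<beta>" "\<beta> < 1" and sum: "\<alpha> + \<beta> < 1"
  shows "\<exists>K::nat. \<forall>G c c' y. c > 0 \<longrightarrow> c' > 0 \<longrightarrow> G \<in> borel_measurable borel \<longrightarrow>
    integrable lborel (\<lambda>y. (1 + \<bar>y\<bar>) ^ K * norm (G y)) \<longrightarrow> continuous_on (- {0}) G \<longrightarrow>
    (\<forall>(n::nat) s. n \<ge> 1 \<longrightarrow> s \<in> {1, -1} \<longrightarrow> G (s * (c * real n powr \<beta>)) = 0) \<longrightarrow>
    (\<forall>(n::nat) s. n \<ge> 1 \<longrightarrow> s \<in> {1, -1} \<longrightarrow> ft G (s * (c' * real n powr \<alpha>)) = 0) \<longrightarrow>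
    y \<noteq> 0 \<longrightarrow> G y = 0"
proof -
  define p q where "p = 1 / \<beta> - 1" and "q = 1 / \<alpha> - 1"
  have pq0: "p > 0" "q > 0" using \<alpha> \<beta> by (auto simp: p_def q_def field_simps)
  have "p * q = 1 + (1 - \<alpha> - \<beta>) / (\<alpha> * \<beta>)"
    using \<alpha> \<beta> by (simp add: p_def q_def field_simps)
  also have "\<dots> > 1" using \<alpha> \<beta> sum by simp
  finally have pq: "p * q > 1" .
  \<comment> \<open>Strictly between 1 and \<open>p * q\<close>: the order of the moment still grows
    by a factor \<open>\<theta>\<close> per round, and the gap \<open>p * q - \<theta>\<close>
    absorbs the rounding losses.\<close>
  define \<theta> where "\<theta> = (1 + p * q) / 2"
  have \<theta>: "1 < \<theta>" "\<theta> < p * q" using pq by (auto simp: \<theta>_def)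
  \<comment> \<open>\<open>K1\<close> ensures \<open>2 \<le> q * k\<close>. \<open>K2\<close> pays
    for the rounding: up to 3 lost in \<open>j\<close>, which costs \<open>3 * p\<close> later, and
    up to 3 lost in \<open>i\<close>.\<close>
  obtain K1 K2 where K1: "2 / q \<le> real K1" and K2: "(3 * p + 3) / (p * q - \<theta>) \<le> real K2"
    using real_arch_simple by metis
  define K where "K = Suc (max K1 K2)"
  have indices: "\<exists>i j. \<theta> * k \<le> real i \<and> real j + 2 \<le> q * k \<and> real i + 2 \<le> p * j" if k: "k \<ge> K" for k :: nat
  proof -
    have k1: "2 \<le> q * k" "3 * p + 3 \<le> (p * q - \<theta>) * k"
    proof -
      have "2 / q \<le> real k" using K1 k by (simp add: K_def)
      then show "2 \<le> q * k" using pq0 by (simp add: field_simps)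
      have "(3 * p + 3) / (p * q - \<theta>) \<le> real k" using K2 k by (simp add: K_def)
      then show "3 * p + 3 \<le> (p * q - \<theta>) * k" using \<theta> by (simp add: field_simps)
    qed
    \<comment> \<open>The largest integer satisfying the margin 2; the subtraction does not truncate
      because \<open>q * k \<ge> 2\<close>.\<close>
    define j where "j = nat \<lfloor>q * k\<rfloor> - 2"
    have j: "real j + 2 \<le> q * k" "q * k \<le> real j + 3" using k1 unfolding j_def by linarith+
    define i where "i = nat \<lfloor>p * j\<rfloor> - 2"
    have "p * (q * k) \<le> p * (real j + 3)" using j pq0 by (intro mult_left_mono) auto
    then have pj: "\<theta> * k + 3 \<le> p * j" using k1 by (simp add: algebra_simps)
    moreover have "\<theta> * k \<ge> 0" using \<theta> by simp
    ultimately have i: "real i + 2 \<le> p * j" "p * j \<le> real i + 3" unfolding i_def by linarith+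
    then show ?thesis using j pj by (intro exI[of _ i] exI[of _ j]) auto
  qed
  show ?thesis
  proof (intro exI[of _ K] allI impI)
    fix G c c' and y0 :: real
    assume c: "c > 0" "c' > 0" and G[measurable]: "G \<in> borel_measurable borel"
      and GK: "integrable lborel (\<lambda>y. (1 + \<bar>y\<bar>) ^ K * norm (G y))"
      and cont: "continuous_on (- {0}) G"
      and Gzero: "\<forall>(n::nat) s. n \<ge> 1 \<longrightarrow> s \<in> {1, -1} \<longrightarrow> G (s * (c * real n powr \<beta>)) = 0"
      and Hzero: "\<forall>(n::nat) s. n \<ge> 1 \<longrightarrow> s \<in> {1, -1} \<longrightarrow> ft G (s * (c' * real n powr \<alpha>)) = 0"
      and y0: "y0 \<noteq> 0"
    define I where "I k \<longleftrightarrow> integrable lborel (\<lambda>y. (1 + \<bar>y\<bar>) ^ k * norm (G y))" for k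
    define M where "M k = (LINT y|lborel. (1 + \<bar>y\<bar>) ^ k * norm (G y))" for k
    have Gint: "integrable lborel G"
      using integrable_of_moment[OF G GK, of 0] by (simp add: integrable_norm_iff)
    obtain D1 where D1: "D1 \<ge> 1" and tr1: "\<And>F j k. F \<in> borel_measurable borel \<Longrightarrow>
      integrable lborel (\<lambda>y. (1 + \<bar>y\<bar>) ^ k * norm (F y)) \<Longrightarrow>
      (\<forall>(n::nat) s. n \<ge> 1 \<longrightarrow> s \<in> {1, -1} \<longrightarrow> ft F (s * (c' * real n powr \<alpha>)) = 0) \<Longrightarrow>
      real j + 2 \<le> (1 / \<alpha> - 1) * real k \<Longrightarrow>
      integrable lborel (\<lambda>x. (1 + \<bar>x\<bar>) ^ j * norm (ft F x)) \<and>
      (LINT x|lborel. (1 + \<bar>x\<bar>) ^ j * norm (ft F x)) \<le> D1 ^ k * (LINT y|lborel. (1 + \<bar>y\<bar>) ^ k * norm (F y))"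
      by (rule ft_moment_transfer[OF \<alpha> c(2)]) (rule that)
    obtain D2 where D2: "D2 \<ge> 1" and tr2: "\<And>F j k. F \<in> borel_measurable borel \<Longrightarrow>
      integrable lborel (\<lambda>y. (1 + \<bar>y\<bar>) ^ k * norm (F y)) \<Longrightarrow>
      (\<forall>(n::nat) s. n \<ge> 1 \<longrightarrow> s \<in> {1, -1} \<longrightarrow> ft F (s * (c * real n powr \<beta>)) = 0) \<Longrightarrow>
      real j + 2 \<le> (1 / \<beta> - 1) * real k \<Longrightarrow>
      integrable lborel (\<lambda>x. (1 + \<bar>x\<bar>) ^ j * norm (ft F x)) \<and>
      (LINT x|lborel. (1 + \<bar>x\<bar>) ^ j * norm (ft F x)) \<le> D2 ^ k * (LINT y|lborel. (1 + \<bar>y\<bar>) ^ k * norm (F y))"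
      by (rule ft_moment_transfer[OF \<beta> c(1)]) (rule that)
    have Hint: "integrable lborel (ft G)"
    proof -
      obtain j :: nat where "real j + 2 \<le> q * K" using indices[of K] by auto
      with tr1[OF G GK Hzero, of j] have "integrable lborel (\<lambda>x. (1 + \<bar>x\<bar>) ^ j * norm (ft G x))"
        by (auto simp: q_def)
      from integrable_of_moment[OF _ this, of 0] show ?thesis by (simp add: integrable_norm_iff)
    qed
    \<comment> \<open>Inversion holds almost everywhere; continuity off 0 extends it to every
      nonzero point, in particular to the prescribed zeros of \<open>G\<close>.\<close>
    have inv: "ft (ft G) (- y) = 2 * of_real pi * G y" if "y \<noteq> 0" for y
    proof -
      have "ft (ft G) (- y) - 2 * of_real pi * G y = 0"
      proof (rule continuous_AE_eq_0[of "- {0}"])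
        have "continuous_on (- {0}) (\<lambda>y. ft (ft G) (- y))"
          by (intro continuous_on_compose2[OF continuous_on_ft[of _ UNIV]] Hint continuous_intros) auto
        then show "continuous_on (- {0}) (\<lambda>y. ft (ft G) (- y) - 2 * of_real pi * G y)"
          by (intro continuous_intros cont)
        show "AE y in lborel. ft (ft G) (- y) - 2 * of_real pi * G y = 0"
          using ft_inversion[OF G Gint Hint] by eventually_elim simp
      qed (use that in auto)
      then show ?thesis by simp
    qed
    \<comment> \<open>Turns \<open>D2 ^ j\<close> into a power with exponent proportional to
      \<open>k\<close>, as \<open>j \<le> q * k \<le> Q * k\<close>.\<close>
    define Q where "Q = nat \<lceil>q\<rceil>"
    define D where "D = D2 ^ Q * D1"
    have D: "D \<ge> 1" unfolding D_def using D1 D2 one_le_power[OF D2, of Q] mult_mono[of 1 "D2 ^ Q" 1 D1] by simp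
    \<comment> \<open>One round from \<open>G\<close> to \<open>ft G\<close> and back:
      \<open>ft (ft G)\<close> is \<open>2 * pi\<close> times the reflection of \<open>G\<close>, so
      it inherits the zeros of exponent \<open>\<beta>\<close>.\<close>
    have step: "\<exists>i. \<theta> * k \<le> real i \<and> I i \<and> M i \<le> D ^ k * M k" if k: "k \<ge> K" "I k" for k
    proof -
      obtain i j where ij: "\<theta> * k \<le> real i" "real j + 2 \<le> q * k" "real i + 2 \<le> p * j"
        using indices[OF k(1)] by auto
      have 1: "integrable lborel (\<lambda>x. (1 + \<bar>x\<bar>) ^ j * norm (ft G x))"
        "(LINT x|lborel. (1 + \<bar>x\<bar>) ^ j * norm (ft G x)) \<le> D1 ^ k * M k"
        using tr1[OF G, of k j] k(2) Hzero ij(2) by (auto simp: I_def M_def q_def)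
      have z: "ft (ft G) (s * (c * real n powr \<beta>)) = 0" if "n \<ge> 1" "s \<in> {1, -1}" for n :: nat and s
        using inv[of "(- s) * (c * real n powr \<beta>)"] Gzero[rule_format, of n "- s"] that c by auto
      have 2: "integrable lborel (\<lambda>x. (1 + \<bar>x\<bar>) ^ i * norm (ft (ft G) x))"
        "(LINT x|lborel. (1 + \<bar>x\<bar>) ^ i * norm (ft (ft G) x)) \<le> D2 ^ j * (LINT x|lborel. (1 + \<bar>x\<bar>) ^ j * norm (ft G x))"
        using tr2[of "ft G" j i] z ij(3) 1 by (auto simp: p_def)
      have AEinv: "AE y in lborel. (1 + \<bar>y\<bar>) ^ i * norm (G y) = (1 / (2 * pi)) * ((1 + \<bar>0 + (-1) * y\<bar>) ^ i * norm (ft (ft G) (0 + (-1) * y)))"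
        using ft_inversion[OF G Gint Hint] by eventually_elim (simp add: norm_mult)
      have i3: "integrable lborel (\<lambda>y. (1 / (2 * pi)) * ((1 + \<bar>0 + (-1) * y\<bar>) ^ i * norm (ft (ft G) (0 + (-1) * y))))"
        using lborel_integrable_real_affine[OF 2(1), of "-1" 0] by (intro integrable_mult_right) simp
      have Ii: "I i" unfolding I_def
        by (rule integrable_cong_AE_imp[OF i3 _ AEinv[THEN AE_symmetric]]) measurable
      have "M i = (LINT y|lborel. (1 / (2 * pi)) * ((1 + \<bar>0 + (-1) * y\<bar>) ^ i * norm (ft (ft G) (0 + (-1) * y))))"
        unfolding M_def by (intro integral_cong_AE AEinv) measurable
      also have "\<dots> = (1 / (2 * pi)) * (LINT x|lborel. (1 + \<bar>x\<bar>) ^ i * norm (ft (ft G) x))"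
        by (subst integral_mult_right_zero, subst (2) lborel_integral_real_affine[of "-1" _ 0]) auto
      also have "\<dots> \<le> 1 * (LINT x|lborel. (1 + \<bar>x\<bar>) ^ i * norm (ft (ft G) x))"
        using pi_gt3 by (intro mult_right_mono) auto
      also have "\<dots> \<le> D2 ^ j * (D1 ^ k * M k)"
        using order_trans[OF 2(2) mult_left_mono[OF 1(2)]] D2 by simp
      also have "\<dots> \<le> (D2 ^ Q) ^ k * (D1 ^ k * M k)"
      proof (intro mult_right_mono mult_nonneg_nonneg)
        have "real j \<le> q * k" using ij by simp
        also have "\<dots> \<le> real Q * k" unfolding Q_def using pq0 by (intro mult_right_mono) linarith+
        finally have "j \<le> Q * k" by (simp flip: of_nat_mult)
        then show "D2 ^ j \<le> (D2 ^ Q) ^ k" using D2 by (simp add: power_increasing flip: power_mult)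
      qed (use D1 in \<open>auto simp: M_def\<close>)
      finally have "M i \<le> D ^ k * M k" by (simp add: D_def power_mult_distrib mult_ac)
      then show ?thesis using ij Ii by auto
    qed
    \<comment> \<open>\<open>R\<close> dominates the starting moment and satisfies
      \<open>D \<le> R powr (\<theta> - 1)\<close>. Then \<open>D ^ k * R ^ k \<le> R ^ i\<close> as
      soon as \<open>i \<ge> \<theta> * k\<close>, which closes the induction.\<close>
    define R where "R = max 1 (max (M K) (D powr (1 / (\<theta> - 1))))"
    have R1: "R \<ge> 1" by (simp add: R_def)
    have RD: "D \<le> R powr (\<theta> - 1)"
    proof -
      have "D = (D powr (1 / (\<theta> - 1))) powr (\<theta> - 1)" using \<theta> D by (simp add: powr_powr)
      also have "\<dots> \<le> R powr (\<theta> - 1)" using \<theta> by (intro powr_mono2) (auto simp: R_def)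
      finally show ?thesis .
    qed
    have moments: "\<exists>k\<ge>N. k \<ge> K \<and> I k \<and> M k \<le> R ^ k" for N
    proof (induction N)
      case 0
      have "M K \<le> R ^ 1" by (simp add: R_def)
      also have "\<dots> \<le> R ^ K" using R1 by (intro power_increasing) (auto simp: K_def)
      finally show ?case using GK by (intro exI[of _ K]) (auto simp: I_def)
    next
      case (Suc N)
      then obtain k where k: "k \<ge> N" "k \<ge> K" "I k" "M k \<le> R ^ k" by auto
      obtain i where i: "\<theta> * k \<le> real i" "I i" "M i \<le> D ^ k * M k" using step[OF k(2,3)] by auto
      have "k \<ge> 1" using k(2) by (simp add: K_def)
      then have "1 * real k < \<theta> * k" using \<theta> by (intro mult_strict_right_mono) auto
      with i have ki: "k < i" by linarith
      have "D ^ k \<le> (R powr (\<theta> - 1)) ^ k" using RD D by (intro power_mono) auto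
      also have "\<dots> = R powr ((\<theta> - 1) * k)" using R1 by (simp add: powr_power mult.commute)
      also have "\<dots> \<le> R powr (real (i - k))"
        using R1 i ki by (intro powr_mono) (auto simp: of_nat_diff algebra_simps)
      also have "\<dots> = R ^ (i - k)" using R1 by (simp add: powr_realpow)
      finally have "D ^ k * M k \<le> R ^ (i - k) * R ^ k"
        using k(4) R1 by (intro mult_mono) (auto simp: M_def)
      also have "\<dots> = R ^ i" using ki by (simp flip: power_add)
      finally have "M i \<le> R ^ i" using i by simp
      then show ?case using ki k i by (intro exI[of _ i]) auto
    qed
    \<comment> \<open>From \<open>x0\<close> on, the decay estimate combined with
      \<open>M k \<le> R ^ k\<close> has ratio at most 1/2, so \<open>norm (ft G x)\<close> lies
      below arbitrarily high powers of 1/2.\<close>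
    define x0 where "x0 = c' * max 1 ((4 * R * c') powr (1 / q))"
    have H0: "ft G x = 0" if x: "x \<ge> x0" for x
    proof -
      have xc: "x / c' \<ge> max 1 ((4 * R * c') powr (1 / q))"
        unfolding pos_le_divide_eq[OF c(2)] using x by (simp only: x0_def mult.commute)
      then have "((4 * R * c') powr (1 / q)) powr q \<le> (x / c') powr q"
        using pq0 by (intro powr_mono2) auto
      then have big: "4 * R * c' \<le> (x / c') powr q" using pq0 R1 c by (simp add: powr_powr)
      have xpos: "x / c' \<ge> 1" using xc by simp
      then have xc': "c' \<le> x" "0 < x" using c by (auto simp: field_simps)
      have small: "R * (2 * c' * (\<bar>x\<bar> / c') powr (1 - 1 / \<alpha>)) \<le> 1 / 2"
      proof -
        define P where "P = (x / c') powr q"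
        have "P > 0" "4 * R * c' \<le> P" using xpos big by (auto simp: P_def)
        then have "R * (2 * c' * inverse P) \<le> 1 / 2" by (simp add: field_simps)
        also have "inverse P = (\<bar>x\<bar> / c') powr (1 - 1 / \<alpha>)"
          using xc' by (simp add: P_def q_def flip: powr_minus)
        finally show ?thesis .
      qed
      have bound: "norm (ft G x) \<le> (1 / 2) ^ N" for N
      proof -
        obtain k where k: "k \<ge> N" "k \<ge> K" "I k" "M k \<le> R ^ k" using moments by blast
        have "norm (ft G x) \<le> M k * (2 * c' * (\<bar>x\<bar> / c') powr (1 - 1 / \<alpha>)) ^ k"
          unfolding M_def using k(3) Hzero xc' by (intro ft_decay \<alpha> c G) (auto simp: I_def)
        also have "\<dots> \<le> R ^ k * (2 * c' * (\<bar>x\<bar> / c') powr (1 - 1 / \<alpha>)) ^ k"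
          using k c by (intro mult_right_mono) auto
        also have "\<dots> = (R * (2 * c' * (\<bar>x\<bar> / c') powr (1 - 1 / \<alpha>))) ^ k" by (simp only: power_mult_distrib)
        also have "\<dots> \<le> (1 / 2) ^ k" using small R1 c by (intro power_mono) auto
        also have "\<dots> \<le> (1 / 2) ^ N" using k by (intro power_decreasing) auto
        finally show ?thesis .
      qed
      have "(\<lambda>N. (1 / 2 :: real) ^ N) \<longlonglongrightarrow> 0" by (intro LIMSEQ_realpow_zero) auto
      from LIMSEQ_le_const[OF this, of "norm (ft G x)"] bound show ?thesis by auto
    qed
    have "ft G x = 0" for x
    proof -
      define S where "S = R * (\<bar>x - x0\<bar> + 1)"
      have "(\<lambda>n. inverse (fact n) * S ^ n) \<longlonglongrightarrow> 0"
        using summable_exp by (rule summable_LIMSEQ_zero)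
      moreover have "\<exists>k\<ge>N. norm (ft G x) \<le> inverse (fact k) * S ^ k" for N
      proof -
        obtain k where k: "k \<ge> N" "k \<ge> K" "I k" "M k \<le> R ^ k" using moments by blast
        have k1: "k \<ge> 1" using k(2) by (simp add: K_def)
        \<comment> \<open>\<open>k\<close> equally spaced nodes in the unit interval to the right of
          \<open>x0\<close>, where \<open>ft G\<close> is already known to vanish. Every factor is
          at most \<open>\<bar>x - x0\<bar> + 1\<close>, and the factorial outgrows
          \<open>S ^ k\<close>.\<close>
        define t where "t j = x0 + real j / real k" for j
        have inj: "inj_on t {1..k}" using k1 by (auto simp: inj_on_def t_def)
        have "norm (ft G x) \<le> M k * (\<Prod>u\<in>t ` {1..k}. \<bar>x - u\<bar>) / fact k"
          unfolding M_def
        proof (rule ft_interpolation[OF G])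
          show "ft G u = 0" if "u \<in> t ` {1..k}" for u
            using that by (intro H0) (auto simp: t_def)
        qed (use k inj in \<open>auto simp: card_image I_def\<close>)
        also have "(\<Prod>u\<in>t ` {1..k}. \<bar>x - u\<bar>) = (\<Prod>j=1..k. \<bar>x - t j\<bar>)"
          using inj by (simp add: prod.reindex)
        also have "M k * (\<Prod>j=1..k. \<bar>x - t j\<bar>) / fact k \<le> R ^ k * (\<Prod>j=1..k. \<bar>x - x0\<bar> + 1) / fact k"
        proof (intro divide_right_mono mult_mono prod_mono)
          show "0 \<le> \<bar>x - t j\<bar> \<and> \<bar>x - t j\<bar> \<le> \<bar>x - x0\<bar> + 1" if "j \<in> {1..k}" for j
          proof -
            have "0 \<le> real j / real k" "real j / real k \<le> 1" using that by auto
            then show ?thesis unfolding t_def by linarith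
          qed
        qed (use k R1 in \<open>auto intro: prod_nonneg\<close>)
        also have "\<dots> = inverse (fact k) * S ^ k" by (simp add: S_def power_mult_distrib divide_inverse mult_ac)
        finally show ?thesis using k by auto
      qed
      ultimately show ?thesis
      proof -
        assume l: "(\<lambda>n. inverse (fact n) * S ^ n) \<longlonglongrightarrow> 0"
          and b: "\<And>N. \<exists>k\<ge>N. norm (ft G x) \<le> inverse (fact k) * S ^ k"
        show ?thesis
        proof (rule ccontr)
          assume "ft G x \<noteq> 0"
          then have "\<forall>\<^sub>F n in sequentially. inverse (fact n) * S ^ n < norm (ft G x)"
            using order_tendstoD(2)[OF l] by simp
          with b show False unfolding eventually_sequentially by (meson not_less)
        qed
      qed
    qed
    then have "ft (ft G) (- y0) = 0" by (simp add: ft_def[of "ft G"])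
    with inv[OF y0] show "G y0 = 0" by simp
  qed
qed

subsection \<open>Parallel and concurrent lines\<close>

text \<open>The substitution \<open>y = x\<^sup>2\<close> on the positive half-line. Continuity is
  assumed at positive points only, since the integrands may be singular at 0.\<close>

lemma integral_square_substitution:
  fixes F :: "real \<Rightarrow> complex"
  assumes cont: "\<And>y. y > 0 \<Longrightarrow> isCont F y"
    and int: "set_integrable lborel {0<..} (\<lambda>x. 2 * x * norm (F (x\<^sup>2)))"
    and meas [measurable]: "F \<in> borel_measurable borel"
  shows "set_integrable lborel {0<..} F"
    and "(LINT y:{0<..}|lborel. F y) = (LINT x:{0<..}|lborel. of_real (2 * x) * F (x\<^sup>2))"
proof -
  have e: "einterval 0 \<infinity> = {0<..}" by (auto simp: einterval_def zero_ereal_def)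
  have lim0: "((ereal \<circ> (\<lambda>x. x\<^sup>2) \<circ> real_of_ereal) \<longlongrightarrow> 0) (at_right 0)"
    unfolding zero_ereal_def comp_assoc ereal_tendsto_simps o_def
    by (auto simp: ereal_tendsto_simps[unfolded o_def] intro!: tendsto_eq_intros)
  have limi: "((ereal \<circ> (\<lambda>x. x\<^sup>2) \<circ> real_of_ereal) \<longlongrightarrow> \<infinity>) (at_left \<infinity>)"
  proof -
    have "filterlim (\<lambda>x::real. x\<^sup>2) at_top at_top"
      by (simp add: filterlim_pow_at_top filterlim_ident)
    then show ?thesis
      unfolding comp_assoc ereal_tendsto_simps2 at_left_PInf filterlim_filtermap by (simp add: comp_def tendsto_PInfty_eq_at_top)
  qed
  \<comment> \<open>The substitution rule for nonnegative functions yields integrability of the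
    norm; the rule for complex functions presupposes this integrability.\<close>
  have "set_integrable lborel (einterval 0 \<infinity>) (\<lambda>y. norm (F y))"
  proof (rule interval_integral_substitution_nonneg(1)[where g = "\<lambda>x. x\<^sup>2" and g' = "\<lambda>x. 2 * x"])
    show "isCont (\<lambda>y. norm (F y)) (x\<^sup>2)" if "0 < ereal x" for x
      using that by (intro continuous_norm cont) (auto simp: zero_ereal_def)
    show "DERIV (\<lambda>x. x\<^sup>2) x :> 2 * x" for x :: real by (auto intro!: derivative_eq_intros)
    show "set_integrable lborel (einterval 0 \<infinity>) (\<lambda>x. norm (F (x\<^sup>2)) * (2 * x))"
      using int unfolding e by (simp add: mult_ac)
  qed (use lim0 limi in \<open>auto simp: zero_ereal_def\<close>)
  then show i: "set_integrable lborel {0<..} F"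
    unfolding e set_integrable_def
    by (rule Bochner_Integration.integrable_bound) (auto split: split_indicator)
  have "(LBINT y=0..\<infinity>. F y) = (LBINT x=0..\<infinity>. (2 * x) *\<^sub>R F (x\<^sup>2))"
  proof (rule interval_integral_substitution_integrable[where g = "\<lambda>x. x\<^sup>2" and g' = "\<lambda>x. 2 * x"])
    show "isCont F (x\<^sup>2)" if "0 < ereal x" for x
      using that by (intro cont) (auto simp: zero_ereal_def)
    show "DERIV (\<lambda>x. x\<^sup>2) x :> 2 * x" for x :: real by (auto intro!: derivative_eq_intros)
    show "set_integrable lborel (einterval 0 \<infinity>) (\<lambda>x. (2 * x) *\<^sub>R F (x\<^sup>2))"
      using int unfolding e set_integrable_def
      by (rule Bochner_Integration.integrable_bound) (auto simp: norm_mult split: split_indicator)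
    show "set_integrable lborel (einterval 0 \<infinity>) F" unfolding e by (rule i)
  qed (use lim0 limi in \<open>auto simp: zero_ereal_def\<close>)
  then show "(LINT y:{0<..}|lborel. F y) = (LINT x:{0<..}|lborel. of_real (2 * x) * F (x\<^sup>2))"
    by (simp add: interval_lebesgue_integral_def e scaleR_conv_of_real)
qed

text \<open>Since \<open>1 - x \<le> 2 - x\<close>, either bound of the region implies
  \<open>\<alpha> + \<beta> < 1\<close>, the inequality behind \<open>p * q > 1\<close>.\<close>

lemma exponent_region_sum:
  assumes "(\<alpha>, \<beta>) \<in> exponent_region"
  shows "0 < \<alpha>" "\<alpha> < 1" "0 < \<beta>" "\<beta> < 1" "\<alpha> + \<beta> < 1"
proof -
  show b: "0 < \<alpha>" "\<alpha> < 1" "0 < \<beta>" "\<beta> < 1" using assms by (auto simp: exponent_region_def)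
  have le: "(1 - x)\<^sup>2 / (2 - x) \<le> 1 - x" if "0 < x" "x < 1" for x :: real
  proof -
    have "(1 - x) * (1 - x) \<le> (1 - x) * (2 - x)" using that by (intro mult_left_mono) auto
    then show ?thesis using that by (simp add: divide_le_eq power2_eq_square)
  qed
  show "\<alpha> + \<beta> < 1" using assms le[of \<alpha>] le[of \<beta>] b by (auto simp: exponent_region_def)
qed

lemma ft_injective:
  assumes "f \<in> borel_measurable borel" "integrable lborel f" "\<And>x. ft f x = 0"
  shows "AE x in lborel. f x = 0"
proof -
  have z: "ft f = (\<lambda>_. 0)" using assms(3) by auto
  show ?thesis
    using ft_inversion[OF assms(1,2)] unfolding z by (simp add: ft_def)
qed

lemma ft_zero_off_0:
  assumes "f \<in> borel_measurable borel" "integrable lborel f" "\<And>x. x \<noteq> 0 \<Longrightarrow> ft f x = 0"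
  shows "ft f x = 0"
proof (rule continuous_AE_eq_0[of UNIV])
  show "continuous_on UNIV (ft f)" using assms by (intro continuous_on_ft)
  show "AE y in lborel. ft f y = 0"
    using AE_lborel_singleton[of 0] by eventually_elim (rule assms(3))
qed auto

text \<open>A chirp has modulus 1, so multiplying \<open>ft f\<close> by it keeps zeros and moments,
  while \<open>chirp_formula\<close> turns the zeros on the second line into zeros of the transform
  of the product.\<close>

lemma parallel_lines_uniqueness:
  assumes "0 < \<alpha>" "\<alpha> < 1" "0 < \<beta>" "\<beta> < 1" "\<alpha> + \<beta> < 1"
  shows "\<exists>K::nat. \<forall>f c1 c2 \<eta> x. c1 > 0 \<longrightarrow> c2 > 0 \<longrightarrow> \<eta> > 0 \<longrightarrow> f \<in> borel_measurable borel \<longrightarrow> integrable lborel f \<longrightarrow>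
    integrable lborel (\<lambda>x. (1 + \<bar>x\<bar>) ^ K * norm (ft f x)) \<longrightarrow>
    (\<forall>(n::nat) s. n \<ge> 1 \<longrightarrow> s \<in> {1, -1} \<longrightarrow> ft f (s * (c1 * real n powr \<alpha>)) = 0) \<longrightarrow>
    (\<forall>(n::nat) s. n \<ge> 1 \<longrightarrow> s \<in> {1, -1} \<longrightarrow>
      (LINT t|lborel. f t * cis (- (s * (c2 * real n powr \<beta>) * t + \<eta> * t\<^sup>2))) = 0) \<longrightarrow>
    ft f x = 0"
proof -
  \<comment> \<open>Here \<open>\<alpha>\<close> belongs to the zeros of \<open>G\<close> and
    \<open>\<beta>\<close> to those of \<open>ft G\<close>, hence the exchanged order of the
    hypotheses.\<close>
  obtain K :: nat where K: "\<forall>G c c' y. c > 0 \<longrightarrow> c' > 0 \<longrightarrow> G \<in> borel_measurable borel \<longrightarrow>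
    integrable lborel (\<lambda>y. (1 + \<bar>y\<bar>) ^ K * norm (G y)) \<longrightarrow> continuous_on (- {0}) G \<longrightarrow>
    (\<forall>(n::nat) s. n \<ge> 1 \<longrightarrow> s \<in> {1, -1} \<longrightarrow> G (s * (c * real n powr \<alpha>)) = 0) \<longrightarrow>
    (\<forall>(n::nat) s. n \<ge> 1 \<longrightarrow> s \<in> {1, -1} \<longrightarrow> ft G (s * (c' * real n powr \<beta>)) = 0) \<longrightarrow>
    y \<noteq> 0 \<longrightarrow> G y = 0"
    using Fourier_uniqueness_powers[OF assms(3,4,1,2)] assms(5) by (auto simp: add.commute)
  show ?thesis
  proof (intro exI[of _ K] allI impI)
    fix f c1 c2 \<eta> x
    assume c: "c1 > (0::real)" "c2 > (0::real)" "\<eta> > (0::real)"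
      and f[measurable]: "f \<in> borel_measurable borel" and fi: "integrable lborel f"
      and gi: "integrable lborel (\<lambda>x. (1 + \<bar>x\<bar>) ^ K * norm (ft f x))"
      and z1: "\<forall>(n::nat) s. n \<ge> 1 \<longrightarrow> s \<in> {1, -1} \<longrightarrow> ft f (s * (c1 * real n powr \<alpha>)) = 0"
      and z2: "\<forall>(n::nat) s. n \<ge> 1 \<longrightarrow> s \<in> {1, -1} \<longrightarrow>
        (LINT t|lborel. f t * cis (- (s * (c2 * real n powr \<beta>) * t + \<eta> * t\<^sup>2))) = 0"
    have gi0: "integrable lborel (ft f)"
      using integrable_of_moment[OF _ gi, of 0] by (simp add: integrable_norm_iff)
    define G where "G x = ft f x * cis (x\<^sup>2 / (4 * \<eta>))" for x
    have Gm[measurable]: "G \<in> borel_measurable borel" unfolding G_def by measurable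
    have "G y = 0" if "y \<noteq> 0" for y
    proof (rule K[rule_format, of c1 "c2 / (2 * \<eta>)"])
      show "integrable lborel (\<lambda>y. (1 + \<bar>y\<bar>) ^ K * norm (G y))" using gi by (simp add: G_def norm_mult)
      show "continuous_on (- {0}) G" unfolding G_def
        using c by (intro continuous_intros continuous_on_ft f fi) auto
      show "G (s * (c1 * real n powr \<alpha>)) = 0" if "n \<ge> 1" "s \<in> {1, -1}" for n :: nat and s
        using z1[rule_format, OF that] by (simp add: G_def)
      show "ft G (s * (c2 / (2 * \<eta>) * real n powr \<beta>)) = 0" if "n \<ge> 1" "s \<in> {1, -1}" for n :: nat and s
      proof -
        have "ft G (s * (c2 * real n powr \<beta>) / (2 * \<eta>)) = 0"
          unfolding G_def using c z2[rule_format, OF that] by (intro chirp_formula f fi gi0) auto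
        then show ?thesis by (simp add: mult_ac)
      qed
    qed (use c that in auto)
    then have "ft f y = 0" if "y \<noteq> 0" for y using that by (force simp: G_def)
    then show "ft f x = 0" by (rule ft_zero_off_0[OF f fi])
  qed
qed

text \<open>The chirp is even, so folding the line at 0 leaves only the even part of
  \<open>h\<close>.\<close>

lemma even_part_chirp:
  fixes h :: "real \<Rightarrow> complex"
  assumes h: "integrable lborel h" and [measurable]: "h \<in> borel_measurable borel"
  shows "(LINT x:{0<..}|lborel. (h x + h (- x)) * cis (l * x\<^sup>2)) = (LINT x|lborel. h x * cis (l * x\<^sup>2))"
proof -
  define k where "k x = h x * cis (l * x\<^sup>2)" for x
  have k: "integrable lborel k" unfolding k_def by (rule integrable_ft_factor[where B=1]) (use h in auto)
  have kS: "set_integrable lborel {0<..} k" "set_integrable lborel {..0} k"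
    unfolding set_integrable_def using k by (auto intro!: integrable_mult_indicator)
  have k': "set_integrable lborel {0<..} (\<lambda>x. k (- x))"
    unfolding set_integrable_def using lborel_integrable_real_affine[OF k, of "-1" 0]
    by (intro integrable_mult_indicator) auto
  have "(LINT x|lborel. indicator {..0} x *\<^sub>R k x) = (LINT x|lborel. indicator {..0} (- x) *\<^sub>R k (- x))"
    by (subst lborel_integral_real_affine[of "-1" _ 0]) auto
  also have "\<dots> = (LINT x|lborel. indicator {0<..} x *\<^sub>R k (- x))"
    using AE_lborel_singleton[of 0] by (intro integral_cong_AE) (auto simp: k_def split: split_indicator)
  finally have refl: "(LINT x:{..0}|lborel. k x) = (LINT x:{0<..}|lborel. k (- x))"
    by (simp add: set_lebesgue_integral_def)
  have "(LINT x|lborel. k x) = (LINT x:{0<..} \<union> {..0}|lborel. k x)"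
  proof -
    have "{0<..} \<union> {..0} = (UNIV :: real set)" by auto
    then show ?thesis by (simp add: set_lebesgue_integral_def)
  qed
  also have "\<dots> = (LINT x:{0<..}|lborel. k x) + (LINT x:{..0}|lborel. k x)"
    by (intro set_integral_Un kS) auto
  also have "\<dots> = (LINT x:{0<..}|lborel. k x + k (- x))"
    unfolding refl by (intro set_integral_add(2)[symmetric] kS k')
  finally show ?thesis by (simp add: k_def distrib_right)
qed

text \<open>At the point of abscissa \<open>\<tau>\<close> on the line of slope \<open>a\<close>,
  \<open>chirp_formula\<close> is used with \<open>\<eta> = a * \<tau>\<close>. The evaluation point
  \<open>\<tau> / (2 * \<eta>) = 1 / (2 * a)\<close> is the same along the whole line, and only the
  chirp rate \<open>1 / (4 * \<eta>)\<close> varies. In the variable \<open>y = x\<^sup>2\<close>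
  this rate becomes a frequency, so that points close to the origin give large zeros.\<close>

lemma concurrent_lines_symmetry:
  assumes "0 < \<alpha>" "\<alpha> < 1" "0 < \<beta>" "\<beta> < 1" "\<alpha> + \<beta> < 1"
  shows "\<exists>K::nat. \<forall>f c1 c2 a x. c1 > 0 \<longrightarrow> c2 > 0 \<longrightarrow> a \<noteq> 0 \<longrightarrow> f \<in> borel_measurable borel \<longrightarrow> integrable lborel f \<longrightarrow>
    integrable lborel (\<lambda>x. (1 + \<bar>x\<bar>) ^ K * norm (ft f x)) \<longrightarrow>
    (\<forall>(n::nat) s. n \<ge> 1 \<longrightarrow> s \<in> {1, -1} \<longrightarrow> ft f (s * (c2 * real n powr (\<beta> / 2))) = 0) \<longrightarrow>
    (\<forall>(n::nat) s. n \<ge> 1 \<longrightarrow> s \<in> {1, -1} \<longrightarrow>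
      (LINT t|lborel. f t * cis (- (s * (c1 * real n powr (- \<alpha>)) * t + s * (a * c1 * real n powr (- \<alpha>)) * t\<^sup>2))) = 0) \<longrightarrow>
    x > 0 \<longrightarrow> ft f x * cis (- (x / (2 * a))) + ft f (- x) * cis (x / (2 * a)) = 0"
proof -
  obtain K :: nat where K: "\<forall>G c c' y. c > 0 \<longrightarrow> c' > 0 \<longrightarrow> G \<in> borel_measurable borel \<longrightarrow>
    integrable lborel (\<lambda>y. (1 + \<bar>y\<bar>) ^ K * norm (G y)) \<longrightarrow> continuous_on (- {0}) G \<longrightarrow>
    (\<forall>(n::nat) s. n \<ge> 1 \<longrightarrow> s \<in> {1, -1} \<longrightarrow> G (s * (c * real n powr \<beta>)) = 0) \<longrightarrow>
    (\<forall>(n::nat) s. n \<ge> 1 \<longrightarrow> s \<in> {1, -1} \<longrightarrow> ft G (s * (c' * real n powr \<alpha>)) = 0) \<longrightarrow>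
    y \<noteq> 0 \<longrightarrow> G y = 0"
    using Fourier_uniqueness_powers[OF assms] by auto
  show ?thesis
  \<comment> \<open>\<open>(1 + x\<^sup>2) ^ K \<le> (1 + \<bar>x\<bar>) ^ (2 * K)\<close>, which
    doubles the order of the weight.\<close>
  proof (intro exI[of _ "2 * K"] allI impI)
    fix f c1 c2 a and x0 :: real
    assume c: "c1 > (0::real)" "c2 > (0::real)" "a \<noteq> (0::real)"
      and f[measurable]: "f \<in> borel_measurable borel" and fi: "integrable lborel f"
      and gi: "integrable lborel (\<lambda>x. (1 + \<bar>x\<bar>) ^ (2 * K) * norm (ft f x))"
      and z1: "\<forall>(n::nat) s. n \<ge> 1 \<longrightarrow> s \<in> {1, -1} \<longrightarrow> ft f (s * (c2 * real n powr (\<beta> / 2))) = 0"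
      and z2: "\<forall>(n::nat) s. n \<ge> 1 \<longrightarrow> s \<in> {1, -1} \<longrightarrow>
      (LINT t|lborel. f t * cis (- (s * (c1 * real n powr (- \<alpha>)) * t + s * (a * c1 * real n powr (- \<alpha>)) * t\<^sup>2))) = 0"
      and x0: "x0 > 0"
    have gi0: "integrable lborel (ft f)"
      using integrable_of_moment[OF _ gi, of 0] by (simp add: integrable_norm_iff)
    define h where "h x = ft f x * cis (- (x / (2 * a)))" for x
    have hm[measurable]: "h \<in> borel_measurable borel" unfolding h_def by measurable
    have hi: "integrable lborel h" unfolding h_def by (rule integrable_ft_factor[where B=1]) (use gi0 in auto)
    have hc: "continuous_on S h" for S
      unfolding h_def using c by (intro continuous_intros continuous_on_ft f fi) auto
    define e where "e x = h x + h (- x)" for x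
    have em[measurable]: "e \<in> borel_measurable borel" unfolding e_def by measurable
    have ec: "continuous_on S e" for S
      unfolding e_def by (intro continuous_intros hc continuous_on_compose2[OF hc[of UNIV]]) auto
    \<comment> \<open>The denominator is the Jacobian of \<open>y = x\<^sup>2\<close>; it may make
      \<open>G\<close> unbounded near 0.\<close>
    define G where "G y = (if y > 0 then e (sqrt y) / (2 * sqrt y) else 0)" for y
    have Gm[measurable]: "G \<in> borel_measurable borel" unfolding G_def by measurable
    have Gsq: "of_real (2 * x) * G (x\<^sup>2) = e x" if "x > 0" for x using that by (simp add: G_def)
    have Gcont: "isCont G y" if "y \<noteq> 0" for y
    proof (cases "y > 0")
      case True
      have i: "isCont (\<lambda>y. e (sqrt y) / (2 * sqrt y)) y"
        using True ec[of UNIV] by (intro continuous_intros continuous_at_compose[unfolded o_def, of y sqrt e])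
          (auto simp: continuous_on_eq_continuous_at)
      have "\<forall>\<^sub>F u in nhds y. G u = e (sqrt u) / (2 * sqrt u)"
        using eventually_nhds_in_open[of "{0<..}" y] True by (auto simp: G_def elim!: eventually_mono)
      from isCont_cong[OF this] i show ?thesis by simp
    next
      case False
      then have "\<forall>\<^sub>F u in nhds y. G u = 0"
        using eventually_nhds_in_open[of "{..<0}" y] that by (auto simp: G_def elim!: eventually_mono)
      then show ?thesis using isCont_cong[of G "\<lambda>_. 0" y] by simp
    qed
    \<comment> \<open>The Jacobian cancels, \<open>2 * x * G (x\<^sup>2) = e x\<close>, so the
      moment of \<open>G\<close> of order \<open>K\<close> is bounded by the moment of
      \<open>h\<close> of order \<open>2 * K\<close>.\<close>
    have subst_int: "set_integrable lborel {0<..} (\<lambda>x. 2 * x * norm (of_real ((1 + \<bar>x\<^sup>2\<bar>) ^ K) * G (x\<^sup>2)))"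
    proof -
      have 1: "integrable lborel (\<lambda>x. (1 + \<bar>x\<bar>) ^ (2 * K) * norm (h x))" using gi by (simp add: h_def norm_mult)
      have 2: "integrable lborel (\<lambda>x. (1 + \<bar>x\<bar>) ^ (2 * K) * norm (h (- x)))"
        using lborel_integrable_real_affine[OF 1, of "-1" 0] by simp
      show ?thesis unfolding set_integrable_def
      proof (rule Bochner_Integration.integrable_bound[OF Bochner_Integration.integrable_add[OF 1 2]])
        have "norm (indicator {0<..} x *\<^sub>R (2 * x * norm (of_real ((1 + \<bar>x\<^sup>2\<bar>) ^ K) * G (x\<^sup>2))))
          \<le> norm ((1 + \<bar>x\<bar>) ^ (2 * K) * norm (h x) + (1 + \<bar>x\<bar>) ^ (2 * K) * norm (h (- x)))" for x
        proof (cases "x > 0")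
          case True
          have "2 * x * norm (of_real ((1 + \<bar>x\<^sup>2\<bar>) ^ K) * G (x\<^sup>2)) = (1 + \<bar>x\<^sup>2\<bar>) ^ K * norm (of_real (2 * x) * G (x\<^sup>2))"
            using True by (simp add: norm_mult norm_power mult_ac del: of_real_power of_real_add)
          also have "\<dots> = (1 + \<bar>x\<^sup>2\<bar>) ^ K * norm (e x)" by (simp only: Gsq[OF True])
          also have "\<dots> \<le> ((1 + \<bar>x\<bar>)\<^sup>2) ^ K * (norm (h x) + norm (h (- x)))"
            unfolding e_def using True
            by (intro mult_mono power_mono norm_triangle_ineq) (auto simp: power2_eq_square algebra_simps)
          also have "\<dots> = (1 + \<bar>x\<bar>) ^ (2 * K) * norm (h x) + (1 + \<bar>x\<bar>) ^ (2 * K) * norm (h (- x))"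
            by (simp add: power_mult distrib_left)
          finally show ?thesis using True by simp
        qed auto
        then show "AE x in lborel. norm (indicator {0<..} x *\<^sub>R (2 * x * norm (of_real ((1 + \<bar>x\<^sup>2\<bar>) ^ K) * G (x\<^sup>2))))
          \<le> norm ((1 + \<bar>x\<bar>) ^ (2 * K) * norm (h x) + (1 + \<bar>x\<bar>) ^ (2 * K) * norm (h (- x)))" by simp
      qed measurable
    qed
    have GK: "integrable lborel (\<lambda>y. (1 + \<bar>y\<bar>) ^ K * norm (G y))"
    proof -
      have "set_integrable lborel {0<..} (\<lambda>y. of_real ((1 + \<bar>y\<bar>) ^ K) * G y)"
        by (rule integral_square_substitution(1)[OF _ subst_int]) (auto intro!: continuous_intros Gcont)
      from integrable_norm[OF this[unfolded set_integrable_def]] show ?thesis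
        by (rule back_subst[of "integrable lborel"])
          (auto simp: fun_eq_iff G_def norm_mult power_abs simp del: of_real_power of_real_add split: split_indicator)
    qed
    have ftG: "ft G l = (LINT x|lborel. h x * cis (- l * x\<^sup>2))" for l
    proof -
      have eint: "integrable lborel e" unfolding e_def
        using hi lborel_integrable_real_affine[OF hi, of "-1" 0] by simp
      have "ft G l = (LINT y:{0<..}|lborel. G y * cis (- (l * y)))"
        unfolding ft_def set_lebesgue_integral_def
        by (intro Bochner_Integration.integral_cong) (auto simp: G_def)
      also have "\<dots> = (LINT x:{0<..}|lborel. of_real (2 * x) * (G (x\<^sup>2) * cis (- (l * x\<^sup>2))))"
      proof (rule integral_square_substitution(2))
        have "integrable lborel (\<lambda>x. indicator {0<..} x *\<^sub>R norm (e x))"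
          using eint by (intro integrable_mult_indicator) auto
        moreover have "indicator {0<..} x *\<^sub>R norm (e x) = indicator {0<..} x *\<^sub>R (2 * x * norm (G (x\<^sup>2) * cis (- (l * x\<^sup>2))))" for x
          using Gsq[of x, symmetric] by (auto simp: norm_mult simp del: of_real_mult split: split_indicator)
        ultimately show "set_integrable lborel {0<..} (\<lambda>x. 2 * x * norm (G (x\<^sup>2) * cis (- (l * x\<^sup>2))))"
          by (simp only: set_integrable_def)
      next
        have "continuous_on UNIV (\<lambda>y. cis (- (l * y)))" by (intro continuous_intros)
        then show "isCont (\<lambda>y. G y * cis (- (l * y))) y" if "y > 0" for y
          using that by (intro isCont_mult Gcont) (auto simp: continuous_on_eq_continuous_at)
      qed auto
      also have "\<dots> = (LINT x:{0<..}|lborel. (h x + h (- x)) * cis (- l * x\<^sup>2))"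
        unfolding set_lebesgue_integral_def using Gsq
        by (intro Bochner_Integration.integral_cong) (auto simp: mult.assoc[symmetric] simp del: of_real_mult simp flip: e_def split: split_indicator)
      also have "\<dots> = (LINT x|lborel. h x * cis (- l * x\<^sup>2))"
        by (rule even_part_chirp[OF hi hm])
      finally show ?thesis .
    qed
    have "G (x0\<^sup>2) = 0"
    proof (rule K[rule_format, of "c2\<^sup>2" "1 / (4 * \<bar>a\<bar> * c1)"])
      show "continuous_on (- {0}) G" by (intro continuous_at_imp_continuous_on) (auto intro: Gcont)
      show "G (s * (c2\<^sup>2 * real n powr \<beta>)) = 0" if n: "n \<ge> 1" and s: "s \<in> {1, -1}" for n :: nat and s
      proof (cases "s = 1")
        case True
        \<comment> \<open>Both \<open>r\<close> and \<open>- r\<close> are zeros of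
          \<open>ft f\<close>, so \<open>e\<close> vanishes at \<open>r\<close> and \<open>G\<close>
          at \<open>r\<^sup>2\<close>.\<close>
        define r where "r = c2 * real n powr (\<beta> / 2)"
        have r: "r > 0" using c n by (simp add: r_def)
        have "c2\<^sup>2 * real n powr \<beta> = r\<^sup>2"
          using n by (simp add: r_def power_mult_distrib powr_power)
        moreover have "ft f r = 0" "ft f (- r) = 0"
          using z1[rule_format, OF n, of 1] z1[rule_format, OF n, of "-1"] by (auto simp: r_def)
        ultimately show ?thesis using r True by (simp add: G_def e_def h_def)
      next
        case False
        \<comment> \<open>At nonpositive points \<open>G\<close> is 0 by definition.\<close>
        then have "s = - 1" using s by auto
        then have "\<not> s * (c2\<^sup>2 * real n powr \<beta>) > 0" by (simp add: not_less)
        then show ?thesis by (simp only: G_def if_False)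
      qed
      show "ft G (s * (1 / (4 * \<bar>a\<bar> * c1) * real n powr \<alpha>)) = 0" if n: "n \<ge> 1" and s: "s \<in> {1, -1}" for n :: nat and s
      proof -
        \<comment> \<open>The sign is chosen so that \<open>1 / (4 * (a * \<tau>))\<close> is minus
          the frequency at which \<open>ft G\<close> is evaluated.\<close>
        define \<tau> where "\<tau> = - s * sgn a * (c1 * real n powr (- \<alpha>))"
        have \<tau>0: "\<tau> \<noteq> 0" using c n s by (auto simp: \<tau>_def sgn_if)
        have s': "- s * sgn a \<in> {1, -1}" using s c by (auto simp: sgn_if)
        have "(LINT t|lborel. f t * cis (- (\<tau> * t + (a * \<tau>) * t\<^sup>2))) = 0"
          using z2[rule_format, OF n s'] by (simp add: \<tau>_def mult_ac)
        then have "ft (\<lambda>x. ft f x * cis (x\<^sup>2 / (4 * (a * \<tau>)))) (\<tau> / (2 * (a * \<tau>))) = 0"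
          using \<tau>0 c by (intro chirp_formula f fi gi0) auto
        moreover have "\<tau> / (2 * (a * \<tau>)) = 1 / (2 * a)" using \<tau>0 by simp
        moreover have "1 / (4 * (a * \<tau>)) = - (s * (1 / (4 * \<bar>a\<bar> * c1) * real n powr \<alpha>))"
          using s c n by (auto simp: \<tau>_def sgn_if powr_minus field_simps)
        then have "x\<^sup>2 / (4 * (a * \<tau>)) = - (s * (1 / (4 * \<bar>a\<bar> * c1) * real n powr \<alpha>)) * x\<^sup>2" for x
          by (metis mult.commute mult_1 times_divide_eq_left)
        ultimately show ?thesis
          unfolding ftG by (simp add: ft_def h_def mult_ac)
      qed
    qed (use c GK x0 in auto)
    then have "e x0 = 0" using Gsq[OF x0] by simp
    then show "ft f x0 * cis (- (x0 / (2 * a))) + ft f (- x0) * cis (x0 / (2 * a)) = 0"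
      by (simp add: e_def h_def)
  qed
qed

subsection \<open>Measures on the parabola\<close>

text \<open>A null set lies in a countable union of nonoverlapping closed intervals of measure at
  most \<open>e\<close>; nonoverlap turns the measure of the union into the sum of the
  lengths.\<close>

lemma null_set_interval_cover:
  fixes N :: "real set"
  assumes N: "N \<in> null_sets lborel" "N \<subseteq> {a..b}" and ab: "a \<le> b" and e: "e > 0"
  obtains u v :: "nat \<Rightarrow> real" where
    "\<And>n. u n \<le> v n" "\<And>n. {u n..v n} \<subseteq> {a..b}" "N \<subseteq> (\<Union>n. {u n..v n})"
    "(\<Sum>n. ennreal (v n - u n)) \<le> ennreal e"
proof -
  have NL: "N \<in> lmeasurable" "measure lebesgue N = 0"
    using null_sets_completionI[OF N(1)] by (auto simp: measure_eq_0_null_sets intro: fmeasurableI_null_sets)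
  obtain \<D> where \<D>: "countable \<D>"
     "\<And>K. K \<in> \<D> \<Longrightarrow> K \<subseteq> cbox a b \<and> K \<noteq> {} \<and> (\<exists>c d. K = cbox c d)"
     "pairwise (\<lambda>A B. interior A \<inter> interior B = {}) \<D>"
     "N \<subseteq> \<Union>\<D>" "\<Union>\<D> \<in> lmeasurable" "measure lebesgue (\<Union>\<D>) \<le> measure lebesgue N + e"
    using measurable_outer_intervals_bounded[OF NL(1) _ e, of a b] N(2) by (metis cbox_interval)
  define A where "A = to_nat_on \<D> ` \<D>"
  \<comment> \<open>Indices outside the enumeration receive a degenerate interval of length
    0.\<close>
  define K where "K n = (if n \<in> A then from_nat_into \<D> n else {a..a})" for n
  have inj: "inj_on (from_nat_into \<D>) A"
    using inj_on_to_nat_on[OF \<D>(1)] \<D>(1) by (auto simp: A_def inj_on_def)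
  have KD: "K n \<in> \<D>" if "n \<in> A" for n using that by (auto simp: K_def A_def intro!: from_nat_into)
  have "\<exists>c d. c \<le> d \<and> K n = {c..d} \<and> {c..d} \<subseteq> {a..b}" for n
  proof (cases "n \<in> A")
    case True
    from \<D>(2)[OF KD[OF True]] obtain c d where cd: "K n = {c..d}" "{c..d} \<subseteq> {a..b}" "{c..d} \<noteq> {}" by auto
    then show ?thesis by (intro exI[of _ c] exI[of _ d]) auto
  next
    case False
    then show ?thesis using ab by (intro exI[of _ a]) (auto simp: K_def)
  qed
  then obtain u v where uv: "\<And>n. u n \<le> v n" "\<And>n. K n = {u n..v n}" "\<And>n. {u n..v n} \<subseteq> {a..b}"
    by metis
  have mK: "measure lebesgue (K n) = v n - u n" for n using uv(1)[of n] by (simp add: uv(2))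
  \<comment> \<open>Intervals with disjoint interiors share at most one point, so finite sums of
    lengths are measures of unions.\<close>
  have neg: "negligible (X \<inter> Y)" if XY: "X \<in> \<D>" "Y \<in> \<D>" "X \<noteq> Y" for X Y
  proof -
    have "interior X \<inter> interior Y = {}" using \<D>(3) XY by (auto simp: pairwise_def)
    moreover obtain p q where X: "X = {p..q}" using \<D>(2)[OF XY(1)] by auto
    moreover obtain x y where Y: "Y = {x..y}" using \<D>(2)[OF XY(2)] by auto
    ultimately have "{max p x<..<min q y} = {}" by auto
    then have "min q y \<le> max p x" by (simp only: greaterThanLessThan_empty_iff)
    then have "X \<inter> Y \<subseteq> {max p x}" unfolding X Y by auto
    then show ?thesis by (rule negligible_subset[OF negligible_sing])
  qed
  have "(\<Sum>n<m. v n - u n) \<le> e" for m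
  proof -
    have K0: "v n - u n = 0" if "n \<notin> A" for n
    proof -
      have "u n \<in> K n" "v n \<in> K n" using uv(1)[of n] by (auto simp: uv(2))
      then show ?thesis using that by (simp add: K_def)
    qed
    have "(\<Sum>n<m. v n - u n) = (\<Sum>n\<in>{..<m} \<inter> A. v n - u n)"
      by (intro sum.mono_neutral_right) (auto simp: K0)
    also have "\<dots> = (\<Sum>n\<in>{..<m} \<inter> A. measure lebesgue (K n))" by (simp add: mK)
    also have "\<dots> = measure lebesgue (\<Union>(K ` ({..<m} \<inter> A)))"
    proof (rule measure_negligible_finite_Union_image[symmetric])
      show "K n \<in> lmeasurable" for n by (simp add: uv)
      show "pairwise (\<lambda>x y. negligible (K x \<inter> K y)) ({..<m} \<inter> A)"
      proof (rule pairwiseI)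
        fix x y assume xy: "x \<in> {..<m} \<inter> A" "y \<in> {..<m} \<inter> A" "x \<noteq> y"
        then have "K x \<noteq> K y" using inj by (auto simp: inj_on_def K_def)
        then show "negligible (K x \<inter> K y)" using xy neg KD by blast
      qed
    qed auto
    also have "\<dots> \<le> measure lebesgue (\<Union>\<D>)"
    proof (rule measure_mono_fmeasurable)
      show "\<Union>(K ` ({..<m} \<inter> A)) \<subseteq> \<Union>\<D>" using KD by auto
      show "\<Union>(K ` ({..<m} \<inter> A)) \<in> sets lebesgue" by (auto simp: uv)
    qed (rule \<D>(5))
    also have "\<dots> \<le> e" using \<D>(6) NL by simp
    finally show ?thesis .
  qed
  then have "(\<Sum>n<m. ennreal (v n - u n)) \<le> ennreal e" for m
    using uv(1) by (subst sum_ennreal) (auto simp: ennreal_leI)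
  then have "(\<Sum>n. ennreal (v n - u n)) \<le> ennreal e"
    by (intro suminf_le_const) auto
  moreover have "N \<subseteq> (\<Union>n. {u n..v n})"
  proof
    fix x assume "x \<in> N"
    then obtain X where X: "X \<in> \<D>" "x \<in> X" using \<D>(4) by auto
    then have "K (to_nat_on \<D> X) = X" using \<D>(1) by (auto simp: K_def A_def)
    then show "x \<in> (\<Union>n. {u n..v n})" using X uv(2) by blast
  qed
  ultimately show ?thesis using uv that by blast
qed

text \<open>The map from \<open>t\<close> to \<open>(t, t\<^sup>2)\<close> has Lipschitz constant
  \<open>1 + 2 * B\<close> on parameters of modulus at most \<open>B\<close>.\<close>

lemma parabola_arc_diameter:
  assumes uv: "u \<le> v" "\<bar>u\<bar> \<le> B" "\<bar>v\<bar> \<le> B"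
  shows "bounded ({z. u \<le> fst z \<and> fst z \<le> v} \<inter> parabola)" (is "bounded ?U")
    and "diameter ({z. u \<le> fst z \<and> fst z \<le> v} \<inter> parabola) \<le> (1 + 2 * B) * (v - u)"
proof -
  have B: "B \<ge> 0" using uv by linarith
  have d: "dist z w \<le> (1 + 2 * B) * (v - u)" if zw: "z \<in> ?U" "w \<in> ?U" for z w
  proof -
    obtain s t where st: "z = (s, s\<^sup>2)" "w = (t, t\<^sup>2)" using zw by (auto simp: parabola_def)
    have b: "u \<le> s" "s \<le> v" "u \<le> t" "t \<le> v" using zw st by auto
    have "dist z w \<le> dist s t + dist (s\<^sup>2) (t\<^sup>2)"
      unfolding st dist_Pair_Pair by (rule sqrt_sum_squares_le_sum) auto
    also have "dist (s\<^sup>2) (t\<^sup>2) = \<bar>s + t\<bar> * dist s t"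
      by (simp add: dist_real_def square_diff_square_factored power2_eq_square abs_mult)
    also have "dist s t + \<bar>s + t\<bar> * dist s t = (1 + \<bar>s + t\<bar>) * dist s t" by (simp add: algebra_simps)
    also have "\<dots> \<le> (1 + 2 * B) * (v - u)"
      using b uv by (intro mult_mono) (auto simp: dist_real_def)
    finally show ?thesis .
  qed
  show "bounded ?U" unfolding bounded_two_points using d by blast
  show "diameter ?U \<le> (1 + 2 * B) * (v - u)"
    using d B uv by (intro diameter_le) (auto simp: dist_norm)
qed

text \<open>Lipschitz images of Lebesgue null sets have one-dimensional Hausdorff measure 0; the
  arcs over a cover of \<open>N\<close> by short intervals form the required covering.\<close>

lemma hausdorff1_parabola_null:
  assumes N: "N \<in> null_sets lborel" "N \<subseteq> {-B..B}" and B: "B \<ge> 0"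
  shows "hausdorff1 ({z. fst z \<in> N} \<inter> parabola) = 0"
proof -
  let ?E = "{z. fst z \<in> N} \<inter> parabola"
  have small: "(INF U\<in>{U :: nat \<Rightarrow> (real \<times> real) set.
                 ?E \<subseteq> (\<Union>n. U n) \<and> (\<forall>n. bounded (U n) \<and> diameter (U n) \<le> \<delta>)}.
          \<Sum>n. ennreal (diameter (U n))) \<le> 0 + ennreal \<epsilon>" (is "?I \<delta> \<le> _") if \<delta>: "\<delta> > 0" and \<epsilon>: "\<epsilon> > 0" for \<delta> \<epsilon> :: real
  proof -
    \<comment> \<open>One budget for two demands: each length is at most the total \<open>e\<close>,
      so every arc has diameter at most \<open>\<delta>\<close>, and all diameters sum to at most
      \<open>\<epsilon>\<close>.\<close>
    define e where "e = min \<delta> \<epsilon> / (1 + 2 * B)"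
    have e: "e > 0" "(1 + 2 * B) * e \<le> \<delta>" "(1 + 2 * B) * e \<le> \<epsilon>"
      using \<delta> \<epsilon> B by (auto simp: e_def)
    have mB: "- B \<le> B" using B by simp
    obtain u v :: "nat \<Rightarrow> real" where uv: "\<And>n. u n \<le> v n" "\<And>n. {u n..v n} \<subseteq> {-B..B}"
      "N \<subseteq> (\<Union>n. {u n..v n})" "(\<Sum>n. ennreal (v n - u n)) \<le> ennreal e"
      by (rule null_set_interval_cover[OF N mB e(1)]) (rule that)
    define U where "U n = {z. u n \<le> fst z \<and> fst z \<le> v n} \<inter> parabola" for n
    have b: "\<bar>u n\<bar> \<le> B" "\<bar>v n\<bar> \<le> B" for n using uv(1)[of n] uv(2)[of n] by auto
    have dU: "bounded (U n)" "diameter (U n) \<le> (1 + 2 * B) * (v n - u n)" for n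
      unfolding U_def using parabola_arc_diameter[OF uv(1) b] by auto
    have le: "v n - u n \<le> e" for n
    proof -
      have "ennreal (v n - u n) = (\<Sum>i\<in>{n}. ennreal (v i - u i))" by simp
      also have "\<dots> \<le> (\<Sum>n. ennreal (v n - u n))" by (intro sum_le_suminf) auto
      finally have "ennreal (v n - u n) \<le> ennreal e" using uv(4) by (rule order_trans)
      then show ?thesis using e by simp
    qed
    have "diameter (U n) \<le> \<delta>" for n
      using dU(2)[of n] mult_left_mono[OF le[of n], of "1 + 2 * B"] e B by linarith
    moreover have "?E \<subseteq> (\<Union>n. U n)"
      using uv(3) by (fastforce simp: U_def)
    ultimately have "(INF U\<in>{U :: nat \<Rightarrow> (real \<times> real) set.
                 ?E \<subseteq> (\<Union>n. U n) \<and> (\<forall>n. bounded (U n) \<and> diameter (U n) \<le> \<delta>)}.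
          \<Sum>n. ennreal (diameter (U n))) \<le> (\<Sum>n. ennreal (diameter (U n)))"
      using dU(1) by (intro INF_lower) auto
    also have "\<dots> \<le> (\<Sum>n. ennreal (1 + 2 * B) * ennreal (v n - u n))"
    proof (intro suminf_le)
      fix n
      have "ennreal (diameter (U n)) \<le> ennreal ((1 + 2 * B) * (v n - u n))" by (intro ennreal_leI dU)
      also have "\<dots> = ennreal (1 + 2 * B) * ennreal (v n - u n)" using B uv(1) by (intro ennreal_mult) auto
      finally show "ennreal (diameter (U n)) \<le> ennreal (1 + 2 * B) * ennreal (v n - u n)" .
    qed auto
    also have "\<dots> = ennreal (1 + 2 * B) * (\<Sum>n. ennreal (v n - u n))" by simp
    also have "\<dots> \<le> ennreal (1 + 2 * B) * ennreal e" using uv(4) by (rule mult_left_mono) simp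
    also have "\<dots> = ennreal ((1 + 2 * B) * e)" using B e by (simp add: ennreal_mult)
    also have "\<dots> \<le> 0 + ennreal \<epsilon>" using e by (simp add: ennreal_leI)
    finally show ?thesis .
  qed
  have "?I \<delta> \<le> 0" if d: "\<delta> > 0" for \<delta> :: real
    by (rule ennreal_le_epsilon) (rule small[OF d])
  then have "hausdorff1 ?E \<le> 0"
    unfolding hausdorff1_def by (intro SUP_least) (simp only: greaterThan_iff)
  then show ?thesis by simp
qed

text \<open>A point of the parabola is determined by its first coordinate, and \<open>ac\<close>
  makes the projected measure absolutely continuous on the line, so the theorem of Radon and Nikodym
  provides the density.\<close>

lemma graph_measure_density:
  fixes m :: "(real \<times> real) measure"
  assumes sets_m [measurable_cong, simp]: "sets m = sets borel" and fin: "finite_measure m"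
    and conc: "AE z in m. z \<in> parabola"
    and ac: "\<And>N. N \<in> null_sets lborel \<Longrightarrow> emeasure m {z. fst z \<in> N} = 0"
  obtains F :: "real \<Rightarrow> real" where "F \<in> borel_measurable borel" "\<And>t. 0 \<le> F t" "integrable lborel F"
    "\<And>g :: real \<times> real \<Rightarrow> complex. g \<in> borel_measurable borel \<Longrightarrow>
       (LINT z|m. g z) = (LINT t|lborel. F t *\<^sub>R g (t, t\<^sup>2))"
proof -
  have sp [simp]: "space m = UNIV" using sets_eq_imp_space_eq[OF sets_m] by simp
  have fst_m [measurable]: "fst \<in> measurable m borel"
    unfolding measurable_cong_sets[OF sets_m refl] borel_prod[symmetric] by measurable
  define \<nu> where "\<nu> = distr m borel fst"
  have "absolutely_continuous lborel \<nu>"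
    unfolding absolutely_continuous_def
  proof
    fix N :: "real set" assume N: "N \<in> null_sets lborel"
    have "emeasure \<nu> N = emeasure m {z. fst z \<in> N}"
      unfolding \<nu>_def using N by (subst emeasure_distr) (auto simp: vimage_def)
    then show "N \<in> null_sets \<nu>"
      using ac[OF N] N by (auto simp: \<nu>_def null_sets_def)
  qed
  moreover have "sets \<nu> = sets lborel" by (simp add: \<nu>_def)
  ultimately obtain f where f[measurable]: "f \<in> borel_measurable lborel" and df: "density lborel f = \<nu>"
    using sigma_finite_measure.Radon_Nikodym[OF sigma_finite_lborel, of \<nu>] by blast
  interpret \<nu>: finite_measure \<nu>
    unfolding \<nu>_def by (rule finite_measure.finite_measure_distr[OF fin]) measurable
  have "(\<integral>\<^sup>+ t. f t \<partial>lborel) = emeasure \<nu> UNIV"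
    unfolding df[symmetric] by (subst emeasure_density) auto
  also have "\<dots> < \<infinity>" using \<nu>.emeasure_finite[of UNIV] by (simp add: less_top[symmetric])
  finally have ff: "(\<integral>\<^sup>+ t. f t \<partial>lborel) < \<infinity>" .
  then have AEf: "AE t in lborel. f t \<noteq> \<infinity>" by (intro nn_integral_noteq_infinite) auto
  \<comment> \<open>The Radon-Nikodym density has values in \<open>ennreal\<close>; it is finite
    almost everywhere because \<open>\<nu>\<close> is finite.\<close>
  define F where "F t = enn2real (f t)" for t
  have Fm[measurable]: "F \<in> borel_measurable borel" unfolding F_def using f by measurable
  have AEF: "AE t in lborel. f t = ennreal (F t)"
    using AEf by eventually_elim (simp add: F_def less_top)
  have d: "density lborel (\<lambda>t. ennreal (F t)) = \<nu>"
    unfolding df[symmetric] using AEF by (intro density_cong) auto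
  have F0: "0 \<le> F t" for t by (simp add: F_def)
  have "(\<integral>\<^sup>+ t. ennreal (F t) \<partial>lborel) = (\<integral>\<^sup>+ t. f t \<partial>lborel)"
    using AEF by (intro nn_integral_cong_AE) auto
  then have Fi: "integrable lborel F" using ff F0 by (intro integrableI_nonneg) auto
  have "(LINT z|m. g z) = (LINT t|lborel. F t *\<^sub>R g (t, t\<^sup>2))"
    if g[measurable]: "g \<in> borel_measurable borel" for g :: "real \<times> real \<Rightarrow> complex"
  proof -
    have gt[measurable]: "(\<lambda>t. g (t, t\<^sup>2)) \<in> borel_measurable borel"
      using g unfolding borel_prod[symmetric] by measurable
    have gm: "g \<in> borel_measurable m" unfolding measurable_cong_sets[OF sets_m refl] by (rule g)
    have gt': "(\<lambda>z. g (fst z, (fst z)\<^sup>2)) \<in> borel_measurable m"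
      using measurable_compose[OF fst_m gt] .
    have "(LINT z|m. g z) = (LINT z|m. g (fst z, (fst z)\<^sup>2))"
      using conc by (intro integral_cong_AE gm gt') (auto simp: parabola_def)
    also have "\<dots> = (LINT t|\<nu>. g (t, t\<^sup>2))"
      unfolding \<nu>_def by (subst integral_distr) auto
    also have "\<dots> = (LINT t|lborel. F t *\<^sub>R g (t, t\<^sup>2))"
      unfolding d[symmetric] by (subst integral_density) (auto simp: F0)
    finally show ?thesis .
  qed
  then show ?thesis using that Fm F0 Fi by blast
qed

text \<open>\<open>ennreal\<close> clips negative values to 0, so the two measures have the positive
  and the negative part of \<open>\<phi>\<close> as densities.\<close>

lemma signed_density_integral:
  fixes g :: "'a \<Rightarrow> complex"
  assumes \<phi>: "integrable \<sigma> (\<phi> :: 'a \<Rightarrow> real)" and g: "g \<in> borel_measurable \<sigma>" "\<And>z. norm (g z) \<le> B"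
  shows "(LINT z|density \<sigma> (\<lambda>z. ennreal (\<phi> z)). g z) - (LINT z|density \<sigma> (\<lambda>z. ennreal (- \<phi> z)). g z) =
    (LINT z|\<sigma>. \<phi> z *\<^sub>R g z)"
proof -
  have [measurable]: "\<phi> \<in> borel_measurable \<sigma>" "g \<in> borel_measurable \<sigma>" using \<phi> g by auto
  have int: "integrable \<sigma> (\<lambda>z. max 0 (s * \<phi> z) *\<^sub>R g z)" if "s \<in> {1, -1}" for s :: real
  proof -
    have "integrable \<sigma> (\<lambda>z. B * \<phi> z)" using \<phi> by simp
    then show ?thesis
    proof (rule Bochner_Integration.integrable_bound)
      have "norm (max 0 (s * \<phi> z) *\<^sub>R g z) \<le> norm (B * \<phi> z)" for z
      proof -
        have "norm (max 0 (s * \<phi> z) *\<^sub>R g z) \<le> \<bar>\<phi> z\<bar> * norm (g z)"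
          unfolding norm_scaleR using that by (intro mult_right_mono) auto
        also have "\<dots> \<le> \<bar>\<phi> z\<bar> * \<bar>B\<bar>" using g(2)[of z] by (intro mult_left_mono) auto
        finally show ?thesis by (simp add: abs_mult mult.commute)
      qed
      then show "AE z in \<sigma>. norm (max 0 (s * \<phi> z) *\<^sub>R g z) \<le> norm (B * \<phi> z)" by simp
    qed measurable
  qed
  have e: "density \<sigma> (\<lambda>z. ennreal (s * \<phi> z)) = density \<sigma> (\<lambda>z. ennreal (max 0 (s * \<phi> z)))" for s
    by (intro density_cong) (auto simp: max_def ennreal_neg)
  have "(LINT z|density \<sigma> (\<lambda>z. ennreal (s * \<phi> z)). g z) = (LINT z|\<sigma>. max 0 (s * \<phi> z) *\<^sub>R g z)" for s
    unfolding e by (subst integral_density) auto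
  from this[of 1] this[of "-1"]
  have "(LINT z|density \<sigma> (\<lambda>z. ennreal (\<phi> z)). g z) - (LINT z|density \<sigma> (\<lambda>z. ennreal (- \<phi> z)). g z) =
     (LINT z|\<sigma>. max 0 (1 * \<phi> z) *\<^sub>R g z) - (LINT z|\<sigma>. max 0 ((-1) * \<phi> z) *\<^sub>R g z)"
    by simp
  also have "\<dots> = (LINT z|\<sigma>. max 0 (1 * \<phi> z) *\<^sub>R g z - max 0 ((-1) * \<phi> z) *\<^sub>R g z)"
    by (intro Bochner_Integration.integral_diff[symmetric] int) auto
  also have "\<dots> = (LINT z|\<sigma>. \<phi> z *\<^sub>R g z)"
    by (intro Bochner_Integration.integral_cong) (auto simp: max_def)
  finally show ?thesis .
qed

text \<open>The supremum over Borel subsets of \<open>E\<close> is attained at the part of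
  \<open>E\<close> where \<open>\<phi>\<close> is positive.\<close>

lemma jordan_pos_density:
  assumes sets_\<sigma>: "sets \<sigma> = sets borel" and \<phi>: "integrable \<sigma> \<phi>"
    and \<nu>: "\<And>E. E \<in> sets borel \<Longrightarrow> \<nu> E = (LINT z:E|\<sigma>. \<phi> z)"
  shows "jordan_pos \<nu> = density \<sigma> (\<lambda>z. ennreal (\<phi> z))"
proof -
  let ?m = "density \<sigma> (\<lambda>z. ennreal (\<phi> z))"
  have sp: "space \<sigma> = UNIV" using sets_eq_imp_space_eq[OF sets_\<sigma>] by simp
  have m[measurable]: "\<phi> \<in> borel_measurable \<sigma>" using \<phi> by auto
  have si: "set_integrable \<sigma> E \<phi>" "set_integrable \<sigma> E (\<lambda>z. max 0 (\<phi> z))" if "E \<in> sets borel" for E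
    using that \<phi> sets_\<sigma> unfolding set_integrable_def by (intro integrable_mult_indicator; simp)+
  have em: "emeasure ?m E = ennreal (LINT z:E|\<sigma>. max 0 (\<phi> z))" if E: "E \<in> sets borel" for E
  proof -
    have "emeasure ?m E = (\<integral>\<^sup>+ z. ennreal (indicator E z *\<^sub>R max 0 (\<phi> z)) \<partial>\<sigma>)"
      using E sets_\<sigma> by (subst emeasure_density)
        (auto intro!: nn_integral_cong simp: max_def ennreal_neg split: split_indicator)
    also have "\<dots> = ennreal (LINT z:E|\<sigma>. max 0 (\<phi> z))"
      unfolding set_lebesgue_integral_def using si(2)[OF E, unfolded set_integrable_def]
      by (intro nn_integral_eq_integral) (auto intro!: AE_I2 simp: max_def split: split_indicator)
    finally show ?thesis .
  qed
  have "(SUP F\<in>{F \<in> sets borel. F \<subseteq> E}. ennreal (\<nu> F)) = emeasure ?m E" if E: "E \<in> sets borel" for E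
  proof (rule antisym)
    show "(SUP F\<in>{F \<in> sets borel. F \<subseteq> E}. ennreal (\<nu> F)) \<le> emeasure ?m E"
    proof (rule SUP_least)
      fix F assume F: "F \<in> {F \<in> sets borel. F \<subseteq> E}"
      then have "\<nu> F = (LINT z:F|\<sigma>. \<phi> z)" using \<nu> by auto
      also have "\<dots> \<le> (LINT z:E|\<sigma>. max 0 (\<phi> z))"
        unfolding set_lebesgue_integral_def
        using F si(1)[of F] si(2)[OF E] unfolding set_integrable_def
        by (intro integral_mono) (auto simp: max_def split: split_indicator)
      finally show "ennreal (\<nu> F) \<le> emeasure ?m E" unfolding em[OF E] by (rule ennreal_leI)
    qed
    define F where "F = E \<inter> {z. \<phi> z > 0}"
    have F: "F \<in> sets borel"
    proof -
      have "{z \<in> space \<sigma>. \<phi> z > 0} \<in> sets \<sigma>" by measurable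
      then show ?thesis using E by (simp add: F_def sp sets_\<sigma>)
    qed
    have "(LINT z:E|\<sigma>. max 0 (\<phi> z)) = (LINT z:F|\<sigma>. \<phi> z)"
      unfolding set_lebesgue_integral_def
      by (intro Bochner_Integration.integral_cong) (auto simp: F_def max_def split: split_indicator)
    then have "emeasure ?m E = ennreal (\<nu> F)" unfolding em[OF E] using \<nu>[OF F] by simp
    also have "\<dots> \<le> (SUP F\<in>{F \<in> sets borel. F \<subseteq> E}. ennreal (\<nu> F))"
      using F by (intro SUP_upper) (auto simp: F_def)
    finally show "emeasure ?m E \<le> (SUP F\<in>{F \<in> sets borel. F \<subseteq> E}. ennreal (\<nu> F))" .
  qed
  then have "jordan_pos \<nu> = measure_of UNIV (sets borel) (emeasure ?m)"
    unfolding jordan_pos_def by (intro measure_of_eq) (auto simp: sets.sigma_sets_eq[of borel, simplified])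
  also have "\<dots> = ?m"
    using measure_of_of_measure[of ?m] by (simp add: sets_\<sigma> sp)
  finally show ?thesis .
qed

section \<open>Null sets of arc length, and densities over the parameter line\<close>

lemma sets_arc_length_measure: "sets (arc_length_measure \<Gamma>) = sets borel"
  unfolding arc_length_measure_def
  by (subst sets_measure_of) (auto simp: sets.sigma_sets_eq[of borel, simplified])

text \<open>Countable additivity of \<open>hausdorff1\<close> is not needed: were it to fail, \<^const>\<open>measure_of\<close> would be the zero measure.\<close>

lemma null_sets_arc_length_measure:
  assumes "E \<in> sets borel" "hausdorff1 (E \<inter> \<Gamma>) = 0"
  shows "E \<in> null_sets (arc_length_measure \<Gamma>)"
proof (rule null_setsI)
  show "emeasure (arc_length_measure \<Gamma>) E = 0"
    unfolding arc_length_measure_def using assms by (subst emeasure_measure_of_conv) auto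
qed (use assms in \<open>simp add: sets_arc_length_measure\<close>)

lemma parabola_closed: "closed parabola"
proof -
  have eq: "parabola = {z. snd z = (fst z)\<^sup>2}" by (auto simp: parabola_def)
  show ?thesis unfolding eq by (intro closed_Collect_eq continuous_intros)
qed

lemma null_sets_arc_length_parabola:
  shows "- parabola \<in> null_sets (arc_length_measure parabola)"
    and "N \<in> null_sets lborel \<Longrightarrow> {z. fst z \<in> N} \<in> null_sets (arc_length_measure parabola)"
proof -
  \<comment> \<open>The intersection is empty, which is the case \<open>N = {}\<close> of
    \<open>hausdorff1_parabola_null\<close>.\<close>
  have "hausdorff1 (- parabola \<inter> parabola) = 0"
    using hausdorff1_parabola_null[of "{}" 0] by simp
  then show "- parabola \<in> null_sets (arc_length_measure parabola)"
    using parabola_closed by (intro null_sets_arc_length_measure) auto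
  assume N: "N \<in> null_sets lborel"
  \<comment> \<open>The Lipschitz bound holds on bounded windows only, so \<open>N\<close> is cut
    into countably many bounded pieces.\<close>
  have "{z :: real \<times> real. fst z \<in> N \<inter> {- real k..real k}} \<in> null_sets (arc_length_measure parabola)" for k :: nat
  proof (rule null_sets_arc_length_measure)
    have "N \<inter> {- real k..real k} \<in> null_sets lborel" using N by (intro null_set_Int2) auto
    then show "hausdorff1 ({z. fst z \<in> N \<inter> {- real k..real k}} \<inter> parabola) = 0"
      by (rule hausdorff1_parabola_null) auto
    have "fst -` (N \<inter> {- real k..real k}) \<inter> space borel \<in> sets (borel :: (real \<times> real) measure)"
      using N unfolding borel_prod[symmetric] by (intro measurable_sets[OF measurable_fst]) auto
    then show "{z :: real \<times> real. fst z \<in> N \<inter> {- real k..real k}} \<in> sets borel" by (simp add: vimage_def)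
  qed
  then have "(\<Union>k. {z :: real \<times> real. fst z \<in> N \<inter> {- real k..real k}}) \<in> null_sets (arc_length_measure parabola)"
    by (intro null_sets_UN)
  also have "(\<Union>k. {z :: real \<times> real. fst z \<in> N \<inter> {- real k..real k}}) = {z. fst z \<in> N}"
  proof -
    have "\<exists>k::nat. - real k \<le> x \<and> x \<le> real k" for x
      using real_arch_simple[of "\<bar>x\<bar>"] by (auto simp: abs_le_iff minus_le_iff)
    then show ?thesis by auto
  qed
  finally show "{z. fst z \<in> N} \<in> null_sets (arc_length_measure parabola)" .
qed

text \<open>The positive and negative parts of \<open>\<phi>\<close> are treated separately, with
  Lebesgue measure on the line as reference. \<open>F\<close> is the difference of the two densities
  and absorbs the arc length factor, which is never computed.\<close>

lemma parabola_density:
  fixes \<phi> :: "real \<times> real \<Rightarrow> real"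
  assumes \<phi>: "integrable (arc_length_measure parabola) \<phi>"
  obtains F :: "real \<Rightarrow> real" where "F \<in> borel_measurable borel" "integrable lborel F"
    "\<And>(g :: real \<times> real \<Rightarrow> complex) B. g \<in> borel_measurable borel \<Longrightarrow> (\<forall>z. norm (g z) \<le> B) \<Longrightarrow>
      (LINT z|arc_length_measure parabola. \<phi> z *\<^sub>R g z) = (LINT t|lborel. F t *\<^sub>R g (t, t\<^sup>2))"
proof -
  let ?\<sigma> = "arc_length_measure parabola"
  note s\<sigma> = sets_arc_length_measure[of parabola]
  have [measurable]: "\<phi> \<in> borel_measurable ?\<sigma>" using \<phi> by auto
  have ex: "\<exists>F. F \<in> borel_measurable borel \<and> integrable lborel F \<and>
    (\<forall>g :: real \<times> real \<Rightarrow> complex. g \<in> borel_measurable borel \<longrightarrow>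
       (LINT z|density ?\<sigma> (\<lambda>z. ennreal (s * \<phi> z)). g z) = (LINT t|lborel. F t *\<^sub>R g (t, t\<^sup>2)))" for s :: real
  proof -
    let ?m = "density ?\<sigma> (\<lambda>z. ennreal (s * \<phi> z))"
    have ac: "absolutely_continuous ?\<sigma> ?m" by (intro absolutely_continuousI_density) measurable
    have null: "E \<in> null_sets ?m" if "E \<in> null_sets ?\<sigma>" for E
      using ac that by (auto simp: absolutely_continuous_def)
    have 1: "sets ?m = sets borel" using s\<sigma> by simp
    have 2: "finite_measure ?m"
    proof (rule finite_measureI)
      have "(\<integral>\<^sup>+ z. ennreal (s * \<phi> z) \<partial>?\<sigma>) \<le> (\<integral>\<^sup>+ z. ennreal (norm (s * \<phi> z)) \<partial>?\<sigma>)"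
        by (intro nn_integral_mono ennreal_leI) auto
      also have "\<dots> < \<infinity>"
        using integrable_mult_right[OF \<phi>, of s] unfolding integrable_iff_bounded by blast
      finally show "emeasure ?m (space ?m) \<noteq> \<infinity>" by (subst emeasure_density) (auto cong: nn_integral_cong)
    qed
    have 3: "AE z in ?m. z \<in> parabola"
      by (rule AE_I'[OF null[OF null_sets_arc_length_parabola(1)]]) auto
    have 4: "emeasure ?m {z. fst z \<in> N} = 0" if "N \<in> null_sets lborel" for N
      using null[OF null_sets_arc_length_parabola(2)[OF that]] by auto
    show ?thesis by (rule graph_measure_density[OF 1 2 3 4]) blast+
  qed
  obtain F1 where F1: "F1 \<in> borel_measurable borel" "integrable lborel F1"
    "\<And>g :: real \<times> real \<Rightarrow> complex. g \<in> borel_measurable borel \<Longrightarrow>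
       (LINT z|density ?\<sigma> (\<lambda>z. ennreal (\<phi> z)). g z) = (LINT t|lborel. F1 t *\<^sub>R g (t, t\<^sup>2))"
    using ex[of 1] by auto
  obtain F2 where F2: "F2 \<in> borel_measurable borel" "integrable lborel F2"
    "\<And>g :: real \<times> real \<Rightarrow> complex. g \<in> borel_measurable borel \<Longrightarrow>
       (LINT z|density ?\<sigma> (\<lambda>z. ennreal (- \<phi> z)). g z) = (LINT t|lborel. F2 t *\<^sub>R g (t, t\<^sup>2))"
    using ex[of "-1"] by auto
  show ?thesis
  proof (rule that[of "\<lambda>t. F1 t - F2 t"])
    fix g :: "real \<times> real \<Rightarrow> complex" and B
    assume g: "g \<in> borel_measurable borel" "\<forall>z. norm (g z) \<le> B"
    have g\<sigma>: "g \<in> borel_measurable ?\<sigma>" unfolding measurable_cong_sets[OF s\<sigma> refl] by (rule g)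
    have gt[measurable]: "(\<lambda>t. g (t, t\<^sup>2)) \<in> borel_measurable borel"
      using g unfolding borel_prod[symmetric] by measurable
    have i: "integrable lborel (\<lambda>t. F t *\<^sub>R g (t, t\<^sup>2))" if F: "F \<in> borel_measurable borel" "integrable lborel F" for F
      using F integrable_ft_factor[of "\<lambda>t. of_real (F t)" "\<lambda>t. g (t, t\<^sup>2)" B] gt g(2)
      by (simp add: scaleR_conv_of_real)
    have "(LINT z|?\<sigma>. \<phi> z *\<^sub>R g z) = (LINT t|lborel. F1 t *\<^sub>R g (t, t\<^sup>2)) - (LINT t|lborel. F2 t *\<^sub>R g (t, t\<^sup>2))"
      using signed_density_integral[OF \<phi> g\<sigma> g(2)[rule_format]] F1(3)[OF g(1)] F2(3)[OF g(1)] by simp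
    also have "\<dots> = (LINT t|lborel. F1 t *\<^sub>R g (t, t\<^sup>2) - F2 t *\<^sub>R g (t, t\<^sup>2))"
      by (intro Bochner_Integration.integral_diff[symmetric] i F1 F2)
    finally show "(LINT z|?\<sigma>. \<phi> z *\<^sub>R g z) = (LINT t|lborel. (F1 t - F2 t) *\<^sub>R g (t, t\<^sup>2))"
      by (simp add: scaleR_diff_left)
  qed (use F1 F2 in auto)
qed

text \<open>Real and imaginary parts of the density are treated separately and recombined. The same
  \<open>F\<close> represents \<open>fourier \<mu>\<close> and \<open>\<mu>\<close> itself, so that
  it suffices to show that \<open>F\<close> is 0 almost everywhere.\<close>

lemma parabola_measure_representation:
  assumes "has_L1_density \<mu> (arc_length_measure parabola)"
  obtains F where "F \<in> borel_measurable borel" "integrable lborel F"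
    "\<And>\<xi> \<eta>. fourier \<mu> (\<xi>, \<eta>) = (LINT t|lborel. F t * cis (- (2 * pi * \<xi> * t + 2 * pi * \<eta> * t\<^sup>2)))"
    "\<And>E. E \<in> sets borel \<Longrightarrow> \<mu> E = (LINT t|lborel. F t * indicator E (t, t\<^sup>2))"
proof -
  let ?\<sigma> = "arc_length_measure parabola"
  note s\<sigma> = sets_arc_length_measure[of parabola]
  obtain f where f: "integrable ?\<sigma> f" "\<And>E. E \<in> sets borel \<Longrightarrow> \<mu> E = (LINT z:E|?\<sigma>. f z)"
    using assms by (auto simp: has_L1_density_def)
  have fE: "integrable ?\<sigma> (\<lambda>z. indicator E z *\<^sub>R f z)" if "E \<in> sets borel" for E
    using that s\<sigma> by (intro integrable_mult_indicator f) auto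
  obtain F1 where F1: "F1 \<in> borel_measurable borel" "integrable lborel F1"
    "\<And>(g :: real \<times> real \<Rightarrow> complex) B. g \<in> borel_measurable borel \<Longrightarrow> (\<forall>z. norm (g z) \<le> B) \<Longrightarrow>
      (LINT z|?\<sigma>. Re (f z) *\<^sub>R g z) = (LINT t|lborel. F1 t *\<^sub>R g (t, t\<^sup>2))"
    by (rule parabola_density[OF integrable_Re[OF f(1)]]) (rule that)
  obtain F2 where F2: "F2 \<in> borel_measurable borel" "integrable lborel F2"
    "\<And>(g :: real \<times> real \<Rightarrow> complex) B. g \<in> borel_measurable borel \<Longrightarrow> (\<forall>z. norm (g z) \<le> B) \<Longrightarrow>
      (LINT z|?\<sigma>. Im (f z) *\<^sub>R g z) = (LINT t|lborel. F2 t *\<^sub>R g (t, t\<^sup>2))"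
    by (rule parabola_density[OF integrable_Im[OF f(1)]]) (rule that)
  define F where "F t = Complex (F1 t) (F2 t)" for t
  have F_eq: "F t = of_real (F1 t) + \<i> * of_real (F2 t)" for t by (simp add: F_def Complex_eq)
  have Fm[measurable]: "F \<in> borel_measurable borel" unfolding F_eq[abs_def] using F1 F2 by measurable
  have Fi: "integrable lborel F" unfolding F_eq[abs_def]
    using F1(2) F2(2) by (intro Bochner_Integration.integrable_add integrable_mult_right integrable_of_real)
  have comb: "(LINT z|?\<sigma>. Re (f z) *\<^sub>R g z) + \<i> * (LINT z|?\<sigma>. Im (f z) *\<^sub>R g z) = (LINT t|lborel. F t * g (t, t\<^sup>2))"
    if g: "g \<in> borel_measurable borel" "\<And>z. norm (g z) \<le> B" for g :: "real \<times> real \<Rightarrow> complex" and B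
  proof -
    have gt[measurable]: "(\<lambda>t. g (t, t\<^sup>2)) \<in> borel_measurable borel"
      using g unfolding borel_prod[symmetric] by measurable
    have i: "integrable lborel (\<lambda>t. H t *\<^sub>R g (t, t\<^sup>2))" if H: "H \<in> borel_measurable borel" "integrable lborel H" for H
      using H integrable_ft_factor[of "\<lambda>t. of_real (H t)" "\<lambda>t. g (t, t\<^sup>2)" B] gt g(2)
      by (simp add: scaleR_conv_of_real)
    have gB: "\<forall>z. norm (g z) \<le> B" using g(2) by simp
    have "(LINT z|?\<sigma>. Re (f z) *\<^sub>R g z) + \<i> * (LINT z|?\<sigma>. Im (f z) *\<^sub>R g z) =
      (LINT t|lborel. F1 t *\<^sub>R g (t, t\<^sup>2)) + (LINT t|lborel. \<i> * F2 t *\<^sub>R g (t, t\<^sup>2))"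
      by (simp only: F1(3)[OF g(1) gB] F2(3)[OF g(1) gB] integral_mult_right_zero)
    also have "\<dots> = (LINT t|lborel. F1 t *\<^sub>R g (t, t\<^sup>2) + \<i> * F2 t *\<^sub>R g (t, t\<^sup>2))"
      by (intro Bochner_Integration.integral_add[symmetric] integrable_mult_right i F1 F2)
    also have "\<dots> = (LINT t|lborel. F t * g (t, t\<^sup>2))"
      by (intro Bochner_Integration.integral_cong) (auto simp: F_eq scaleR_conv_of_real algebra_simps)
    finally show ?thesis .
  qed
  have "fourier \<mu> (\<xi>, \<eta>) = (LINT t|lborel. F t * cis (- (2 * pi * \<xi> * t + 2 * pi * \<eta> * t\<^sup>2)))" for \<xi> \<eta>
  proof -
    define g where "g = (\<lambda>(x, y). exp (- 2 * of_real pi * \<i> * of_real (\<xi> * x + \<eta> * y)))"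
    have g_eq: "g z = cis (- (2 * pi * (\<xi> * fst z + \<eta> * snd z)))" for z
      by (simp add: g_def cis_conv_exp case_prod_beta mult_ac)
    have gm: "g \<in> borel_measurable borel"
      unfolding g_eq[abs_def] by (intro borel_measurable_continuous_onI continuous_intros)
    have g1: "norm (g z) \<le> 1" for z by (simp add: g_eq)
    have g\<sigma>: "g \<in> borel_measurable ?\<sigma>" unfolding measurable_cong_sets[OF s\<sigma> refl] by (rule gm)
    have si: "signed_integral \<nu> g = (LINT z|?\<sigma>. \<phi> z *\<^sub>R g z)"
      if \<phi>: "integrable ?\<sigma> \<phi>" and \<nu>: "\<And>E. E \<in> sets borel \<Longrightarrow> \<nu> E = (LINT z:E|?\<sigma>. \<phi> z)" for \<nu> \<phi>
    proof -
      have "jordan_pos \<nu> = density ?\<sigma> (\<lambda>z. ennreal (\<phi> z))"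
        by (rule jordan_pos_density[OF s\<sigma> \<phi> \<nu>])
      moreover have "jordan_pos (\<lambda>E. - \<nu> E) = density ?\<sigma> (\<lambda>z. ennreal (- \<phi> z))"
        by (rule jordan_pos_density[OF s\<sigma>]) (use \<phi> \<nu> in \<open>auto simp: set_lebesgue_integral_def\<close>)
      ultimately show ?thesis
        unfolding signed_integral_def by (simp add: signed_density_integral[OF \<phi> g\<sigma> g1])
    qed
    have "fourier \<mu> (\<xi>, \<eta>) = signed_integral (\<lambda>E. Re (\<mu> E)) g + \<i> * signed_integral (\<lambda>E. Im (\<mu> E)) g"
      by (simp add: fourier_def complex_measure_integral_def g_def)
    also have "signed_integral (\<lambda>E. Re (\<mu> E)) g = (LINT z|?\<sigma>. Re (f z) *\<^sub>R g z)"
      by (rule si) (use f(1) in \<open>auto simp: f(2) set_lebesgue_integral_def fE simp flip: integral_Re\<close>)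
    also have "signed_integral (\<lambda>E. Im (\<mu> E)) g = (LINT z|?\<sigma>. Im (f z) *\<^sub>R g z)"
      by (rule si) (use f(1) in \<open>auto simp: f(2) set_lebesgue_integral_def fE simp flip: integral_Im\<close>)
    also note comb[OF gm g1]
    finally show ?thesis by (simp add: g_eq algebra_simps)
  qed
  moreover have "\<mu> E = (LINT t|lborel. F t * indicator E (t, t\<^sup>2))" if E: "E \<in> sets borel" for E
  proof -
    have "\<mu> E = (LINT z|?\<sigma>. indicator E z *\<^sub>R f z)" using f(2)[OF E] by (simp add: set_lebesgue_integral_def)
    also have "\<dots> = (LINT z|?\<sigma>. Re (f z) *\<^sub>R indicator E z + \<i> * (Im (f z) *\<^sub>R indicator E z))"
      by (intro Bochner_Integration.integral_cong) (auto simp: complex_eq_iff split: split_indicator)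
    also have "\<dots> = (LINT z|?\<sigma>. Re (f z) *\<^sub>R indicator E z) + \<i> * (LINT z|?\<sigma>. Im (f z) *\<^sub>R indicator E z)"
    proof -
      have "integrable ?\<sigma> (\<lambda>z. Re (f z) *\<^sub>R (indicator E z :: complex))" "integrable ?\<sigma> (\<lambda>z. Im (f z) *\<^sub>R (indicator E z :: complex))"
      proof -
        have *: "integrable ?\<sigma> (\<lambda>z. indicator E z *\<^sub>R complex_of_real (\<phi> z))" if "integrable ?\<sigma> \<phi>" for \<phi>
          using E s\<sigma> that by (intro integrable_mult_indicator integrable_of_real) auto
        have sc: "r *\<^sub>R (indicator E z :: complex) = indicator E z *\<^sub>R complex_of_real r" for r z
          by (auto simp: scaleR_conv_of_real split: split_indicator)
        show "integrable ?\<sigma> (\<lambda>z. Re (f z) *\<^sub>R (indicator E z :: complex))" "integrable ?\<sigma> (\<lambda>z. Im (f z) *\<^sub>R (indicator E z :: complex))"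
          unfolding sc using *[OF integrable_Re[OF f(1)]] *[OF integrable_Im[OF f(1)]] by blast+
      qed
      then show ?thesis
        by (simp only: Bochner_Integration.integral_add integrable_mult_right integral_mult_right_zero)
    qed
    also have "\<dots> = (LINT t|lborel. F t * indicator E (t, t\<^sup>2))"
      using E by (intro comb[where B=1]) (auto split: split_indicator)
    finally show ?thesis .
  qed
  ultimately show ?thesis using that Fm Fi by blast
qed

section \<open>Conclusion for two parallel and for three concurrent lines\<close>

lemma algebraic_curve_parabola: "algebraic_curve parabola"
  unfolding algebraic_curve_def
\<comment> \<open>The outer variable is \<open>y\<close>, so this is the polynomial
  \<open>y - x\<^sup>2\<close>.\<close>
proof (intro exI[of _ "[:[:0, 0, -1:], 1:]"] conjI allI)
  show "parabola = {(x, y). poly (poly [:[:0, 0, -1:], 1:] [:y:]) x = 0}"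
    by (auto simp: parabola_def power2_eq_square)
qed auto

text \<open>Translates the weight of the definition into the moment weight and undoes a dilation,
  which will be the factor \<open>2 * pi\<close> between \<open>fourier\<close> and
  \<open>ft\<close>.\<close>

lemma integrable_weight_rescale:
  fixes u :: "real \<Rightarrow> complex" and r :: real
  assumes [measurable]: "u \<in> borel_measurable borel" and KC: "real K \<le> C" "C > 0" and r: "r > 0"
    and int: "integrable lborel (\<lambda>x. (1 + \<bar>x\<bar> powr C) * norm (u (r * x)))"
  shows "integrable lborel (\<lambda>x. (1 + \<bar>x\<bar>) ^ K * norm (u x))"
proof -
  have bound: "(1 + \<bar>r * x\<bar>) ^ K \<le> ((1 + r) * 2) ^ K * (1 + \<bar>x\<bar> powr C)" for x
  proof -
    have "(1 + \<bar>x\<bar>) ^ K \<le> 2 ^ K * (1 + \<bar>x\<bar> powr C)"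
    proof (cases "\<bar>x\<bar> \<le> 1")
      case True
      then have "(1 + \<bar>x\<bar>) ^ K \<le> 2 ^ K" by (intro power_mono) auto
      also have "\<dots> \<le> 2 ^ K * (1 + \<bar>x\<bar> powr C)" by simp
      finally show ?thesis .
    next
      case False
      then have "(1 + \<bar>x\<bar>) ^ K \<le> (2 * \<bar>x\<bar>) ^ K" by (intro power_mono) auto
      also have "\<dots> = 2 ^ K * \<bar>x\<bar> powr (real K)" using False by (simp add: power_mult_distrib powr_realpow)
      also have "\<dots> \<le> 2 ^ K * (1 + \<bar>x\<bar> powr C)"
      proof -
        have "\<bar>x\<bar> powr real K \<le> \<bar>x\<bar> powr C" using KC False by (intro powr_mono) auto
        then have "\<bar>x\<bar> powr real K \<le> 1 + \<bar>x\<bar> powr C" by linarith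
        then show ?thesis by simp
      qed
      finally show ?thesis .
    qed
    then have "(1 + r) ^ K * (1 + \<bar>x\<bar>) ^ K \<le> (1 + r) ^ K * (2 ^ K * (1 + \<bar>x\<bar> powr C))"
      using r by (intro mult_left_mono) auto
    moreover have "(1 + \<bar>r * x\<bar>) ^ K \<le> ((1 + r) * (1 + \<bar>x\<bar>)) ^ K"
      using r by (intro power_mono) (auto simp: abs_mult algebra_simps)
    ultimately show ?thesis
      by (simp only: power_mult_distrib mult.assoc)
  qed
  have "integrable lborel (\<lambda>x. (1 + \<bar>r * x\<bar>) ^ K * norm (u (r * x)))"
  proof (rule Bochner_Integration.integrable_bound)
    show "integrable lborel (\<lambda>x. ((1 + r) * 2) ^ K * ((1 + \<bar>x\<bar> powr C) * norm (u (r * x))))"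
      using int by (intro integrable_mult_right)
    have "\<bar>(1 + \<bar>r * x\<bar>) ^ K * norm (u (r * x))\<bar> \<le> \<bar>((1 + r) * 2) ^ K * ((1 + \<bar>x\<bar> powr C) * norm (u (r * x)))\<bar>" for x
      using mult_right_mono[OF bound[of x], of "norm (u (r * x))"]
      by (subst abs_of_nonneg, simp) (rule order_trans[OF _ abs_ge_self], simp add: mult_ac)
    then show "AE x in lborel. norm ((1 + \<bar>r * x\<bar>) ^ K * norm (u (r * x))) \<le> norm (((1 + r) * 2) ^ K * ((1 + \<bar>x\<bar> powr C) * norm (u (r * x))))"
      by simp
  qed measurable
  from lborel_integrable_real_affine[OF this, of "1 / r" 0] r show ?thesis by simp
qed

lemma parabola_measure_zero:
  assumes "F \<in> borel_measurable borel" "integrable lborel F" "\<And>x. ft F x = 0"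
    and "\<And>E. E \<in> sets borel \<Longrightarrow> \<mu> E = (LINT t|lborel. F t * indicator E (t, t\<^sup>2))" and E: "E \<in> sets borel"
  shows "\<mu> E = (0 :: complex)"
proof -
  have "AE t in lborel. F t * indicator E (t, t\<^sup>2) = 0"
    using ft_injective[OF assms(1-3)] by eventually_elim simp
  then show ?thesis unfolding assms(4)[OF E] by (rule integral_eq_zero_AE)
qed

text \<open>The two relations form a linear system for \<open>ft F x\<close> and
  \<open>ft F (- x)\<close> with determinant \<open>2 * \<i> * sin (\<delta> * x)\<close>. It is
  nonzero off a countable set, and continuity of \<open>ft F\<close> covers the remaining
  points.\<close>

lemma ft_zero_of_two_symmetries:
  assumes F: "F \<in> borel_measurable borel" "integrable lborel F"
    and ad: "a \<noteq> 0" "d \<noteq> 0" "a \<noteq> d"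
    and sym: "\<And>b x. b \<in> {a, d} \<Longrightarrow> x > 0 \<Longrightarrow> ft F x * cis (- (x / (2 * b))) + ft F (- x) * cis (x / (2 * b)) = 0"
  shows "ft F x = 0"
proof -
  define \<delta> where "\<delta> = 1 / (2 * d) - 1 / (2 * a)"
  have \<delta>: "\<delta> \<noteq> 0" using ad by (simp add: \<delta>_def field_simps)
  have pos: "ft F x = 0 \<and> ft F (- x) = 0" if x: "x > 0" "sin (\<delta> * x) \<noteq> 0" for x
  proof -
    have "ft F x * cis (- (x / (2 * a))) * cis (x / (2 * d)) + ft F (- x) * cis (x / (2 * a)) * cis (x / (2 * d)) = 0"
      using sym[of a x] x by (simp flip: distrib_right)
    moreover have "ft F x * cis (- (x / (2 * d))) * cis (x / (2 * a)) + ft F (- x) * cis (x / (2 * d)) * cis (x / (2 * a)) = 0"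
      using sym[of d x] x by (simp flip: distrib_right)
    moreover have "cis (- (x / (2 * a))) * cis (x / (2 * d)) = cis (\<delta> * x)" "cis (- (x / (2 * d))) * cis (x / (2 * a)) = cis (- (\<delta> * x))"
      by (simp_all add: cis_mult \<delta>_def algebra_simps)
    ultimately have
      "ft F x * cis (\<delta> * x) + ft F (- x) * (cis (x / (2 * a)) * cis (x / (2 * d))) = 0"
      "ft F x * cis (- (\<delta> * x)) + ft F (- x) * (cis (x / (2 * a)) * cis (x / (2 * d))) = 0"
      by (simp_all add: algebra_simps)
    then have "ft F x * cis (\<delta> * x) = ft F x * cis (- (\<delta> * x))" by (metis add_right_cancel)
    then have "ft F x * (cis (\<delta> * x) - cis (- (\<delta> * x))) = 0" by (simp add: right_diff_distrib)
    moreover have "cis (\<delta> * x) - cis (- (\<delta> * x)) \<noteq> 0" using x by (simp add: complex_eq_iff)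
    ultimately have z: "ft F x = 0" by simp
    with sym[of a x] x show ?thesis by simp
  qed
  have "AE x in lborel. x \<notin> {x. sin (\<delta> * x) = 0}"
  proof (rule AE_not_in)
    have "{x. sin (\<delta> * x) = 0} \<subseteq> range (\<lambda>i::int. of_int i * pi / \<delta>)"
      using \<delta> by (auto simp: sin_zero_iff_int2 field_simps)
    then have "countable {x. sin (\<delta> * x) = 0}" by (rule countable_subset) simp
    then show "{x. sin (\<delta> * x) = 0} \<in> null_sets lborel" by (rule countable_imp_null_set_lborel)
  qed
  then have "AE x in lborel. ft F x = 0"
    using AE_lborel_singleton[of 0]
  proof eventually_elim
    case (elim x)
    then show ?case using pos[of x] pos[of "- x"] by (cases "x > 0") auto
  qed
  then show ?thesis
    by (intro continuous_AE_eq_0[of UNIV "ft F"] continuous_on_ft F) auto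
qed

theorem theorem1:
  "(\<forall>c1 c2 \<alpha> \<beta> :: real.
      c1 > 0 \<longrightarrow> c2 > 0 \<longrightarrow> (\<alpha>, \<beta>) \<in> exponent_region \<longrightarrow>
      weak_uniqueness_pair parabola (two_lines c1 c2 \<alpha> \<beta>)) \<and>
   (\<forall>c1 c2 c3 a d \<alpha> \<beta> \<gamma> :: real.
      c1 > 0 \<longrightarrow> c2 > 0 \<longrightarrow> c3 > 0 \<longrightarrow> a \<noteq> 0 \<longrightarrow> d \<noteq> 0 \<longrightarrow> a \<noteq> d \<longrightarrow>
      (\<alpha>, \<beta>) \<in> exponent_region \<longrightarrow> (\<gamma>, \<beta>) \<in> exponent_region \<longrightarrow>
      weak_uniqueness_pair parabola (three_lines c1 c2 c3 a d \<alpha> \<beta> \<gamma>))"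
proof (intro conjI allI impI)
  fix c1 c2 \<alpha> \<beta> :: real
  assume c: "c1 > 0" "c2 > 0" and region: "(\<alpha>, \<beta>) \<in> exponent_region"
  from parallel_lines_uniqueness[OF exponent_region_sum[OF region]] obtain K :: nat where
    K: "\<forall>f c1 c2 \<eta> x. c1 > 0 \<longrightarrow> c2 > 0 \<longrightarrow> \<eta> > 0 \<longrightarrow> f \<in> borel_measurable borel \<longrightarrow> integrable lborel f \<longrightarrow>
    integrable lborel (\<lambda>x. (1 + \<bar>x\<bar>) ^ K * norm (ft f x)) \<longrightarrow>
    (\<forall>(n::nat) s. n \<ge> 1 \<longrightarrow> s \<in> {1, -1} \<longrightarrow> ft f (s * (c1 * real n powr \<alpha>)) = 0) \<longrightarrow>
    (\<forall>(n::nat) s. n \<ge> 1 \<longrightarrow> s \<in> {1, -1} \<longrightarrow>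
      (LINT t|lborel. f t * cis (- (s * (c2 * real n powr \<beta>) * t + \<eta> * t\<^sup>2))) = 0) \<longrightarrow>
    ft f x = 0" by (elim exE)
  show "weak_uniqueness_pair parabola (two_lines c1 c2 \<alpha> \<beta>)"
    unfolding weak_uniqueness_pair_def
  \<comment> \<open>The additional 1 keeps the exponent positive when \<open>K = 0\<close>.\<close>
  proof (intro conjI algebraic_curve_parabola exI[of _ "real K + 1"] allI impI ballI)
    fix \<mu> and E :: "(real \<times> real) set"
    assume dens: "has_L1_density \<mu> (arc_length_measure parabola)"
      and zero: "\<forall>p\<in>two_lines c1 c2 \<alpha> \<beta>. fourier \<mu> p = 0"
      and weight: "integrable lborel (\<lambda>x. (1 + \<bar>x\<bar> powr (real K + 1)) * cmod (fourier \<mu> (x, 0)))"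
      and E: "E \<in> sets borel"
    obtain F where F[measurable]: "F \<in> borel_measurable borel" and Fi: "integrable lborel F"
      and ff: "\<And>\<xi> \<eta>. fourier \<mu> (\<xi>, \<eta>) = (LINT t|lborel. F t * cis (- (2 * pi * \<xi> * t + 2 * pi * \<eta> * t\<^sup>2)))"
      and \<mu>: "\<And>E. E \<in> sets borel \<Longrightarrow> \<mu> E = (LINT t|lborel. F t * indicator E (t, t\<^sup>2))"
      by (rule parabola_measure_representation[OF dens]) (rule that)
    have ff0: "fourier \<mu> (\<xi>, 0) = ft F (2 * pi * \<xi>)" for \<xi> by (simp add: ff ft_def)
    have "ft F x = 0" for x
    \<comment> \<open>The factors \<open>2 * pi\<close> come from angular frequency; the second line
      has height 1, hence \<open>\<eta> = 2 * pi\<close>.\<close>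
    proof (rule K[rule_format, of "2 * pi * c1" "2 * pi * c2" "2 * pi"])
      show "integrable lborel (\<lambda>x. (1 + \<bar>x\<bar>) ^ K * norm (ft F x))"
        using weight unfolding ff0 by (intro integrable_weight_rescale[of "ft F" K "real K + 1" "2 * pi"]) auto
      show "ft F (s * (2 * pi * c1 * real n powr \<alpha>)) = 0" if "n \<ge> 1" "s \<in> {1, -1}" for n :: nat and s
      proof -
        have "(s * (c1 * real n powr \<alpha>), 0) \<in> two_lines c1 c2 \<alpha> \<beta>" using that by (auto simp: two_lines_def)
        then have "fourier \<mu> (s * (c1 * real n powr \<alpha>), 0) = 0" using zero by blast
        then show ?thesis unfolding ff0 by (simp add: mult_ac)
      qed
      show "(LINT t|lborel. F t * cis (- (s * (2 * pi * c2 * real n powr \<beta>) * t + 2 * pi * t\<^sup>2))) = 0"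
        if "n \<ge> 1" "s \<in> {1, -1}" for n :: nat and s
      proof -
        have "(s * (c2 * real n powr \<beta>), 1) \<in> two_lines c1 c2 \<alpha> \<beta>" using that by (auto simp: two_lines_def)
        then have "fourier \<mu> (s * (c2 * real n powr \<beta>), 1) = 0" using zero by blast
        then show ?thesis unfolding ff by (simp add: mult_ac)
      qed
    qed (use c Fi in auto)
    then show "\<mu> E = 0" using parabola_measure_zero[OF F Fi _ \<mu> E] by blast
  qed auto
next
  fix c1 c2 c3 a d \<alpha> \<beta> \<gamma> :: real
  assume c: "c1 > 0" "c2 > 0" "c3 > 0" and ad: "a \<noteq> 0" "d \<noteq> 0" "a \<noteq> d"
    and region: "(\<alpha>, \<beta>) \<in> exponent_region" "(\<gamma>, \<beta>) \<in> exponent_region"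
  \<comment> \<open>Abbreviates the symmetry for a line of exponent \<open>e\<close>, since it is
    used for \<open>\<alpha>\<close> and for \<open>\<gamma>\<close> with the same
    \<open>\<beta>\<close>.\<close>
  define S where "S e K \<longleftrightarrow> (\<forall>f c1 c2 a x. c1 > 0 \<longrightarrow> c2 > 0 \<longrightarrow> a \<noteq> 0 \<longrightarrow> f \<in> borel_measurable borel \<longrightarrow> integrable lborel f \<longrightarrow>
    integrable lborel (\<lambda>x. (1 + \<bar>x\<bar>) ^ K * norm (ft f x)) \<longrightarrow>
    (\<forall>(n::nat) s. n \<ge> 1 \<longrightarrow> s \<in> {1, -1} \<longrightarrow> ft f (s * (c2 * real n powr (\<beta> / 2))) = 0) \<longrightarrow>
    (\<forall>(n::nat) s. n \<ge> 1 \<longrightarrow> s \<in> {1, -1} \<longrightarrow>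
      (LINT t|lborel. f t * cis (- (s * (c1 * real n powr (- e)) * t + s * (a * c1 * real n powr (- e)) * t\<^sup>2))) = 0) \<longrightarrow>
    x > 0 \<longrightarrow> ft f x * cis (- (x / (2 * a))) + ft f (- x) * cis (x / (2 * a)) = 0)" for e and K :: nat
  obtain K1 where K1: "S \<alpha> K1"
    using concurrent_lines_symmetry[OF exponent_region_sum[OF region(1)]] unfolding S_def by (elim exE)
  obtain K2 where K2: "S \<gamma> K2"
    using concurrent_lines_symmetry[OF exponent_region_sum[OF region(2)]] unfolding S_def by (elim exE)
  \<comment> \<open>The larger order lets one weight serve both slopes.\<close>
  define C where "C = real (max K1 K2) + 1"
  have C: "C > 0" "real K1 \<le> C" "real K2 \<le> C" by (auto simp: C_def)
  let ?\<Lambda> = "three_lines c1 c2 c3 a d \<alpha> \<beta> \<gamma>"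
  show "weak_uniqueness_pair parabola ?\<Lambda>"
    unfolding weak_uniqueness_pair_def
  proof (intro conjI algebraic_curve_parabola exI[of _ C] allI impI ballI)
    fix \<mu> and E :: "(real \<times> real) set"
    assume dens: "has_L1_density \<mu> (arc_length_measure parabola)"
      and zero: "\<forall>p\<in>?\<Lambda>. fourier \<mu> p = 0"
      and weight: "integrable lborel (\<lambda>x. (1 + \<bar>x\<bar> powr C) * cmod (fourier \<mu> (x, 0)))"
      and E: "E \<in> sets borel"
    obtain F where F[measurable]: "F \<in> borel_measurable borel" and Fi: "integrable lborel F"
      and ff: "\<And>\<xi> \<eta>. fourier \<mu> (\<xi>, \<eta>) = (LINT t|lborel. F t * cis (- (2 * pi * \<xi> * t + 2 * pi * \<eta> * t\<^sup>2)))"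
      and \<mu>: "\<And>E. E \<in> sets borel \<Longrightarrow> \<mu> E = (LINT t|lborel. F t * indicator E (t, t\<^sup>2))"
      by (rule parabola_measure_representation[OF dens]) (rule that)
    have ff0: "fourier \<mu> (\<xi>, 0) = ft F (2 * pi * \<xi>)" for \<xi> by (simp add: ff ft_def)
    have w: "integrable lborel (\<lambda>x. (1 + \<bar>x\<bar>) ^ K * norm (ft F x))" if "real K \<le> C" for K
      using weight that C unfolding ff0 by (intro integrable_weight_rescale[of "ft F" K C "2 * pi"]) auto
    have z1: "ft F (s * (2 * pi * c2 * real n powr (\<beta> / 2))) = 0" if "s \<in> {1, -1}" for n :: nat and s
    proof -
      have "(s * (c2 * real n powr (\<beta> / 2)), 0) \<in> ?\<Lambda>" using that by (force simp: three_lines_def)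
      then have "fourier \<mu> (s * (c2 * real n powr (\<beta> / 2)), 0) = 0" using zero by blast
      then show ?thesis unfolding ff0 by (simp add: mult_ac)
    qed
    have sym: "ft F x * cis (- (x / (2 * b))) + ft F (- x) * cis (x / (2 * b)) = 0"
      if S: "S e K" "real K \<le> C" and b: "c' > 0" "b \<noteq> 0" and x: "x > 0"
        and mem: "\<And>(n::nat) s. n \<ge> 1 \<Longrightarrow> s \<in> {1, -1} \<Longrightarrow> (s * (c' * real n powr (- e)), s * (b * c' * real n powr (- e))) \<in> ?\<Lambda>"
      for e b c' x K
    proof (rule S(1)[unfolded S_def, rule_format, of "2 * pi * c'" "2 * pi * c2"])
      show "(LINT t|lborel. F t * cis (- (s * (2 * pi * c' * real n powr (- e)) * t + s * (b * (2 * pi * c') * real n powr (- e)) * t\<^sup>2))) = 0"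
        if "n \<ge> 1" "s \<in> {1, -1}" for n :: nat and s
      proof -
        have "fourier \<mu> (s * (c' * real n powr (- e)), s * (b * c' * real n powr (- e))) = 0"
          using zero mem[OF that] by blast
        then show ?thesis unfolding ff by (simp add: mult_ac)
      qed
    qed (use b c x F Fi w[OF S(2)] z1 in auto)
    have "ft F x = 0" for x
    proof (rule ft_zero_of_two_symmetries[OF F Fi ad])
      fix b x :: real assume b: "b \<in> {a, d}" and x: "x > 0"
      show "ft F x * cis (- (x / (2 * b))) + ft F (- x) * cis (x / (2 * b)) = 0"
      proof (cases "b = a")
        case True
        show ?thesis unfolding True
          by (rule sym[OF K1 C(2) c(1) ad(1) x]) (force simp: three_lines_def)
      next
        case False
        then have bd: "b = d" using b by simp
        show ?thesis unfolding bd
          by (rule sym[OF K2 C(3) c(3) ad(2) x]) (force simp: three_lines_def)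
      qed
    qed
    then show "\<mu> E = 0" using parabola_measure_zero[OF F Fi _ \<mu> E] by blast
  qed (use C in auto)
qed
end
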